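(* Let $D$ be a skeletal directed acyclic graph. For any congruence $\equiv$ of $\mathcal{AR}_D$ and any positive coefficients $s\in(\mathbb{R}_{>0})^{\mathbb{I}_\equiv}$, the quotient fan $\mathcal{F}_\equiv$ is the normal fan of the Minkowski sum $\sum_{\rho\in\mathbb{I}_\equiv}s_\rho\,\mathbb{SP}_\rho$ of dilated shard polytopes.
   Context: All directed graphs are finite and simple. A reorientation of a directed acyclic graph $D=(V,A)$ is a directed graph with the same underlying undirected graph, encoded by the set of arcs of $D$ that it reverses. $\mathcal{AR}_D$ is the poset of acyclic reorientations of $D$ ordered by inclusion of sets of reversed arcs. The transitive reduction of a directed acyclic graph is obtained by deleting all arcs whose endpoints are connected by a directed path of length at least $2$. A directed graph is a forest if its underlying undirected graph has no cycle. $D$ is vertebrate if the transitive reduction of every induced subgraph of $D$ is a forest; filled if for any directed path $\pi$ in $D$ whose endpoints are joined by an arc of $D$, all arcs joining any two vertices of $\pi$ belong to $D$; skeletal if vertebrate and filled. When $D$ is skeletal, $\mathcal{AR}_D$ is a lattice. A congruence of a lattice is an equivalence relation compatible with meets and joins; it contracts a join irreducible $J$ (covering a unique element $J_\star$) if $J_\star\equiv J$. Ropes. The transitive support of an arc $(u,v)$ of $D$ is the set of vertices appearing along directed paths in $D$ from $u$ to $v$. A rope of $D$ is a quadruple $(u,v,\nabla,\Delta)$ where $(u,v)\in A$ and $\nabla\sqcup\Delta$ is a partition of the transitive support of $(u,v)$ minus $\{u,v\}$. For a rope $\rho=(u,v,\nabla,\Delta)$, let $I_\vee(\rho)$ be the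 acyclic reorientation of $D$ where an arc $(w,w')$ of $D$ is reversed if and only if $w\in\Delta\cup\{u\}$ and $w'\in\nabla\cup\{v\}$; $\rho\mapsto I_\vee(\rho)$ is a bijection from ropes of $D$ to join irreducibles of $\mathcal{AR}_D$. For a congruence $\equiv$, $\mathbb{I}_\equiv$ is the set of ropes $\rho$ such that $I_\vee(\rho)$ is not contracted by $\equiv$. Fans. For an acyclic reorientation $E$ of $D$, let $\mathbb{C}_E=\{x\in\mathbb{R}^V : x_u\le x_v\text{ for all arcs }(u,v)\text{ of }E\}$. The quotient fan $\mathcal{F}_\equiv$ is the complete fan in $\mathbb{R}^V$ whose chambers are the unions $\bigcup_{E\in X}\mathbb{C}_E$ over the $\equiv$-classes $X$ (these are known to be the chambers of a fan). The normal fan of a polytope $P\subset\mathbb{R}^V$ is formed by the normal cones of its faces, where the normal cone of a face $F$ is the (closed) cone of vectors $v$ for which $x\mapsto\langle v,x\rangle$ is maximized over $P$ at all points of $F$. An empty Minkowski sum is $\{0\}$. Shard polytopes. Let $\rho=(u,v,\nabla,\Delta)$ be a rope and $\pi$ the directed path from $u$ to $v$ in the transitive reduction of $D$ (its vertex set is $\{u,v\}\cup\nabla\cup\Delta$). A $\rho$-alternating matching is a pair $(M_\nabla,M_\Delta)$ with $M_\nabla\subseteq\{u\}\cup\nabla$ and $M_\Delta\subseteq\Delta\cup\{v\}$ that alternate along $\pi$, i.e. $M_\nabla=\{a_1,\dots,a_q\}$ and $M_\Delta=\{b_1,\dots,b_q\}$ with $a_1,b_1,a_2,b_2,\dots,a_q,b_q$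 appearing in this order along $\pi$ ($q\ge0$). The shard polytope $\mathbb{SP}_\rho\subset\mathbb{R}^V$ is the convex hull of the vectors $\sum_{w\in M_\nabla}e_w-\sum_{w\in M_\Delta}e_w$ over all $\rho$-alternating matchings $(M_\nabla,M_\Delta)$. *)

theory Defs
  imports
    "HOL-Algebra.Lattice"
    "HOL-Library.Sublist"
    "HOL-Library.Set_Algebras"
    "HOL-Analysis.Analysis"
begin

text \<open>
  A directed graph is given by its arc relation \<open>A :: 'v rel\<close>; its vertex set is the finite type
  \<open>'v\<close>. An acyclic relation has neither loops nor antiparallel arcs, so \<open>acyclic A\<close> expresses
  that the graph is simple and acyclic. The subgraph induced by \<open>W\<close> has arc relation \<open>Restr A W\<close>;
  vertices outside \<open>W\<close> are then isolated, which affects neither directed paths between distinct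
  vertices nor cycles.
\<close>

subsection \<open>Skeletal directed acyclic graphs\<close>

definition dipath :: "'v rel \<Rightarrow> 'v \<Rightarrow> 'v list \<Rightarrow> 'v \<Rightarrow> bool" where
  "dipath A u p v \<longleftrightarrow>
     p \<noteq> [] \<and> distinct p \<and> successively (\<lambda>x y. (x, y) \<in> A) p \<and> hd p = u \<and> last p = v"

text \<open>Paths are lists of vertices, so a path of length at least 2 has at least 3 vertices.\<close>

definition transitive_reduction :: "'v rel \<Rightarrow> 'v rel" where
  "transitive_reduction A = {(u, v) \<in> A. \<not> (\<exists>p. dipath A u p v \<and> 3 \<le> length p)}"

definition is_forest :: "'v rel \<Rightarrow> bool" where
  "is_forest A \<longleftrightarrow>
     \<not> (\<exists>p. 3 \<le> length p \<and> distinct p \<and>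
          successively (\<lambda>x y. (x, y) \<in> A \<union> A\<inverse>) p \<and> (last p, hd p) \<in> A \<union> A\<inverse>)"

definition vertebrate :: "'v rel \<Rightarrow> bool" where
  "vertebrate A \<longleftrightarrow> (\<forall>W. is_forest (transitive_reduction (Restr A W)))"

text \<open>
  In an acyclic graph, an arc joining two vertices of a directed path is directed along the path;
  hence \<open>sorted_wrt\<close> says that any two vertices of the path are joined by an arc.
\<close>

definition filled :: "'v rel \<Rightarrow> bool" where
  "filled A \<longleftrightarrow>
     (\<forall>u p v. dipath A u p v \<and> (u, v) \<in> A \<longrightarrow> sorted_wrt (\<lambda>x y. (x, y) \<in> A) p)"

definition skeletal :: "'v rel \<Rightarrow> bool" where
  "skeletal A \<longleftrightarrow> vertebrate A \<and> filled A"

subsection \<open>Lattice congruences\<close>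

text \<open>To be used for orders \<open>L\<close> whose \<open>eq\<close> component is equality.\<close>

definition covered_by :: "('a, 'm) gorder_scheme \<Rightarrow> 'a \<Rightarrow> 'a \<Rightarrow> bool" where
  "covered_by L x y \<longleftrightarrow>
     x \<in> carrier L \<and> y \<in> carrier L \<and> x \<sqsubset>\<^bsub>L\<^esub> y \<and>
     \<not> (\<exists>z\<in>carrier L. x \<sqsubset>\<^bsub>L\<^esub> z \<and> z \<sqsubset>\<^bsub>L\<^esub> y)"

definition join_irreducible :: "('a, 'm) gorder_scheme \<Rightarrow> 'a \<Rightarrow> bool" where
  "join_irreducible L J \<longleftrightarrow> J \<in> carrier L \<and> (\<exists>!x. covered_by L x J)"

definition lattice_congruence :: "('a, 'm) gorder_scheme \<Rightarrow> 'a rel \<Rightarrow> bool" where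
  "lattice_congruence L r \<longleftrightarrow>
     equiv (carrier L) r \<and>
     (\<forall>x x' y y'. (x, x') \<in> r \<and> (y, y') \<in> r \<longrightarrow>
        (x \<squnion>\<^bsub>L\<^esub> y, x' \<squnion>\<^bsub>L\<^esub> y') \<in> r \<and> (x \<sqinter>\<^bsub>L\<^esub> y, x' \<sqinter>\<^bsub>L\<^esub> y') \<in> r)"

definition contracts :: "('a, 'm) gorder_scheme \<Rightarrow> 'a rel \<Rightarrow> 'a \<Rightarrow> bool" where
  "contracts L r J \<longleftrightarrow> join_irreducible L J \<and> (THE x. covered_by L x J, J) \<in> r"

subsection \<open>Acyclic reorientations\<close>

definition reorient :: "'v rel \<Rightarrow> 'v rel \<Rightarrow> 'v rel" where
  "reorient A R = (A - R) \<union> R\<inverse>"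

definition acyclic_reorientations :: "'v rel \<Rightarrow> 'v rel gorder" where
  "acyclic_reorientations A = \<lparr>carrier = {R. R \<subseteq> A \<and> acyclic (reorient A R)}, eq = (=), le = (\<subseteq>)\<rparr>"

subsection \<open>Ropes\<close>

text \<open>A rope \<open>(u, v, N, D)\<close> has down set \<open>N\<close> (\<open>\<nabla>\<close>) and up set \<open>D\<close> (\<open>\<Delta>\<close>).\<close>

type_synonym 'v rope = "'v \<times> 'v \<times> 'v set \<times> 'v set"

definition transitive_support :: "'v rel \<Rightarrow> 'v \<Rightarrow> 'v \<Rightarrow> 'v set" where
  "transitive_support A u v = {w. \<exists>p. dipath A u p v \<and> w \<in> set p}"

definition ropes :: "'v rel \<Rightarrow> 'v rope set" where
  "ropes A = {(u, v, N, D). (u, v) \<in> A \<and> N \<inter> D = {} \<and>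
                            N \<union> D = transitive_support A u v - {u, v}}"

definition I_join :: "'v rel \<Rightarrow> 'v rope \<Rightarrow> 'v rel" where
  "I_join A = (\<lambda>(u, v, N, D). {(w, w') \<in> A. w \<in> D \<union> {u} \<and> w' \<in> N \<union> {v}})"

definition uncontracted_ropes :: "'v rel \<Rightarrow> 'v rel rel \<Rightarrow> 'v rope set" where
  "uncontracted_ropes A r = {\<rho> \<in> ropes A. \<not> contracts (acyclic_reorientations A) r (I_join A \<rho>)}"

subsection \<open>Fans\<close>

definition reorientation_cone :: "('v::finite) rel \<Rightarrow> 'v rel \<Rightarrow> (real ^ 'v) set" where
  "reorientation_cone A R = {x. \<forall>(u, v)\<in>reorient A R. x $ u \<le> x $ v}"

text \<open>
  A fan is represented by the set of all its cones. A complete fan consists of the faces of its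
  chambers; \<open>face_of\<close> also admits the empty face, which is not a cone of the fan.
\<close>

definition quotient_fan :: "('v::finite) rel \<Rightarrow> 'v rel rel \<Rightarrow> (real ^ 'v) set set" where
  "quotient_fan A r =
     {C. C \<noteq> {} \<and> (\<exists>X \<in> carrier (acyclic_reorientations A) // r. C face_of (\<Union>R\<in>X. reorientation_cone A R))}"

definition normal_cone :: "('a::real_inner) set \<Rightarrow> 'a set \<Rightarrow> 'a set" where
  "normal_cone P F = {c. \<forall>x\<in>F. \<forall>y\<in>P. c \<bullet> y \<le> c \<bullet> x}"

definition normal_fan :: "('a::real_inner) set \<Rightarrow> 'a set set" where
  "normal_fan P = {normal_cone P F | F. F face_of P \<and> F \<noteq> {}}"

subsection \<open>Shard polytopes\<close>

definition reduced_path :: "'v rel \<Rightarrow> 'v \<Rightarrow> 'v \<Rightarrow> 'v list" where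
  "reduced_path A u v = (THE p. dipath (transitive_reduction A) u p v)"

text \<open>For lists of equal length, \<open>splice [a\<^sub>1, \<dots>, a\<^sub>q] [b\<^sub>1, \<dots>, b\<^sub>q]\<close> is \<open>[a\<^sub>1, b\<^sub>1, \<dots>, a\<^sub>q, b\<^sub>q]\<close>.\<close>

definition alternating_matching :: "'v rel \<Rightarrow> 'v rope \<Rightarrow> 'v set \<Rightarrow> 'v set \<Rightarrow> bool" where
  "alternating_matching A = (\<lambda>(u, v, N, D) MN MD.
     MN \<subseteq> {u} \<union> N \<and> MD \<subseteq> D \<union> {v} \<and>
     (\<exists>as bs. length as = length bs \<and> set as = MN \<and> set bs = MD \<and>
        subseq (splice as bs) (reduced_path A u v)))"

definition shard_polytope :: "('v::finite) rel \<Rightarrow> 'v rope \<Rightarrow> (real ^ 'v) set" where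
  "shard_polytope A \<rho> =
     convex hull {(\<Sum>w\<in>MN. axis w 1) - (\<Sum>w\<in>MD. axis w 1) | MN MD. alternating_matching A \<rho> MN MD}"

end

theory Submission
  imports Defs
begin

text \<open>
  The vertices of a shard polytope are alternating matchings, and a matching maximizes a linear functional
  \<open>c\<close> as soon as no change at a single interval of the path improves it. Such a change compares only two
  coordinates of \<open>c\<close> whose vertices are joined by an arc, so the maximizer is constant on every cone
  \<open>reorientation_cone A R\<close>. It can change across a wall only if the rope of the wall is a subrope of \<open>\<rho>\<close>, and it does
  change if the rope of the wall is \<open>\<rho>\<close> itself. A cover of the lattice lies inside a class iff its rope is
  contracted, and subropes of uncontracted ropes are uncontracted; hence two orientations are congruent
  iff all uncontracted ropes have the same maximizers on them, and the normal cones of the vertices of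
  the Minkowski sum are the unions of the cones of the classes.
\<close>

subsection \<open>Normal fans of polytopes\<close>

text \<open>The obstacle is the boundary of the cones: a functional \<open>c\<close> with ties may
  have several maximizers, so no walk can be read off from \<open>c\<close>. Hence
  \<open>optimal_walk\<close> is determined by the orientation \<open>R\<close> alone. It is unique
  because a linear extension of \<open>R\<close> supplies weights without ties, and it is optimal
  for every \<open>c\<close> in the closed cone of \<open>R\<close>. Conversely, if the point
  belonging to \<open>R\<close> is maximal for \<open>c\<close>, breaking the ties of
  \<open>c\<close> by \<open>R\<close> gives an orientation with the same optimal walks whose cone
  contains \<open>c\<close>. The skeletal hypothesis enters in two ways. The support of an arc
  becomes a chain of pairwise adjacent vertices, so every comparison made by a walk is decided by an
  arc of \<open>A\<close>. And sets of reversed arcs that are closed and coclosed are acyclic, which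
  yields the joins and the tie-broken orientations. Forcing among ropes is read off from hexagons,
  formed by the six orders of three vertices of one support. That the unions of cones over the
  classes are convex is not presupposed: it follows once they are identified with normal
  cones.\<close>

lemma normal_cone_hull:
  fixes X :: "'a::real_inner set"
  shows "normal_cone (convex hull X) {p} = {c. \<forall>q\<in>X. c \<bullet> q \<le> c \<bullet> p}"
proof -
  have "normal_cone Y {p} = {c. \<forall>y\<in>Y. c \<bullet> y \<le> c \<bullet> p}" for Y
    by (simp add: normal_cone_def)
  moreover have "(\<forall>y\<in>convex hull X. c \<bullet> y \<le> c \<bullet> p) = (\<forall>q\<in>X. c \<bullet> q \<le> c \<bullet> p)" for c
  proof
    assume "\<forall>y\<in>convex hull X. c \<bullet> y \<le> c \<bullet> p"
    then show "\<forall>q\<in>X. c \<bullet> q \<le> c \<bullet> p" by (intro ballI) (erule bspec, rule hull_inc)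
  next
    assume "\<forall>q\<in>X. c \<bullet> q \<le> c \<bullet> p"
    then have "convex hull X \<subseteq> {y. c \<bullet> y \<le> c \<bullet> p}"
      by (intro hull_minimal convex_halfspace_le) auto
    then show "\<forall>y\<in>convex hull X. c \<bullet> y \<le> c \<bullet> p" by (simp only: subset_iff mem_Collect_eq Ball_def)
  qed
  ultimately show ?thesis by (simp only:)
qed

text \<open>If a functional in the smaller cone lies strictly between \<open>a\<close> and
  \<open>b\<close>, its defect at a point of \<open>F\<close> is a positive combination of the
  nonnegative defects of \<open>a\<close> and \<open>b\<close>, so both of these vanish.\<close>

lemma face_of_normal_cone:
  assumes "p \<in> F" "F \<subseteq> P"
  shows "normal_cone P F face_of normal_cone P {p}"
  unfolding face_of_def
proof (intro conjI ballI impI)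
  show "normal_cone P F \<subseteq> normal_cone P {p}" using \<open>p \<in> F\<close> unfolding normal_cone_def by auto
  show "convex (normal_cone P F)"
    unfolding normal_cone_def convex_def
    by (auto simp: inner_add_left intro!: add_mono mult_left_mono)
  fix a b c
  assume a: "a \<in> normal_cone P {p}" and b: "b \<in> normal_cone P {p}"
    and c: "c \<in> normal_cone P F" and "c \<in> open_segment a b"
  then obtain t where t: "0 < t" "t < 1" "c = (1 - t) *\<^sub>R a + t *\<^sub>R b"
    by (auto simp: in_segment)
  have eq: "a \<bullet> x = a \<bullet> p \<and> b \<bullet> x = b \<bullet> p" if "x \<in> F" for x
  proof -
    have le: "a \<bullet> x \<le> a \<bullet> p" "b \<bullet> x \<le> b \<bullet> p"
      using a b \<open>x \<in> F\<close> assms unfolding normal_cone_def by auto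
    have "c \<bullet> p \<le> c \<bullet> x" using c \<open>x \<in> F\<close> assms unfolding normal_cone_def by auto
    then have "(1 - t) * (a \<bullet> p - a \<bullet> x) + t * (b \<bullet> p - b \<bullet> x) \<le> 0"
      unfolding t(3) by (simp add: inner_add_left algebra_simps)
    moreover have "0 \<le> (1 - t) * (a \<bullet> p - a \<bullet> x)" "0 \<le> t * (b \<bullet> p - b \<bullet> x)" using t le by auto
    ultimately have "(1 - t) * (a \<bullet> p - a \<bullet> x) = 0" "t * (b \<bullet> p - b \<bullet> x) = 0" by linarith+
    then show ?thesis using t by auto
  qed
  show "a \<in> normal_cone P F" "b \<in> normal_cone P F"
    using a b eq unfolding normal_cone_def by auto
qed

text \<open>The witness is the face of \<open>P\<close> on which a relative interior point
  \<open>c0\<close> of \<open>C\<close> is maximal. Finiteness of \<open>Q\<close> is what allows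
  \<open>c0\<close> to be moved a little in any direction that keeps this face optimal.\<close>

lemma face_of_normal_cone_eq:
  fixes P :: "'a::euclidean_space set"
  assumes P: "P = convex hull Q" "finite Q" and "p \<in> P"
    and C: "C face_of normal_cone P {p}" "C \<noteq> {}"
  shows "\<exists>F. F face_of P \<and> F \<noteq> {} \<and> C = normal_cone P F"
proof -
  have "convex C" using C(1) face_of_imp_convex by blast
  then obtain c0 where c0: "c0 \<in> rel_interior C" using C(2) rel_interior_eq_empty by blast
  have CN: "C \<subseteq> normal_cone P {p}" using C(1) face_of_imp_subset by blast
  have c0C: "c0 \<in> C" using c0 rel_interior_subset by blast
  then have c0N: "c0 \<bullet> y \<le> c0 \<bullet> p" if "y \<in> P" for y
    using CN that unfolding normal_cone_def by auto
  define F where "F = P \<inter> {x. c0 \<bullet> x = c0 \<bullet> p}"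
  have "F face_of P" unfolding F_def
    using P(1) c0N by (intro face_of_Int_supporting_hyperplane_le) auto
  moreover have "p \<in> F" using \<open>p \<in> P\<close> by (simp add: F_def)
  moreover have "C = normal_cone P F"
  proof (intro equalityI subsetI)
    fix c assume "c \<in> C"
    \<comment> \<open>The segment from \<open>c\<close> to \<open>c0\<close> can be prolonged beyond
      \<open>c0\<close> inside \<open>C\<close>. Optimality of \<open>p\<close> at the prolonged
      point bounds \<open>c\<close> on \<open>F\<close> from the other side.\<close>
    obtain m where m: "m > 1" "(1 - m) *\<^sub>R c + m *\<^sub>R c0 \<in> C"
      using convex_rel_interior_if[OF \<open>convex C\<close> c0] hull_inc[OF \<open>c \<in> C\<close>] by (metis order_refl)
    have le: "c \<bullet> y \<le> c \<bullet> p" if "y \<in> P" for y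
      using \<open>c \<in> C\<close> CN that unfolding normal_cone_def by auto
    have "c \<bullet> p = c \<bullet> x" if "x \<in> F" for x
    proof -
      have "((1 - m) *\<^sub>R c + m *\<^sub>R c0) \<bullet> x \<le> ((1 - m) *\<^sub>R c + m *\<^sub>R c0) \<bullet> p"
        using m CN that unfolding normal_cone_def F_def by auto
      then have "(m - 1) * (c \<bullet> p) \<le> (m - 1) * (c \<bullet> x)"
        using that by (simp add: F_def inner_add_left algebra_simps)
      with m have "c \<bullet> p \<le> c \<bullet> x" by simp
      with le that show ?thesis unfolding F_def by force
    qed
    with le show "c \<in> normal_cone P F" unfolding normal_cone_def by auto
  next
    fix d assume d: "d \<in> normal_cone P F"
    show "d \<in> C"
    proof (cases "d = c0")
      case False
      \<comment> \<open>The inequality says that \<open>c0\<close>, pushed away from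
        \<open>d\<close> by the amount \<open>e'\<close>, still prefers \<open>p\<close> to
        \<open>q\<close>. Off \<open>F\<close> the gap of \<open>c0\<close> is positive and absorbs
        a small push; on \<open>F\<close> both sides vanish.\<close>
      have "\<forall>q\<in>Q. \<exists>e>0. \<forall>e'. 0 < e' \<and> e' \<le> e \<longrightarrow> e' * (d \<bullet> q - d \<bullet> p) \<ge> (1 + e') * (c0 \<bullet> q - c0 \<bullet> p)"
      proof
        fix q assume "q \<in> Q"
        then have "q \<in> P" by (simp add: P(1) hull_inc)
        show "\<exists>e>0. \<forall>e'. 0 < e' \<and> e' \<le> e \<longrightarrow> e' * (d \<bullet> q - d \<bullet> p) \<ge> (1 + e') * (c0 \<bullet> q - c0 \<bullet> p)"
        proof (cases "q \<in> F")
          case True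
          then have "d \<bullet> q = d \<bullet> p"
            using d \<open>p \<in> F\<close> \<open>q \<in> P\<close> \<open>p \<in> P\<close> unfolding normal_cone_def by (auto intro: antisym)
          with True show ?thesis by (intro exI[of _ 1]) (auto simp: F_def)
        next
          case False
          define \<delta> where "\<delta> = c0 \<bullet> p - c0 \<bullet> q"
          define D where "D = \<bar>d \<bullet> q - d \<bullet> p\<bar> + 1"
          have pos: "\<delta> > 0" "D > 0"
            using False c0N[OF \<open>q \<in> P\<close>] \<open>q \<in> P\<close> unfolding F_def \<delta>_def D_def by auto
          show ?thesis
          proof (intro exI[of _ "\<delta> / D"] conjI allI impI)
            fix e' assume e': "0 < e' \<and> e' \<le> \<delta> / D"
            then have "e' * D \<le> \<delta>" using pos by (simp add: field_simps)
            moreover have "- (e' * D) \<le> e' * (d \<bullet> q - d \<bullet> p)"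
            proof -
              have "- D \<le> d \<bullet> q - d \<bullet> p" unfolding D_def by linarith
              from mult_left_mono[OF this, of e'] e' show ?thesis by simp
            qed
            moreover have "0 \<le> e' * \<delta>" using e' pos by simp
            ultimately show "(1 + e') * (c0 \<bullet> q - c0 \<bullet> p) \<le> e' * (d \<bullet> q - d \<bullet> p)"
              unfolding \<delta>_def by (simp add: algebra_simps)
          qed (use pos in simp)
        qed
      qed
      from bchoice[OF this] obtain e where e: "\<And>q. q \<in> Q \<Longrightarrow> e q > 0"
        "\<And>q e'. q \<in> Q \<Longrightarrow> 0 < e' \<Longrightarrow> e' \<le> e q \<Longrightarrow>
           e' * (d \<bullet> q - d \<bullet> p) \<ge> (1 + e') * (c0 \<bullet> q - c0 \<bullet> p)"
        by blast
      \<comment> \<open>The inserted 1 keeps the argument of \<open>Min\<close> nonempty whatever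
        \<open>Q\<close> is.\<close>
      define \<epsilon> where "\<epsilon> = Min (insert 1 (e ` Q))"
      have \<epsilon>: "0 < \<epsilon>" "\<And>q. q \<in> Q \<Longrightarrow> \<epsilon> \<le> e q"
        unfolding \<epsilon>_def using P(2) e(1) by auto
      define b where "b = (1 + \<epsilon>) *\<^sub>R c0 - \<epsilon> *\<^sub>R d"
      have "b \<bullet> q \<le> b \<bullet> p" if "q \<in> Q" for q
        using e(2)[OF that \<epsilon>(1) \<epsilon>(2)[OF that]]
        unfolding b_def by (simp add: inner_diff_left algebra_simps)
      then have "Q \<subseteq> {y. b \<bullet> y \<le> b \<bullet> p}" by blast
      then have "P \<subseteq> {y. b \<bullet> y \<le> b \<bullet> p}"
        unfolding P(1) by (intro hull_minimal convex_halfspace_le)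
      then have bN: "b \<in> normal_cone P {p}" unfolding normal_cone_def by auto
      have dN: "d \<in> normal_cone P {p}" using d \<open>p \<in> F\<close> unfolding normal_cone_def by auto
      have "c0 = (1 - 1 / (1 + \<epsilon>)) *\<^sub>R d + (1 / (1 + \<epsilon>)) *\<^sub>R b"
      proof -
        have "1 - 1 / (1 + \<epsilon>) = \<epsilon> / (1 + \<epsilon>)" using \<epsilon>(1) by (simp add: field_simps)
        then show ?thesis using \<epsilon>(1) unfolding b_def by (simp add: scaleR_diff_right)
      qed
      moreover have "b \<noteq> d"
      proof
        assume "b = d"
        then have "(1 + \<epsilon>) *\<^sub>R c0 = (1 + \<epsilon>) *\<^sub>R d" unfolding b_def by (simp add: algebra_simps)
        with \<epsilon>(1) False show False by simp
      qed
      ultimately have "c0 \<in> open_segment d b"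
        using \<epsilon>(1) by (auto simp: in_segment intro!: exI[of _ "1 / (1 + \<epsilon>)"])
      then show ?thesis using C(1) bN dN c0C unfolding face_of_def by blast
    qed (use c0C in simp)
  qed
  ultimately show ?thesis by blast
qed

text \<open>The points of \<open>W\<close> need not be known to be vertices; it is enough that their
  normal cones cover the space. A functional exposing a face \<open>F\<close> lies in the cone of
  some \<open>p\<close> in \<open>W\<close>, and this \<open>p\<close> must then belong to
  \<open>F\<close>.\<close>

lemma normal_fan_eq_faces:
  fixes P :: "'a::euclidean_space set"
  assumes P: "P = convex hull Q" "finite Q" and W: "W \<subseteq> P"
    and cover: "\<And>c. \<exists>p\<in>W. c \<in> normal_cone P {p}"
  shows "normal_fan P = {C. C \<noteq> {} \<and> (\<exists>p\<in>W. C face_of normal_cone P {p})}"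
proof (intro equalityI subsetI)
  fix C assume "C \<in> normal_fan P"
  then obtain F where F: "C = normal_cone P F" "F face_of P" "F \<noteq> {}"
    unfolding normal_fan_def by blast
  have "F exposed_face_of P"
    using F(2) P by (simp add: exposed_face_of_polyhedron polyhedron_convex_hull)
  then obtain c b where c: "P \<subseteq> {x. c \<bullet> x \<le> b}" "F = P \<inter> {x. c \<bullet> x = b}"
    unfolding exposed_face_of_def by blast
  obtain p where p: "p \<in> W" "c \<in> normal_cone P {p}" using cover by blast
  obtain x where "x \<in> F" using F(3) by blast
  then have "c \<bullet> x \<le> c \<bullet> p" "c \<bullet> x = b" using p(2) c(2) unfolding normal_cone_def by auto
  then have "p \<in> F" using c p(1) W by force
  moreover have "c \<in> normal_cone P F" unfolding normal_cone_def using c by auto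
  ultimately show "C \<in> {C. C \<noteq> {} \<and> (\<exists>p\<in>W. C face_of normal_cone P {p})}"
    using face_of_normal_cone F face_of_imp_subset p(1) by blast
next
  fix C assume "C \<in> {C. C \<noteq> {} \<and> (\<exists>p\<in>W. C face_of normal_cone P {p})}"
  then show "C \<in> normal_fan P"
    using face_of_normal_cone_eq[OF P] W unfolding normal_fan_def by blast
qed

subsection \<open>Alternating matchings as walks\<close>

text \<open>
  A walk \<open>S\<close> encodes an alternating matching on a path with vertices \<open>0, \<dots>, n - 1\<close>: \<open>i \<in> S\<close> iff an odd
  number of vertices smaller than \<open>i\<close> are matched, so that \<open>a\<^sub>1, a\<^sub>2, \<dots>\<close> are the vertices at which \<open>S\<close> is
  entered (\<open>up\<close>) and \<open>b\<^sub>1, b\<^sub>2, \<dots>\<close> those at which it is left (\<open>dn\<close>). Summation by parts makes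
  \<open>walk_sum y S\<close> the weight of this matching, and flipping an interval \<open>{i<..j}\<close> changes it by
  \<open>y i - y j\<close>; thus stability refers only to the order \<open>T\<close> of pairs of vertices.
\<close>

definition walk :: "nat \<Rightarrow> (nat \<Rightarrow> bool) \<Rightarrow> (nat \<Rightarrow> bool) \<Rightarrow> nat set \<Rightarrow> bool" where
  "walk n up dn S \<longleftrightarrow> S \<subseteq> {0<..<n} \<and>
     (\<forall>i<n. (i \<in> S \<and> Suc i \<notin> S \<longrightarrow> dn i) \<and> (i \<notin> S \<and> Suc i \<in> S \<longrightarrow> up i))"

definition walk_sum :: "(nat \<Rightarrow> 'a::ab_group_add) \<Rightarrow> nat set \<Rightarrow> 'a" where
  "walk_sum y S = (\<Sum>i\<in>S. y (i - 1) - y i)"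

definition stable :: "nat \<Rightarrow> (nat \<Rightarrow> bool) \<Rightarrow> (nat \<Rightarrow> bool) \<Rightarrow> (nat \<Rightarrow> nat \<Rightarrow> bool) \<Rightarrow> nat set \<Rightarrow> bool" where
  "stable n up dn T S \<longleftrightarrow> walk n up dn S \<and>
     (\<forall>i j. i < j \<and> j < n \<longrightarrow>
        ({i<..j} \<inter> S = {} \<and> walk n up dn (S \<union> {i<..j}) \<longrightarrow> \<not> T i j) \<and>
        ({i<..j} \<subseteq> S \<and> walk n up dn (S - {i<..j}) \<longrightarrow> T i j))"

lemma finite_walk: "walk n up dn S \<Longrightarrow> finite S"
  unfolding walk_def using finite_subset by blast

lemma finite_walks: "finite {S. walk n up dn S}"
  by (rule finite_subset[of _ "Pow {0<..<n}"]) (auto simp: walk_def)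

lemma walk_empty: "walk n up dn {}"
  by (simp add: walk_def)

lemma walk_sum_interval: "i \<le> j \<Longrightarrow> walk_sum y {i<..j} = y i - y j"
proof (induction j rule: dec_induct)
  case (step j)
  then have "{i<..Suc j} = insert (Suc j) {i<..j}" by auto
  with step show ?case by (simp add: walk_sum_def)
qed (simp add: walk_sum_def)

lemma walk_sum_Un: "finite S \<Longrightarrow> finite I \<Longrightarrow> I \<inter> S = {} \<Longrightarrow> walk_sum y (S \<union> I) = walk_sum y S + walk_sum y I"
  unfolding walk_sum_def by (rule sum.union_disjoint) auto

lemma walk_sum_Un_interval:
  "finite S \<Longrightarrow> i \<le> j \<Longrightarrow> {i<..j} \<inter> S = {} \<Longrightarrow> walk_sum y (S \<union> {i<..j}) = walk_sum y S + (y i - y j)"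
  by (simp add: walk_sum_Un walk_sum_interval)

lemma walk_sum_Diff_interval:
  assumes "finite S" "i \<le> j" "{i<..j} \<subseteq> S"
  shows "walk_sum y (S - {i<..j}) = walk_sum y S - (y i - y j)"
proof -
  have "walk_sum y ((S - {i<..j}) \<union> {i<..j}) = walk_sum y (S - {i<..j}) + (y i - y j)"
    using assms by (intro walk_sum_Un_interval) auto
  moreover have "(S - {i<..j}) \<union> {i<..j} = S" using assms by auto
  ultimately show ?thesis by simp
qed

text \<open>The flipped interval is the maximal run of \<open>S' - S\<close> starting at
  \<open>m\<close>. Each of its two ends needs a label in the modified walk. If the walk that is
  modified does not provide it, the other one does: the walks agree just before the run, and just
  after it \<open>S'\<close> cannot be inside while \<open>S\<close> is outside.\<close>

lemma walk_leftmost_flip: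
  assumes S: "walk n up dn S" and S': "walk n up dn S'"
    and m: "m \<in> S' - S" and min: "\<And>k. k < m \<Longrightarrow> k \<in> S \<longleftrightarrow> k \<in> S'"
  obtains i j where "i < j" "j < n" "{i<..j} \<inter> S = {}" "{i<..j} \<subseteq> S'"
    "walk n up dn (S \<union> {i<..j})" "walk n up dn (S' - {i<..j})"
proof -
  have bS: "S \<subseteq> {0<..<n}" "S' \<subseteq> {0<..<n}" using S S' unfolding walk_def by auto
  have m0: "0 < m" "m < n" using m bS by auto
  define J where "J = {j. m \<le> j \<and> {m..j} \<subseteq> S' - S}"
  have "J \<subseteq> {..<n}" unfolding J_def using bS by fastforce
  then have fJ: "finite J" using finite_subset by blast
  have "m \<in> J" unfolding J_def using m by auto
  define j where "j = Max J"
  have jJ: "j \<in> J" unfolding j_def using fJ \<open>m \<in> J\<close> by (metis Max_in empty_iff)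
  have "Suc j \<notin> J" using Max_ge[OF fJ, of "Suc j"] unfolding j_def by auto
  have mj: "m \<le> j" "{m..j} \<subseteq> S' - S" using jJ unfolding J_def by auto
  then have nx: "\<not> (Suc j \<in> S' \<and> Suc j \<notin> S)"
    using \<open>Suc j \<notin> J\<close> unfolding J_def by (auto simp: atLeastAtMostSuc_conv)
  have jn: "j < n" using \<open>J \<subseteq> {..<n}\<close> jJ by auto
  define i where "i = m - 1"
  have I: "{i<..j} = {m..j}" unfolding i_def using m0 by auto
  have im: "Suc i = m" "i < m" unfolding i_def using m0 by auto
  have agree: "i \<in> S \<longleftrightarrow> i \<in> S'" using min im by blast
  show thesis
  proof (rule that[of i j])
    show "i < j" using im mj by auto
    show "j < n" by (rule jn)
    show "{i<..j} \<inter> S = {}" "{i<..j} \<subseteq> S'" using mj I by auto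
    show "walk n up dn (S \<union> {i<..j})"
      unfolding walk_def
    proof (intro conjI allI impI)
      show "S \<union> {i<..j} \<subseteq> {0<..<n}" using bS mj I by auto
      fix t assume "t < n"
      have tS: "t \<in> S \<Longrightarrow> Suc t \<notin> S \<Longrightarrow> dn t" "t \<notin> S \<Longrightarrow> Suc t \<in> S \<Longrightarrow> up t"
        "t \<in> S' \<Longrightarrow> Suc t \<notin> S' \<Longrightarrow> dn t" "t \<notin> S' \<Longrightarrow> Suc t \<in> S' \<Longrightarrow> up t"
        using S S' \<open>t < n\<close> unfolding walk_def by auto
      { assume a: "t \<in> S \<union> {i<..j} \<and> Suc t \<notin> S \<union> {i<..j}"
        show "dn t"
        proof (cases "t = j")
          case True
          then have "t \<in> S'" "Suc t \<notin> S'" using a nx mj by auto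
          then show ?thesis by (rule tS)
        next
          case False
          then have "t \<in> S" "Suc t \<notin> S" using a by auto
          then show ?thesis by (rule tS)
        qed }
      { assume a: "t \<notin> S \<union> {i<..j} \<and> Suc t \<in> S \<union> {i<..j}"
        show "up t"
        proof (cases "t = i")
          case True
          then have "t \<notin> S'" "Suc t \<in> S'" using a agree im m by auto
          then show ?thesis by (rule tS)
        next
          case False
          then have "t \<notin> S" "Suc t \<in> S" using a by auto
          then show ?thesis by (rule tS)
        qed }
    qed
    show "walk n up dn (S' - {i<..j})"
      unfolding walk_def
    proof (intro conjI allI impI)
      show "S' - {i<..j} \<subseteq> {0<..<n}" using bS mj I by auto
      fix t assume "t < n"
      have tS: "t \<in> S \<Longrightarrow> Suc t \<notin> S \<Longrightarrow> dn t" "t \<notin> S \<Longrightarrow> Suc t \<in> S \<Longrightarrow> up t"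
        "t \<in> S' \<Longrightarrow> Suc t \<notin> S' \<Longrightarrow> dn t" "t \<notin> S' \<Longrightarrow> Suc t \<in> S' \<Longrightarrow> up t"
        using S S' \<open>t < n\<close> unfolding walk_def by auto
      { assume a: "t \<in> S' - {i<..j} \<and> Suc t \<notin> S' - {i<..j}"
        show "dn t"
        proof (cases "t = i")
          case True
          then have "t \<in> S" "Suc t \<notin> S" using a agree im m by auto
          then show ?thesis by (rule tS)
        next
          case False
          then have "t \<in> S'" "Suc t \<notin> S'" using a by auto
          then show ?thesis by (rule tS)
        qed }
      { assume a: "t \<notin> S' - {i<..j} \<and> Suc t \<in> S' - {i<..j}"
        show "up t"
        proof (cases "t = j")
          case True
          then have "t \<notin> S" "Suc t \<in> S" using a nx mj by auto
          then show ?thesis by (rule tS)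
        next
          case False
          then have "t \<notin> S'" "Suc t \<in> S'" using a by auto
          then show ?thesis by (rule tS)
        qed }
    qed
  qed
qed

text \<open>A walk that no single interval flip improves is optimal: undoing in \<open>S'\<close> the leftmost run on
  which it differs from \<open>S\<close> changes its weight by the same amount as flipping that run in \<open>S\<close>.\<close>

lemma stable_walk_sum:
  fixes y :: "nat \<Rightarrow> real"
  assumes S: "stable n up dn T S"
    and y: "\<And>i j. i < j \<Longrightarrow> j < n \<Longrightarrow> (T i j \<longrightarrow> y j \<le> y i) \<and> (\<not> T i j \<longrightarrow> y i \<le> y j)"
    and S': "walk n up dn S'"
  shows "walk_sum y S' \<le> walk_sum y S \<and>
    ((\<forall>i j. i < j \<and> j < n \<longrightarrow> y i \<noteq> y j) \<and> S' \<noteq> S \<longrightarrow> walk_sum y S' < walk_sum y S)"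
  using S'
proof (induction "card ((S - S') \<union> (S' - S))" arbitrary: S' rule: less_induct)
  case less
  have wS: "walk n up dn S" using S unfolding stable_def by simp
  note fin = finite_walk[OF wS] finite_walk[OF less.prems]
  define D where "D = (S - S') \<union> (S' - S)"
  have fD: "finite D" unfolding D_def using fin by auto
  show ?case
  proof (cases "D = {}")
    case True
    then have "S' = S" unfolding D_def by auto
    then show ?thesis by simp
  next
    case False
    define m where "m = (LEAST m. m \<in> D)"
    have mD: "m \<in> D" unfolding m_def using False by (metis LeastI all_not_in_conv)
    have min: "k \<in> S \<longleftrightarrow> k \<in> S'" if "k < m" for k
      using not_less_Least[of k "\<lambda>m. m \<in> D"] that unfolding m_def D_def by auto
    have card: "card ((S - S'') \<union> (S'' - S)) < card ((S - S') \<union> (S' - S))"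
      if "i < j" "(S - S'') \<union> (S'' - S) = D - {i<..j}" "{i<..j} \<subseteq> D" for S'' and i j :: nat
    proof -
      have "j \<in> {i<..j}" using that(1) by simp
      then have "D - {i<..j} \<subset> D" using that(3) by blast
      then show ?thesis using psubset_card_mono[OF fD] that(2) unfolding D_def by simp
    qed
    from mD consider "m \<in> S' - S" | "m \<in> S - S'" unfolding D_def by blast
    then show ?thesis
    proof cases
      case 1
      obtain i j where ij: "i < j" "j < n" "{i<..j} \<inter> S = {}" "{i<..j} \<subseteq> S'"
        "walk n up dn (S \<union> {i<..j})" "walk n up dn (S' - {i<..j})"
        using walk_leftmost_flip[OF wS less.prems 1 min] by blast
      have "walk_sum y (S' - {i<..j}) \<le> walk_sum y S"
        using ij by (intro less.hyps[THEN conjunct1] card[of i j]) (auto simp: D_def)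
      moreover have "walk_sum y (S' - {i<..j}) = walk_sum y S' - (y i - y j)"
        using ij fin by (intro walk_sum_Diff_interval) auto
      moreover have "\<not> T i j" using S ij unfolding stable_def by blast
      then have "y i \<le> y j" using y ij by blast
      ultimately show ?thesis using ij(1,2) by force
    next
      case 2
      obtain i j where ij: "i < j" "j < n" "{i<..j} \<inter> S' = {}" "{i<..j} \<subseteq> S"
        "walk n up dn (S' \<union> {i<..j})" "walk n up dn (S - {i<..j})"
        using walk_leftmost_flip[OF less.prems wS 2] min by blast
      have "walk_sum y (S' \<union> {i<..j}) \<le> walk_sum y S"
        using ij by (intro less.hyps[THEN conjunct1] card[of i j]) (auto simp: D_def)
      moreover have "walk_sum y (S' \<union> {i<..j}) = walk_sum y S' + (y i - y j)"
        using ij fin by (intro walk_sum_Un_interval) auto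
      moreover have "T i j" using S ij unfolding stable_def by blast
      then have "y j \<le> y i" using y ij by blast
      ultimately show ?thesis using ij(1,2) by force
    qed
  qed
qed

lemma maximal_walk_flips:
  fixes y :: "nat \<Rightarrow> real"
  assumes S: "walk n up dn S" and max: "\<And>S'. walk n up dn S' \<Longrightarrow> walk_sum y S' \<le> walk_sum y S"
    and ij: "i < j"
  shows "{i<..j} \<inter> S = {} \<Longrightarrow> walk n up dn (S \<union> {i<..j}) \<Longrightarrow> y i \<le> y j"
    and "{i<..j} \<subseteq> S \<Longrightarrow> walk n up dn (S - {i<..j}) \<Longrightarrow> y j \<le> y i"
proof -
  show "y i \<le> y j" if "{i<..j} \<inter> S = {}" "walk n up dn (S \<union> {i<..j})"
    using max[OF that(2)] walk_sum_Un_interval[OF finite_walk[OF S], of i j y] that(1) ij by simp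
  show "y j \<le> y i" if "{i<..j} \<subseteq> S" "walk n up dn (S - {i<..j})"
    using max[OF that(2)] walk_sum_Diff_interval[OF finite_walk[OF S], of i j y] that(1) ij by simp
qed

text \<open>Here \<open>T i j\<close> means \<open>y j < y i\<close>, that is, adding
  \<open>{i<..j}\<close> is a gain. A walk of maximal weight is stable, and since \<open>y\<close>
  has no ties, two distinct stable walks would each be strictly heavier than the other.\<close>

lemma stable_unique_exists:
  fixes y :: "nat \<Rightarrow> real"
  assumes y: "\<And>i j. i < j \<Longrightarrow> j < n \<Longrightarrow> (T i j \<longrightarrow> y j < y i) \<and> (\<not> T i j \<longrightarrow> y i < y j)"
  shows "\<exists>!S. stable n up dn T S"
proof -
  have le: "\<And>i j. i < j \<Longrightarrow> j < n \<Longrightarrow> (T i j \<longrightarrow> y j \<le> y i) \<and> (\<not> T i j \<longrightarrow> y i \<le> y j)"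
    and ne: "\<forall>i j. i < j \<and> j < n \<longrightarrow> y i \<noteq> y j"
    using y by (meson less_imp_le, metis less_irrefl)
  define X where "X = {S. walk n up dn S}"
  have X: "finite X" "X \<noteq> {}" unfolding X_def using finite_walks walk_empty[of n up dn] by auto
  have "Max (walk_sum y ` X) \<in> walk_sum y ` X" using X by simp
  then obtain S where S: "S \<in> X" "walk_sum y S = Max (walk_sum y ` X)" by auto
  have wS: "walk n up dn S" and mS: "\<And>S'. walk n up dn S' \<Longrightarrow> walk_sum y S' \<le> walk_sum y S"
    using S X(1) unfolding X_def by auto
  have "stable n up dn T S"
    unfolding stable_def using wS maximal_walk_flips[OF wS mS] y by (meson leD)
  moreover have "S1 = S2" if "stable n up dn T S1" "stable n up dn T S2" for S1 S2
  proof (rule ccontr)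
    assume "S1 \<noteq> S2"
    have "walk n up dn S1" "walk n up dn S2" using that unfolding stable_def by auto
    then have "walk_sum y S1 < walk_sum y S2" "walk_sum y S2 < walk_sum y S1"
      using stable_walk_sum[OF that(2) le] stable_walk_sum[OF that(1) le] ne \<open>S1 \<noteq> S2\<close> by auto
    then show False by simp
  qed
  ultimately show ?thesis by blast
qed

text \<open>Cutting an admissible interval at \<open>m\<close> creates one new end, at
  \<open>m\<close>, and the label of \<open>m\<close> decides which of the two pieces is
  admissible.\<close>

lemma walk_subinterval:
  assumes S: "walk n up dn S" and ij: "{i<..j} \<inter> S = {}" "walk n up dn (S \<union> {i<..j})"
    and m: "i < m" "m < j"
  shows "up m \<Longrightarrow> walk n up dn (S \<union> {m<..j})" and "dn m \<Longrightarrow> walk n up dn (S \<union> {i<..m})"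
proof -
  have b: "S \<union> {i<..j} \<subseteq> {0<..<n}" using ij unfolding walk_def by auto
  have T: "(t \<in> S \<and> Suc t \<notin> S \<longrightarrow> dn t) \<and> (t \<notin> S \<and> Suc t \<in> S \<longrightarrow> up t)"
      "(t \<in> S \<union> {i<..j} \<and> Suc t \<notin> S \<union> {i<..j} \<longrightarrow> dn t) \<and>
       (t \<notin> S \<union> {i<..j} \<and> Suc t \<in> S \<union> {i<..j} \<longrightarrow> up t)" if "t < n" for t
    using S ij(2) that unfolding walk_def by auto
  show "walk n up dn (S \<union> {m<..j})" if "up m"
    unfolding walk_def
  proof (intro conjI allI impI)
    show "S \<union> {m<..j} \<subseteq> {0<..<n}" using b m by auto
    fix t assume "t < n"
    note T = T[OF this]
    show "dn t" if "t \<in> S \<union> {m<..j} \<and> Suc t \<notin> S \<union> {m<..j}"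
      using T that m ij(1) by (cases "t = j") auto
    show "up t" if "t \<notin> S \<union> {m<..j} \<and> Suc t \<in> S \<union> {m<..j}"
      using T that m ij(1) \<open>up m\<close> by (cases "t = m") auto
  qed
  show "walk n up dn (S \<union> {i<..m})" if "dn m"
    unfolding walk_def
  proof (intro conjI allI impI)
    show "S \<union> {i<..m} \<subseteq> {0<..<n}" using b m by auto
    fix t assume "t < n"
    note T = T[OF this]
    show "dn t" if "t \<in> S \<union> {i<..m} \<and> Suc t \<notin> S \<union> {i<..m}"
      using T that m ij(1) \<open>dn m\<close> by (cases "t = m") auto
    show "up t" if "t \<notin> S \<union> {i<..m} \<and> Suc t \<in> S \<union> {i<..m}"
      using T that m ij(1) by (cases "t = i") auto
  qed
qed

text \<open>For a fixed walk, stability is a conjunction of conditions on \<open>T\<close> at single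
  pairs, so an order that agrees at each pair with one of two suitable orders is suitable
  too.\<close>

lemma stable_between:
  assumes T1: "stable n up dn T1 S" and T2: "stable n up dn T2 S"
    and T: "\<And>i j. i < j \<Longrightarrow> j < n \<Longrightarrow> T i j = T1 i j \<or> T i j = T2 i j"
  shows "stable n up dn T S"
  unfolding stable_def
proof (intro conjI allI impI)
  show "walk n up dn S" using T1 unfolding stable_def by blast
  fix i j assume ij: "i < j \<and> j < n"
  { assume "{i<..j} \<inter> S = {} \<and> walk n up dn (S \<union> {i<..j})"
    then have "\<not> T1 i j" "\<not> T2 i j" using T1 T2 ij unfolding stable_def by blast+
    then show "\<not> T i j" using T[of i j] ij by auto }
  { assume "{i<..j} \<subseteq> S \<and> walk n up dn (S - {i<..j})"
    then have "T1 i j" "T2 i j" using T1 T2 ij unfolding stable_def by blast+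
    then show "T i j" using T[of i j] ij by auto }
qed

text \<open>When only the pair \<open>(i, j)\<close> turns into a gain, stability can fail only
  because adding \<open>{i<..j}\<close> is admissible. Its admissible pieces are then no gain under
  \<open>T\<close>, which tells on which side of \<open>i\<close> and \<open>j\<close> the labelled
  vertices between them lie. This is what later identifies the rope of a wall.\<close>

lemma stable_flip_order:
  assumes S: "stable n up dn T S" and S': "\<not> stable n up dn T' S"
    and ij: "i < j" "j < n" "\<not> T i j" "T' i j"
    and eq: "\<And>k l. k < l \<Longrightarrow> l < n \<Longrightarrow> (k, l) \<noteq> (i, j) \<Longrightarrow> T' k l = T k l"
    and m: "i < m" "m < j"
  shows "up m \<Longrightarrow> \<not> T m j" and "dn m \<Longrightarrow> \<not> T i m"
proof -
  have wS: "walk n up dn S" using S unfolding stable_def by simp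
  obtain k l where kl: "k < l" "l < n"
    "({k<..l} \<inter> S = {} \<and> walk n up dn (S \<union> {k<..l}) \<and> T' k l) \<or>
     ({k<..l} \<subseteq> S \<and> walk n up dn (S - {k<..l}) \<and> \<not> T' k l)"
    using S' wS unfolding stable_def by blast
  have "({k<..l} \<inter> S = {} \<and> walk n up dn (S \<union> {k<..l}) \<longrightarrow> \<not> T k l) \<and>
     ({k<..l} \<subseteq> S \<and> walk n up dn (S - {k<..l}) \<longrightarrow> T k l)"
    using S kl(1,2) unfolding stable_def by blast
  then have "k = i" "l = j" "{i<..j} \<inter> S = {}" "walk n up dn (S \<union> {i<..j})"
    using eq kl ij by blast+
  note w = walk_subinterval[OF wS this(3,4) m]
  show "\<not> T m j" if "up m"
  proof -
    have "{m<..j} \<inter> S = {}" using \<open>{i<..j} \<inter> S = {}\<close> m by (auto simp: disjoint_iff)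
    then show ?thesis using S w(1)[OF that] m ij(2) unfolding stable_def by blast
  qed
  show "\<not> T i m" if "dn m"
  proof -
    have "{i<..m} \<inter> S = {}" using \<open>{i<..j} \<inter> S = {}\<close> m by (auto simp: disjoint_iff)
    moreover have "m < n" using m ij(2) by simp
    ultimately show ?thesis using S w(2)[OF that] m unfolding stable_def by blast
  qed
qed

section \<open>From matchings given by lists of vertices to walks and back\<close>

lemma states_sum:
  fixes y :: "nat \<Rightarrow> 'a::real_vector"
  assumes "\<not> \<sigma> 0" "\<not> \<sigma> n"
  shows "(\<Sum>i<n. (of_bool (\<sigma> (Suc i)) - of_bool (\<sigma> i)) *\<^sub>R y i) = walk_sum y {i \<in> {0<..<n}. \<sigma> i}"
proof -
  \<comment> \<open>The induction runs over prefixes, at whose ends \<open>\<sigma>\<close> may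
    hold; the last summand is the boundary term of the summation by parts.\<close>
  have "(\<Sum>i<n. (of_bool (\<sigma> (Suc i)) - of_bool (\<sigma> i)) *\<^sub>R y i) =
    walk_sum y {i \<in> {0<..<n}. \<sigma> i} + (of_bool (\<sigma> n) :: real) *\<^sub>R y (n - 1)"
  proof (induction n)
    case 0
    then show ?case using assms(1) by (simp add: walk_sum_def)
  next
    case (Suc n)
    show ?case
    proof (cases "\<sigma> n")
      case True
      then have "n \<noteq> 0" using assms(1) by (intro notI) simp
      then have "{i \<in> {0<..<Suc n}. \<sigma> i} = insert n {i \<in> {0<..<n}. \<sigma> i}" using True by auto
      then show ?thesis using Suc True by (simp add: walk_sum_def algebra_simps)
    next
      case False
      then have "{i \<in> {0<..<Suc n}. \<sigma> i} = {i \<in> {0<..<n}. \<sigma> i}" by (auto simp: less_Suc_eq)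
      then show ?thesis using Suc False by simp
    qed
  qed
  then show ?thesis using assms(2) by simp
qed

text \<open>A two-state automaton reads the path. The flag \<open>b\<close> says that a pair has
  been opened before \<open>ws\<close>, so that the next matched vertex closes it; this is why
  \<open>bs\<close> then comes first in the splice and is longer than \<open>as\<close> by one. The
  state \<open>\<sigma> i\<close> is the flag before vertex \<open>i\<close> is read.\<close>

lemma matching_imp_states:
  fixes y :: "'v \<Rightarrow> 'a::real_vector"
  assumes "length bs + of_bool (\<not> b) = length as + 1"
    and "subseq (if b then splice bs as else splice as bs) ws"
    and "set as \<subseteq> U" "set bs \<subseteq> Dn"
  shows "\<exists>\<sigma>. \<sigma> 0 = b \<and> \<not> \<sigma> (length ws) \<and>
    (\<forall>i<length ws. (\<sigma> i \<and> \<not> \<sigma> (Suc i) \<longrightarrow> ws ! i \<in> Dn) \<and> (\<not> \<sigma> i \<and> \<sigma> (Suc i) \<longrightarrow> ws ! i \<in> U)) \<and>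
    (\<Sum>i<length ws. (of_bool (\<sigma> (Suc i)) - of_bool (\<sigma> i)) *\<^sub>R y (ws ! i)) =
      (\<Sum>a\<leftarrow>as. y a) - (\<Sum>a\<leftarrow>bs. y a)"
  using assms
proof (induction ws arbitrary: b as bs)
  case Nil
  then have "as = [] \<and> bs = [] \<and> \<not> b" by (cases b; cases as; cases bs) auto
  then show ?case by (intro exI[of _ "\<lambda>_. False"]) simp
next
  case (Cons w ws)
  let ?l = "\<lambda>b as bs. if b then splice bs as else splice as bs"
  consider "subseq (?l b as bs) ws" |
    "b" "bs \<noteq> []" "hd bs = w" "subseq (splice as (tl bs)) ws" |
    "\<not> b" "as \<noteq> []" "hd as = w" "subseq (splice bs (tl as)) ws"
  proof (cases b)
    case True
    with Cons.prems(1) obtain x bs' where bs: "bs = x # bs'" by (cases bs) auto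
    show ?thesis using Cons.prems(2) True that
      by (cases "x = w") (auto simp: bs)
  next
    case False
    show ?thesis
    proof (cases as)
      case Nil
      then show ?thesis using Cons.prems(1) that(1) False by auto
    next
      case (Cons x as')
      then show ?thesis using Cons.prems(2) False that by (cases "x = w") auto
    qed
  qed
  then show ?case
  proof cases
    case 1
    obtain \<sigma> where \<sigma>: "\<sigma> 0 = b" "\<not> \<sigma> (length ws)"
      "\<forall>i<length ws. (\<sigma> i \<and> \<not> \<sigma> (Suc i) \<longrightarrow> ws ! i \<in> Dn) \<and> (\<not> \<sigma> i \<and> \<sigma> (Suc i) \<longrightarrow> ws ! i \<in> U)"
      "(\<Sum>i<length ws. (of_bool (\<sigma> (Suc i)) - of_bool (\<sigma> i)) *\<^sub>R y (ws ! i)) =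
      (\<Sum>a\<leftarrow>as. y a) - (\<Sum>a\<leftarrow>bs. y a)"
      using Cons.IH[OF Cons.prems(1) 1 Cons.prems(3,4)] by blast
    show ?thesis
      by (rule exI[of _ "case_nat b \<sigma>"])
        (use \<sigma> in \<open>auto simp: sum.lessThan_Suc_shift less_Suc_eq_0_disj simp del: sum.lessThan_Suc\<close>)
  next
    case 2
    obtain \<sigma> where \<sigma>: "\<sigma> 0 = False" "\<not> \<sigma> (length ws)"
      "\<forall>i<length ws. (\<sigma> i \<and> \<not> \<sigma> (Suc i) \<longrightarrow> ws ! i \<in> Dn) \<and> (\<not> \<sigma> i \<and> \<sigma> (Suc i) \<longrightarrow> ws ! i \<in> U)"
      "(\<Sum>i<length ws. (of_bool (\<sigma> (Suc i)) - of_bool (\<sigma> i)) *\<^sub>R y (ws ! i)) =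
      (\<Sum>a\<leftarrow>as. y a) - (\<Sum>a\<leftarrow>tl bs. y a)"
      using Cons.IH[of "tl bs" False as] Cons.prems 2 by (cases bs) auto
    have bs: "bs = w # tl bs" using 2 by (cases bs) auto
    have sum: "(\<Sum>a\<leftarrow>bs. y a) = y w + (\<Sum>a\<leftarrow>tl bs. y a)" by (subst bs) simp
    have "w \<in> Dn" using Cons.prems(4) bs by (metis list.set_intros(1) subsetD)
    then show ?thesis
      by (intro exI[of _ "case_nat True \<sigma>"])
        (use \<sigma> 2 sum in \<open>auto simp: sum.lessThan_Suc_shift less_Suc_eq_0_disj simp del: sum.lessThan_Suc\<close>)
  next
    case 3
    obtain \<sigma> where \<sigma>: "\<sigma> 0 = True" "\<not> \<sigma> (length ws)"
      "\<forall>i<length ws. (\<sigma> i \<and> \<not> \<sigma> (Suc i) \<longrightarrow> ws ! i \<in> Dn) \<and> (\<not> \<sigma> i \<and> \<sigma> (Suc i) \<longrightarrow> ws ! i \<in> U)"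
      "(\<Sum>i<length ws. (of_bool (\<sigma> (Suc i)) - of_bool (\<sigma> i)) *\<^sub>R y (ws ! i)) =
      (\<Sum>a\<leftarrow>tl as. y a) - (\<Sum>a\<leftarrow>bs. y a)"
      using Cons.IH[of bs True "tl as"] Cons.prems 3 by (cases as) auto
    have as: "as = w # tl as" using 3 by (cases as) auto
    have sum: "(\<Sum>a\<leftarrow>as. y a) = y w + (\<Sum>a\<leftarrow>tl as. y a)" by (subst as) simp
    have "w \<in> U" using Cons.prems(3) as by (metis list.set_intros(1) subsetD)
    then show ?thesis
      by (intro exI[of _ "case_nat False \<sigma>"])
        (use \<sigma> 3 sum in \<open>auto simp: sum.lessThan_Suc_shift less_Suc_eq_0_disj simp del: sum.lessThan_Suc\<close>)
  qed
qed

text \<open>The run of the automaton gives the lists back: a vertex at which the state rises joins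
  \<open>as\<close>, one at which it falls joins \<open>bs\<close>.\<close>

lemma states_imp_matching:
  fixes y :: "'v \<Rightarrow> 'a::real_vector"
  assumes "\<not> \<sigma> (length ws)"
    and "\<And>i. i < length ws \<Longrightarrow> (\<sigma> i \<and> \<not> \<sigma> (Suc i) \<longrightarrow> ws ! i \<in> Dn) \<and> (\<not> \<sigma> i \<and> \<sigma> (Suc i) \<longrightarrow> ws ! i \<in> U)"
  shows "\<exists>as bs. length bs + of_bool (\<not> \<sigma> 0) = length as + 1 \<and>
    subseq (if \<sigma> 0 then splice bs as else splice as bs) ws \<and> set as \<subseteq> U \<and> set bs \<subseteq> Dn \<and>
    (\<Sum>i<length ws. (of_bool (\<sigma> (Suc i)) - of_bool (\<sigma> i)) *\<^sub>R y (ws ! i)) =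
      (\<Sum>a\<leftarrow>as. y a) - (\<Sum>a\<leftarrow>bs. y a)"
  using assms
proof (induction ws arbitrary: \<sigma>)
  case Nil
  then show ?case by (intro exI[of _ "[]"]) simp
next
  case (Cons w ws)
  have "\<exists>as bs. length bs + of_bool (\<not> \<sigma> (Suc 0)) = length as + 1 \<and>
    subseq (if \<sigma> (Suc 0) then splice bs as else splice as bs) ws \<and> set as \<subseteq> U \<and> set bs \<subseteq> Dn \<and>
    (\<Sum>i<length ws. (of_bool (\<sigma> (Suc (Suc i))) - of_bool (\<sigma> (Suc i))) *\<^sub>R y (ws ! i)) =
      (\<Sum>a\<leftarrow>as. y a) - (\<Sum>a\<leftarrow>bs. y a)"
    using Cons.IH[of "\<lambda>i. \<sigma> (Suc i)"] Cons.prems by fastforce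
  then obtain as bs where ab: "length bs + of_bool (\<not> \<sigma> (Suc 0)) = length as + 1"
    "subseq (if \<sigma> (Suc 0) then splice bs as else splice as bs) ws" "set as \<subseteq> U" "set bs \<subseteq> Dn"
    "(\<Sum>i<length ws. (of_bool (\<sigma> (Suc (Suc i))) - of_bool (\<sigma> (Suc i))) *\<^sub>R y (ws ! i)) =
      (\<Sum>a\<leftarrow>as. y a) - (\<Sum>a\<leftarrow>bs. y a)"
    by blast
  have w: "(\<sigma> 0 \<and> \<not> \<sigma> (Suc 0) \<longrightarrow> w \<in> Dn) \<and> (\<not> \<sigma> 0 \<and> \<sigma> (Suc 0) \<longrightarrow> w \<in> U)"
    using Cons.prems(2)[of 0] by simp
  consider "\<sigma> 0 = \<sigma> (Suc 0)" | "\<sigma> 0" "\<not> \<sigma> (Suc 0)" | "\<not> \<sigma> 0" "\<sigma> (Suc 0)" by blast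
  then show ?case
  proof cases
    case 1
    then show ?thesis using ab
      by (intro exI[of _ as] exI[of _ bs])
        (auto simp: sum.lessThan_Suc_shift simp del: sum.lessThan_Suc)
  next
    case 2
    then show ?thesis using ab w
      by (intro exI[of _ as] exI[of _ "w # bs"])
        (auto simp: sum.lessThan_Suc_shift simp del: sum.lessThan_Suc)
  next
    case 3
    then show ?thesis using ab w
      by (intro exI[of _ "w # as"] exI[of _ bs])
        (auto simp: sum.lessThan_Suc_shift simp del: sum.lessThan_Suc)
  qed
qed

subsection \<open>Supports and paths in skeletal graphs\<close>

text \<open>The number of strict predecessors grows along arcs. Multiplying it by \<open>n\<close>,
  which exceeds all values of \<open>\<iota>\<close>, leaves room to break ties injectively.\<close>

lemma injective_numbering:
  fixes r :: "('v::finite) rel"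
  assumes "acyclic r"
  obtains h :: "'v \<Rightarrow> nat" where "inj h" "\<And>x y. (x, y) \<in> r \<Longrightarrow> h x < h y"
proof -
  obtain \<iota> :: "'v \<Rightarrow> nat" and n where \<iota>: "\<iota> ` UNIV = {i. i < n}" "inj \<iota>"
    using finite_imp_inj_to_nat_seg[of "UNIV :: 'v set"] by auto
  have \<iota>n: "\<iota> x < n" for x using \<iota>(1) by auto
  define f where "f x = card {y. (y, x) \<in> r\<^sup>+}" for x
  define h where "h x = f x * n + \<iota> x" for x
  have "h x < h y" if xy: "(x, y) \<in> r" for x y
  proof -
    have "x \<notin> {z. (z, x) \<in> r\<^sup>+}" using assms by (simp add: acyclic_def)
    moreover have "x \<in> {z. (z, y) \<in> r\<^sup>+}" "{z. (z, x) \<in> r\<^sup>+} \<subseteq> {z. (z, y) \<in> r\<^sup>+}"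
      using xy by auto
    ultimately have "f x < f y" unfolding f_def by (intro psubset_card_mono) auto
    then have "Suc (f x) * n \<le> f y * n" by (intro mult_le_mono1) simp
    then show ?thesis using \<iota>n[of x] unfolding h_def by simp
  qed
  moreover have "inj h"
  proof (rule injI)
    fix x y assume "h x = h y"
    then have "h x mod n = h y mod n" by simp
    then have "\<iota> x = \<iota> y" unfolding h_def using \<iota>n by simp
    then show "x = y" using \<iota>(2) by (simp add: inj_eq)
  qed
  ultimately show thesis using that by blast
qed

lemma rtrancl_imp_successively:
  assumes "(u, v) \<in> r\<^sup>*"
  shows "\<exists>p. p \<noteq> [] \<and> successively (\<lambda>x y. (x, y) \<in> r) p \<and> hd p = u \<and> last p = v"
  using assms
proof (induction rule: rtrancl_induct)
  case base
  show ?case by (rule exI[of _ "[u]"]) simp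
next
  case (step y z)
  then obtain p where "p \<noteq> []" "successively (\<lambda>x y. (x, y) \<in> r) p" "hd p = u" "last p = y" by blast
  with step(2) show ?case by (intro exI[of _ "p @ [z]"]) (simp add: successively_append_iff)
qed

lemma acyclic_successively_distinct:
  fixes r :: "('v::finite) rel"
  assumes "acyclic r" "successively (\<lambda>x y. (x, y) \<in> r) p"
  shows "distinct p"
proof -
  obtain h :: "'v \<Rightarrow> nat" where h: "inj h" "\<And>x y. (x, y) \<in> r \<Longrightarrow> h x < h y"
    using injective_numbering[OF assms(1)] by blast
  have "successively (\<lambda>x y. h x < h y) p"
    using assms(2) h(2) by (auto elim: successively_mono)
  then have "sorted_wrt (\<lambda>x y. h x < h y) p"
    by (subst (asm) successively_conv_sorted_wrt) (auto simp: transp_def)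
  then have "sorted_wrt (<) (map h p)" by (simp add: sorted_wrt_map)
  then show ?thesis by (simp add: strict_sorted_iff distinct_map)
qed

lemma rtrancl_imp_dipath_through:
  fixes r :: "('v::finite) rel"
  assumes "acyclic r" "(u, w) \<in> r\<^sup>*" "(w, v) \<in> r\<^sup>*"
  obtains p where "dipath r u p v" "w \<in> set p"
proof -
  obtain p where p: "p \<noteq> []" "successively (\<lambda>x y. (x, y) \<in> r) p" "hd p = u" "last p = w"
    using rtrancl_imp_successively[OF assms(2)] by blast
  obtain q where q: "q \<noteq> []" "successively (\<lambda>x y. (x, y) \<in> r) q" "hd q = w" "last q = v"
    using rtrancl_imp_successively[OF assms(3)] by blast
  obtain q' where q': "q = w # q'" using q by (cases q) auto
  have s: "successively (\<lambda>x y. (x, y) \<in> r) (p @ q')"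
    using p q by (cases q') (auto simp: q' successively_append_iff)
  have "dipath r u (p @ q') v"
    unfolding dipath_def using p q s acyclic_successively_distinct[OF assms(1) s]
    by (auto simp: q')
  moreover have "w \<in> set (p @ q')" using p by auto
  ultimately show thesis using that by blast
qed

lemma dipath_memD:
  assumes "dipath r u p v" "w \<in> set p"
  shows "(u, w) \<in> r\<^sup>* \<and> (w, v) \<in> r\<^sup>*"
proof -
  have "successively (\<lambda>x y. (x, y) \<in> r) p \<Longrightarrow> x \<in> set p \<Longrightarrow> (hd p, x) \<in> r\<^sup>* \<and> (x, last p) \<in> r\<^sup>*" for x p
  proof (induction p arbitrary: x)
    case (Cons a p)
    show ?case
    proof (cases p)
      case (Cons b p')
      then have IH: "(b, z) \<in> r\<^sup>* \<and> (z, last p) \<in> r\<^sup>*" if "z \<in> set p" for z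
        using Cons.IH[of z] Cons.prems(1) that by simp
      have "(a, b) \<in> r" using Cons Cons.prems(1) by simp
      then have "(a, z) \<in> r\<^sup>*" if "z \<in> set p" for z
        using IH[OF that] by (meson converse_rtrancl_into_rtrancl)
      moreover have "(a, last p) \<in> r\<^sup>*"
        using IH[of b] Cons \<open>(a, b) \<in> r\<close> by (auto intro: converse_rtrancl_into_rtrancl)
      ultimately show ?thesis using Cons.prems(2) IH Cons by auto
    qed (use Cons.prems in auto)
  qed simp
  then show ?thesis using assms unfolding dipath_def by auto
qed

text \<open>A path-free form of \<open>transitive_support\<close>; the two agree for arcs of a
  filled acyclic graph, and statements about paths reduce to triangles.\<close>

definition support :: "'v rel \<Rightarrow> 'v \<Rightarrow> 'v \<Rightarrow> 'v set" where
  "support A u v = {u, v} \<union> {w. (u, w) \<in> A \<and> (w, v) \<in> A}"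

locale skeletal_dag =
  fixes A :: "('v::finite) rel"
  assumes acyclic_arcs: "acyclic A" and skeletal_arcs: "skeletal A"
begin

lemma arc_irrefl: "(x, x) \<notin> A"
  using acyclic_arcs by (auto simp: acyclic_def)

lemma arc_asym: "(x, y) \<in> A \<Longrightarrow> (y, x) \<notin> A"
  using acyclic_arcs unfolding acyclic_def by (meson r_into_trancl trancl_trans)

lemma arc_no_cycle: "(x, y) \<in> A\<^sup>* \<Longrightarrow> (y, x) \<notin> A"
  using acyclic_arcs unfolding acyclic_def by (meson rtrancl_into_trancl1)

lemma dipath_clique: "dipath A u p v \<Longrightarrow> (u, v) \<in> A \<Longrightarrow> sorted_wrt (\<lambda>x y. (x, y) \<in> A) p"
  using skeletal_arcs unfolding skeletal_def filled_def by blast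

text \<open>Filledness turns a directed path through \<open>w\<close> between the ends of an arc
  into a clique.\<close>

lemma between_arcs:
  assumes uv: "(u, v) \<in> A" and "(u, w) \<in> A\<^sup>*" "(w, v) \<in> A\<^sup>*"
  shows "w \<in> support A u v"
proof -
  obtain p where p: "dipath A u p v" "w \<in> set p"
    using rtrancl_imp_dipath_through[OF acyclic_arcs assms(2,3)] by blast
  have s: "sorted_wrt (\<lambda>x y. (x, y) \<in> A) p" using dipath_clique[OF p(1) uv] .
  obtain k where k: "k < length p" "w = p ! k" using p(2) by (metis in_set_conv_nth)
  have uv: "u = p ! 0" "v = p ! (length p - 1)" "p \<noteq> []"
    using p(1) unfolding dipath_def by (auto simp: hd_conv_nth last_conv_nth)
  have "(u, w) \<in> A" if "k \<noteq> 0" using sorted_wrt_nth_less[OF s, of 0 k] k that uv by simp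
  moreover have "(w, v) \<in> A" if "k \<noteq> length p - 1" using sorted_wrt_nth_less[OF s, of k "length p - 1"] k that uv by simp
  ultimately show ?thesis using k uv unfolding support_def by auto
qed

lemma transitive_support_eq:
  assumes uv: "(u, v) \<in> A"
  shows "transitive_support A u v = support A u v"
proof (intro equalityI subsetI)
  fix w assume "w \<in> transitive_support A u v"
  then show "w \<in> support A u v"
    unfolding transitive_support_def using between_arcs[OF uv] dipath_memD by fast
next
  fix w assume "w \<in> support A u v"
  then have "(u, w) \<in> A\<^sup>*" "(w, v) \<in> A\<^sup>*" unfolding support_def using uv by auto
  then show "w \<in> transitive_support A u v"
    unfolding transitive_support_def using rtrancl_imp_dipath_through[OF acyclic_arcs] by blast
qed

text \<open>The path that removes the arc is a clique by filledness, so its second vertex already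
  forms the triangle.\<close>

lemma not_reduced_imp_triangle:
  assumes "(x, y) \<in> Restr A W" "(x, y) \<notin> transitive_reduction (Restr A W)"
  shows "\<exists>z\<in>W. (x, z) \<in> A \<and> (z, y) \<in> A"
proof -
  obtain p where p: "dipath (Restr A W) x p y" "3 \<le> length p"
    using assms unfolding transitive_reduction_def by blast
  have "successively (\<lambda>x y. (x, y) \<in> A) p"
    using p(1) unfolding dipath_def by (auto elim: successively_mono)
  then have pA: "dipath A x p y" using p(1) unfolding dipath_def by auto
  have s: "sorted_wrt (\<lambda>x y. (x, y) \<in> A) p" using dipath_clique[OF pA] assms(1) by blast
  have xy: "x = p ! 0" "y = p ! (length p - 1)" "p \<noteq> []"
    using pA unfolding dipath_def by (auto simp: hd_conv_nth last_conv_nth)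
  have "(p ! 0, p ! Suc 0) \<in> Restr A W"
    using p unfolding dipath_def successively_conv_nth by auto
  moreover have "(p ! Suc 0, p ! (length p - 1)) \<in> A"
    using s p(2) by (intro sorted_wrt_nth_less[where P="\<lambda>x y. (x, y) \<in> A"]) auto
  ultimately show ?thesis using xy by auto
qed

text \<open>Without a chord no vertex of the diamond lies between the ends of one of its four sides.
  All sides then survive in the transitive reduction of the subgraph induced on the four vertices
  and form a cycle, against vertebracy.\<close>

lemma diamond_chord:
  assumes uv: "(u, v) \<in> A" and w: "(u, w) \<in> A" "(w, v) \<in> A" and w': "(u, w') \<in> A" "(w', v) \<in> A"
    and "w \<noteq> w'"
  shows "(w, w') \<in> A \<or> (w', w) \<in> A"
proof (rule ccontr)
  assume n: "\<not> ?thesis"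
  define W where "W = {u, v, w, w'}"
  let ?T = "transitive_reduction (Restr A W)"
  have W: "u \<in> W" "v \<in> W" "w \<in> W" "w' \<in> W" unfolding W_def by auto
  have d: "u \<noteq> v" "u \<noteq> w" "u \<noteq> w'" "v \<noteq> w" "v \<noteq> w'" using assms arc_irrefl by auto
  have T: "(u, w) \<in> ?T" "(w, v) \<in> ?T" "(u, w') \<in> ?T" "(w', v) \<in> ?T"
  proof -
    have na: "(v, w) \<notin> A" "(w, u) \<notin> A" "(v, w') \<notin> A" "(w', u) \<notin> A" "(w, w') \<notin> A" "(w', w) \<notin> A"
      using assms n arc_asym by blast+
    have "\<not> (\<exists>z\<in>W. (x, z) \<in> A \<and> (z, y) \<in> A)"
      if "(x, y) \<in> {(u, w), (w, v), (u, w'), (w', v)}" for x y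
      using that na arc_irrefl unfolding W_def by auto
    then have "(x, y) \<in> ?T" if "(x, y) \<in> {(u, w), (w, v), (u, w'), (w', v)}" "(x, y) \<in> Restr A W" for x y
      using not_reduced_imp_triangle[OF that(2)] that(1) by blast
    then show "(u, w) \<in> ?T" "(w, v) \<in> ?T" "(u, w') \<in> ?T" "(w', v) \<in> ?T"
      using assms W by simp_all
  qed
  have "is_forest ?T"
    using skeletal_arcs unfolding skeletal_def vertebrate_def by blast
  moreover have "3 \<le> length [u, w, v, w']" "distinct [u, w, v, w']"
    "successively (\<lambda>x y. (x, y) \<in> ?T \<union> ?T\<inverse>) [u, w, v, w']"
    "(last [u, w, v, w'], hd [u, w, v, w']) \<in> ?T \<union> ?T\<inverse>"
    using d \<open>w \<noteq> w'\<close> T by auto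
  ultimately show False unfolding is_forest_def by blast
qed

lemma support_linear:
  assumes "(u, v) \<in> A" "x \<in> support A u v" "y \<in> support A u v" "x \<noteq> y"
  shows "(x, y) \<in> A \<or> (y, x) \<in> A"
  using assms diamond_chord[of u v x y] unfolding support_def by blast

lemma support_convex:
  assumes uv: "(u, v) \<in> A" and "x \<in> support A u v" "y \<in> support A u v" "(x, w) \<in> A\<^sup>*" "(w, y) \<in> A\<^sup>*"
  shows "w \<in> support A u v"
proof (rule between_arcs[OF uv])
  have "(u, x) \<in> A\<^sup>*" "(y, v) \<in> A\<^sup>*" using assms unfolding support_def by auto
  then show "(u, w) \<in> A\<^sup>*" "(w, v) \<in> A\<^sup>*" using assms by auto
qed

lemma support_subset:
  assumes "(u, v) \<in> A" "x \<in> support A u v" "y \<in> support A u v" "(x, y) \<in> A"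
  shows "support A x y \<subseteq> support A u v"
  using support_convex[OF assms(1-3)] assms(2,3) unfolding support_def[of A x y] by blast

text \<open>A vertex of the support missed by \<open>q\<close> would lie between two consecutive
  vertices of \<open>q\<close>, and the arc joining these would not be reduced.\<close>

lemma dipath_reduced_set:
  assumes uv: "(u, v) \<in> A" and q: "dipath (transitive_reduction A) u q v"
  shows "sorted_wrt (\<lambda>x y. (x, y) \<in> A) q \<and> set q = support A u v"
proof -
  obtain f :: "'v \<Rightarrow> nat" where f: "inj f" "\<And>x y. (x, y) \<in> A \<Longrightarrow> f x < f y"
    using injective_numbering[OF acyclic_arcs] by blast
  have "successively (\<lambda>x y. (x, y) \<in> A) q"
    using q unfolding dipath_def transitive_reduction_def by (auto elim: successively_mono)
  then have qA: "dipath A u q v" using q unfolding dipath_def by auto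
  have s: "sorted_wrt (\<lambda>x y. (x, y) \<in> A) q" using dipath_clique[OF qA uv] .
  have "set q \<subseteq> support A u v"
    using dipath_memD[OF qA] between_arcs[OF uv] by blast
  moreover have "support A u v \<subseteq> set q"
  proof (rule subsetI, rule ccontr)
    fix w assume w: "w \<in> support A u v" "w \<notin> set q"
    have ends: "u = q ! 0" "v = q ! (length q - 1)" "q \<noteq> []" "u \<in> set q" "v \<in> set q"
      using q unfolding dipath_def by (auto simp: hd_conv_nth last_conv_nth)
    then have uw: "(u, w) \<in> A" "(w, v) \<in> A" using w unfolding support_def by auto
    \<comment> \<open>The last vertex of \<open>q\<close> that precedes \<open>w\<close> and its
      successor on \<open>q\<close> enclose \<open>w\<close>, because the support is a
      chain.\<close>
    define K where "K = {k. k < length q \<and> (q ! k, w) \<in> A}"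
    have K: "finite K" "0 \<in> K" unfolding K_def using ends uw by auto
    define k where "k = Max K"
    have k: "k \<in> K" unfolding k_def using K by (metis Max_in empty_iff)
    then have kl: "k < length q" "(q ! k, w) \<in> A" unfolding K_def by auto
    have "k \<noteq> length q - 1" using kl ends uw arc_asym by auto
    then have k1: "Suc k < length q" using kl by simp
    have "Suc k \<notin> K" using Max_ge[OF K(1), of "Suc k"] unfolding k_def by auto
    then have "(q ! Suc k, w) \<notin> A" using k1 unfolding K_def by simp
    then have "(w, q ! Suc k) \<in> A"
      using support_linear[OF uv, of w "q ! Suc k"] w k1 \<open>set q \<subseteq> support A u v\<close>
      by (metis nth_mem subsetD)
    then have "dipath A (q ! k) [q ! k, w, q ! Suc k] (q ! Suc k)"
      using kl arc_irrefl arc_asym unfolding dipath_def by auto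
    then have "(q ! k, q ! Suc k) \<notin> transitive_reduction A"
      unfolding transitive_reduction_def by force
    moreover have "(q ! k, q ! Suc k) \<in> transitive_reduction A"
      using q k1 unfolding dipath_def successively_conv_nth by blast
    ultimately show False by simp
  qed
  ultimately show ?thesis using s by blast
qed

text \<open>The path lists the support in increasing order of a linear extension \<open>f\<close>. A
  vertex spoiling a consecutive arc would itself lie in the support, strictly between neighbours of
  the list.\<close>

lemma dipath_reduced_exists:
  assumes uv: "(u, v) \<in> A"
  shows "\<exists>p. dipath (transitive_reduction A) u p v"
proof -
  obtain f :: "'v \<Rightarrow> nat" where f: "inj f" "\<And>x y. (x, y) \<in> A \<Longrightarrow> f x < f y"
    using injective_numbering[OF acyclic_arcs] by blast
  let ?S = "support A u v"
  have "sorted_list_of_set (f ` ?S) \<noteq> []" by (simp add: support_def)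
  define p where "p = map (inv f) (sorted_list_of_set (f ` ?S))"
  have mp: "map f p = sorted_list_of_set (f ` ?S)"
    unfolding p_def map_map by (rule map_idI) (auto simp: inv_f_f[OF f(1)])
  have "set (map f p) = f ` ?S" unfolding mp by simp
  then have sp: "set p = ?S" using f(1) by (simp add: inj_image_eq_iff)
  have dp: "distinct p"
    using distinct_map[of f p] unfolding mp by simp
  have sf: "f (p ! i) < f (p ! j)" if "i < j" "j < length p" for i j
  proof -
    have "sorted_wrt (<) (map f p)" unfolding mp by simp
    then show ?thesis using sorted_wrt_nth_less[of "(<)" "map f p" i j] that by simp
  qed
  have pA: "(x, y) \<in> A" if "x \<in> ?S" "y \<in> ?S" "f x < f y" for x y
    using support_linear[OF uv that(1,2)] f(2) that(3) by fastforce
  have p0: "p \<noteq> []" using sp by (auto simp: support_def)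
  have fmin: "f u \<le> f w \<and> f w \<le> f v" if "w \<in> ?S" for w
    using that uv f(2) unfolding support_def by (auto dest: less_imp_le)
  obtain i where i: "i < length p" "p ! i = u" using sp by (metis UnI1 in_set_conv_nth insertI1 support_def)
  have "i = 0"
    using sf[of 0 i] fmin[of "p ! 0"] i p0 sp by (metis leD length_greater_0_conv neq0_conv nth_mem)
  obtain j where j: "j < length p" "p ! j = v"
    using sp by (metis UnI1 in_set_conv_nth insertI1 insertI2 support_def)
  have "j = length p - 1"
  proof (rule ccontr)
    assume "j \<noteq> length p - 1"
    then have "f (p ! j) < f (p ! (length p - 1))" using j by (intro sf) auto
    moreover have "p ! (length p - 1) \<in> ?S" using nth_mem[of "length p - 1" p] p0 unfolding sp by simp
    ultimately show False using fmin[of "p ! (length p - 1)"] j by simp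
  qed
  have ends: "hd p = u" "last p = v"
    using i j \<open>i = 0\<close> \<open>j = length p - 1\<close> p0 by (auto simp: hd_conv_nth last_conv_nth)
  have "(p ! i, p ! Suc i) \<in> transitive_reduction A" if "Suc i < length p" for i
  proof (rule ccontr)
    assume n: "(p ! i, p ! Suc i) \<notin> transitive_reduction A"
    have S: "p ! i \<in> ?S" "p ! Suc i \<in> ?S" unfolding sp[symmetric] using that by simp_all
    have a: "(p ! i, p ! Suc i) \<in> A" using pA[OF S] sf[of i "Suc i"] that by simp
    obtain z where z: "(p ! i, z) \<in> A" "(z, p ! Suc i) \<in> A"
      using not_reduced_imp_triangle[of "p ! i" "p ! Suc i" UNIV] n a by auto
    have "z \<in> ?S" using support_subset[OF uv S a] z unfolding support_def[of A "p ! i"] by blast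
    then obtain k where k: "k < length p" "z = p ! k" using sp by (metis in_set_conv_nth)
    have "f (p ! i) < f (p ! k)" "f (p ! k) < f (p ! Suc i)" using z f(2) k by auto
    moreover have "f (p ! k) \<le> f (p ! i)" if "k \<le> i"
      using sf[of k i] that \<open>Suc i < length p\<close> by (cases "k = i") auto
    moreover have "f (p ! Suc i) \<le> f (p ! k)" if "Suc i \<le> k"
      using sf[of "Suc i" k] that k by (cases "k = Suc i") auto
    ultimately show False by (cases "k \<le> i") auto
  qed
  then have "dipath (transitive_reduction A) u p v"
    unfolding dipath_def successively_conv_nth using p0 dp ends by auto
  then show ?thesis by blast
qed

text \<open>The \<open>THE\<close> is justified because all paths of the reduction from
  \<open>u\<close> to \<open>v\<close> are increasing listings of the same set.\<close>

lemma reduced_path: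
  assumes uv: "(u, v) \<in> A"
  shows "sorted_wrt (\<lambda>x y. (x, y) \<in> A) (reduced_path A u v)"
    and "set (reduced_path A u v) = support A u v"
    and "distinct (reduced_path A u v)" "reduced_path A u v \<noteq> []"
    and "hd (reduced_path A u v) = u" "last (reduced_path A u v) = v"
proof -
  obtain f :: "'v \<Rightarrow> nat" where f: "inj f" "\<And>x y. (x, y) \<in> A \<Longrightarrow> f x < f y"
    using injective_numbering[OF acyclic_arcs] by blast
  have "p = q" if "dipath (transitive_reduction A) u p v" "dipath (transitive_reduction A) u q v" for p q
  proof -
    have "sorted_wrt (<) (map f l) \<and> set (map f l) = f ` support A u v"
      if "dipath (transitive_reduction A) u l v" for l
      using dipath_reduced_set[OF uv that] f(2)
      by (auto simp: sorted_wrt_map elim: sorted_wrt_mono_rel[rotated])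
    then have "map f p = map f q" using that by (intro sorted_distinct_set_unique) (auto simp: strict_sorted_iff)
    then show ?thesis using f(1) by simp
  qed
  then have d: "dipath (transitive_reduction A) u (reduced_path A u v) v"
    unfolding reduced_path_def using dipath_reduced_exists[OF uv] by (intro theI'[of "\<lambda>p. dipath _ u p v"]) blast
  show "sorted_wrt (\<lambda>x y. (x, y) \<in> A) (reduced_path A u v)"
    "set (reduced_path A u v) = support A u v"
    using dipath_reduced_set[OF uv d] by auto
  show "distinct (reduced_path A u v)" "reduced_path A u v \<noteq> []"
    "hd (reduced_path A u v) = u" "last (reduced_path A u v) = v"
    using d unfolding dipath_def by auto
qed

text \<open>A shortest directed cycle of \<open>reorient A R\<close> is chordless, and being vertebrate and filled excludes
  induced cycles of length at least 4.\<close>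

lemma acyclic_reorientI:
  assumes RA: "R \<subseteq> A"
    and closed: "\<And>x y z. (x, y) \<in> R \<Longrightarrow> (y, z) \<in> R \<Longrightarrow> (x, z) \<in> A \<Longrightarrow> (x, z) \<in> R"
    and coclosed: "\<And>x y z. (x, z) \<in> R \<Longrightarrow> (x, y) \<in> A \<Longrightarrow> (y, z) \<in> A \<Longrightarrow> (x, y) \<in> R \<or> (y, z) \<in> R"
  shows "acyclic (reorient A R)"
proof (rule ccontr)
  let ?O = "reorient A R"
  assume "\<not> acyclic ?O"
  then obtain x where "(x, x) \<in> ?O\<^sup>+" unfolding acyclic_def by blast
  then have ex: "\<exists>n. 0 < n \<and> (\<exists>x. (x, x) \<in> ?O ^^ n)" by (auto simp: trancl_power)
  define n where "n = (LEAST n. 0 < n \<and> (\<exists>x. (x, x) \<in> ?O ^^ n))"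
  have "0 < n \<and> (\<exists>x. (x, x) \<in> ?O ^^ n)" unfolding n_def using ex by (rule LeastI_ex)
  then obtain x where n0: "0 < n" and x: "(x, x) \<in> ?O ^^ n" by blast
  have short: "(y, y) \<notin> ?O ^^ m" if "0 < m" "m < n" for y m
    using not_less_Least that unfolding n_def by blast
  obtain c where c: "c 0 = x" "c n = x" "\<And>i. i < n \<Longrightarrow> (c i, c (Suc i)) \<in> ?O"
    using x unfolding relpow_fun_conv by blast
  have seg: "i \<le> j \<Longrightarrow> j \<le> n \<Longrightarrow> (c i, c j) \<in> ?O ^^ (j - i)" for i j
  proof (induction j rule: dec_induct)
    case (step j)
    then show ?case using c(3)[of j] by (auto simp: Suc_diff_le)
  qed simp
  have adjO: "(a, b) \<in> A \<union> A\<inverse> \<longleftrightarrow> (a, b) \<in> ?O \<union> ?O\<inverse>" for a b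
    unfolding reorient_def using RA by blast
  \<comment> \<open>A chord of a shortest cycle, in whichever direction it is oriented, closes one
    of the two parts of the cycle to a shorter one.\<close>
  have nonadj: "j = Suc i \<or> (i = 0 \<and> j = n - 1)" if "i < j" "j < n" "(c i, c j) \<in> A \<union> A\<inverse>" for i j
  proof (rule ccontr)
    assume neg: "\<not> ?thesis"
    from that(3) consider "(c j, c i) \<in> ?O" | "(c i, c j) \<in> ?O" unfolding adjO by blast
    then show False
    proof cases
      case 1
      have "(c i, c i) \<in> ?O ^^ Suc (j - i)" using seg[of i j] 1 that by auto
      moreover have "Suc (j - i) < n" using that neg by auto
      ultimately show False using short by blast
    next
      case 2
      have "(c 0, c j) \<in> ?O ^^ Suc i" using seg[of 0 i] 2 that by auto
      moreover have "(c j, c n) \<in> ?O ^^ (n - j)" using seg[of j n] that by auto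
      ultimately have "(c 0, c n) \<in> ?O ^^ (Suc i + (n - j))" unfolding relpow_add by blast
      moreover have "Suc i + (n - j) < n" using that neg by auto
      ultimately show False using short[of "Suc i + (n - j)" x] c by simp
    qed
  qed
  \<comment> \<open>An acyclic triangle becomes cyclic either by reversing just its long arc, which
    \<open>coclosed\<close> forbids, or by reversing just its two short arcs, which
    \<open>closed\<close> forbids.\<close>
  have no3: False if "(a, b) \<in> ?O" "(b, d) \<in> ?O" "(d, a) \<in> ?O" for a b d
  proof -
    have ac: "\<not> ((p, q) \<in> A \<and> (q, r) \<in> A \<and> (r, p) \<in> A)" for p q r
      using arc_no_cycle[of p r] by (meson r_into_rtrancl rtrancl_trans)
    show False
      using that RA ac[of a b d] ac[of d b a] closed[of a d b] closed[of b a d] closed[of d b a]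
        coclosed[of a d b] coclosed[of b a d] coclosed[of d b a]
      unfolding reorient_def by blast
  qed
  have "n \<noteq> 1" using c(3)[of 0] c(1,2) arc_irrefl adjO[of x x] by auto
  moreover have "n \<noteq> 2"
  proof
    assume "n = 2"
    then have "(c 0, c 1) \<in> ?O" "(c 1, c 0) \<in> ?O" using c(3)[of 0] c(3)[of 1] c(1,2) by (auto simp: numeral_2_eq_2)
    then show False unfolding reorient_def using arc_asym RA by blast
  qed
  moreover have "n \<noteq> 3"
  proof
    assume n3: "n = 3"
    then have "(c 0, c 1) \<in> ?O" "(c 1, c 2) \<in> ?O" "(c 2, c 0) \<in> ?O"
      using c(3)[of 0] c(3)[of 1] c(3)[of 2] c(1,2) by (auto simp: numeral_2_eq_2 numeral_3_eq_3)
    then show False by (rule no3)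
  qed
  ultimately have n4: "4 \<le> n" using n0 by linarith
  define W where "W = c ` {..<n}"
  let ?T = "transitive_reduction (Restr A W)"
  let ?adj = "\<lambda>i j. (c i, c j) \<in> A \<union> A\<inverse>"
  \<comment> \<open>A chordless cycle of length at least 4 contains no triangle, so no arc of the
    induced subgraph is lost in its transitive reduction, and the whole cycle survives.\<close>
  have tri: False if "i < j" "j < k" "k < n" "?adj i j" "?adj j k" "?adj i k" for i j k
    using nonadj[of i j] nonadj[of j k] nonadj[of i k] that n4 by linarith
  have TW: "(a, b) \<in> ?T" if ab: "(a, b) \<in> Restr A W" for a b
  proof (rule ccontr)
    assume "(a, b) \<notin> ?T"
    then obtain z where z: "z \<in> W" "(a, z) \<in> A" "(z, b) \<in> A"
      using not_reduced_imp_triangle[OF ab] by blast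
    obtain i j k where ijk: "i < n" "j < n" "k < n" "a = c i" "b = c j" "z = c k"
      using ab z(1) unfolding W_def by auto
    have adj: "?adj i j" "?adj j i" "?adj j k" "?adj k j" "?adj i k" "?adj k i" using ab z ijk by auto
    have "i \<noteq> j" "j \<noteq> k" "i \<noteq> k" using ab z ijk arc_irrefl by auto
    then consider "i < j \<and> j < k" | "i < k \<and> k < j" | "j < i \<and> i < k" | "j < k \<and> k < i"
      | "k < i \<and> i < j" | "k < j \<and> j < i" by linarith
    then show False using tri adj ijk by cases blast+
  qed
  let ?p = "map c [0..<n]"
  have TO: "(a, b) \<in> ?T \<union> ?T\<inverse>" if "(a, b) \<in> ?O" "a \<in> W" "b \<in> W" for a b
  proof -
    have "(a, b) \<in> A \<union> A\<inverse>" using adjO that by blast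
    then show ?thesis using TW that by blast
  qed
  have "distinct ?p"
  proof -
    have "c i \<noteq> c j" if "i < j" "j < n" for i j
    proof
      assume "c i = c j"
      then have "(c i, c i) \<in> ?O ^^ (j - i)" using seg[of i j] that by simp
      then show False using short[of "j - i" "c i"] that by simp
    qed
    then have "inj_on c {0..<n}" by (intro linorder_inj_onI) auto
    then show ?thesis by (simp add: distinct_map)
  qed
  moreover have "successively (\<lambda>x y. (x, y) \<in> ?T \<union> ?T\<inverse>) ?p"
    unfolding successively_conv_nth
  proof (intro allI impI)
    fix i assume i: "Suc i < length ?p"
    then have "(c i, c (Suc i)) \<in> ?T \<union> ?T\<inverse>" by (intro TO c(3)) (auto simp: W_def)
    then show "(?p ! i, ?p ! Suc i) \<in> ?T \<union> ?T\<inverse>" using i by simp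
  qed
  moreover have "(last ?p, hd ?p) \<in> ?T \<union> ?T\<inverse>"
  proof -
    have "(c (n - 1), c (Suc (n - 1))) \<in> ?O" using n0 by (intro c(3)) auto
    then have "(c (n - 1), c 0) \<in> ?O" using n0 c(1,2) by simp
    then have "(c (n - 1), c 0) \<in> ?T \<union> ?T\<inverse>" by (rule TO) (use n0 in \<open>auto simp: W_def\<close>)
    then show ?thesis using n0 by (simp add: hd_map last_map)
  qed
  moreover have "3 \<le> length ?p" using n4 by simp
  moreover have "is_forest ?T"
    using skeletal_arcs unfolding skeletal_def vertebrate_def by blast
  ultimately show False unfolding is_forest_def by blast
qed

end

subsection \<open>Acyclic reorientations\<close>

context skeletal_dag begin

definition AR :: "'v rel set" where
  "AR = {R. R \<subseteq> A \<and> acyclic (reorient A R)}"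

abbreviation "L \<equiv> acyclic_reorientations A"

lemma carrier_L: "carrier L = AR"
  unfolding acyclic_reorientations_def AR_def by simp

lemma le_L: "R \<sqsubseteq>\<^bsub>L\<^esub> R' \<longleftrightarrow> R \<subseteq> R'"
  unfolding acyclic_reorientations_def by simp

lemma lless_L: "R \<sqsubset>\<^bsub>L\<^esub> R' \<longleftrightarrow> R \<subset> R'"
  unfolding acyclic_reorientations_def lless_def by auto

lemma AR_subset: "R \<in> AR \<Longrightarrow> R \<subseteq> A"
  unfolding AR_def by simp

text \<open>An acyclic reorientation is the inversion set of a numbering of the vertices. Facts
  about \<open>R\<close> thereby become comparisons of numbers.\<close>

lemma AR_numbering:
  assumes "R \<in> AR"
  obtains y :: "'v \<Rightarrow> nat" where "inj y" "\<And>a b. (a, b) \<in> A \<Longrightarrow> (a, b) \<in> R \<longleftrightarrow> y b < y a"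
proof -
  have R: "R \<subseteq> A" "acyclic (reorient A R)" using assms unfolding AR_def by auto
  obtain y :: "'v \<Rightarrow> nat" where y: "inj y" "\<And>a b. (a, b) \<in> reorient A R \<Longrightarrow> y a < y b"
    using injective_numbering[OF R(2)] by blast
  have neg: "(a, b) \<in> R \<Longrightarrow> y b < y a" and pos: "(a, b) \<in> A \<Longrightarrow> (a, b) \<notin> R \<Longrightarrow> y a < y b" for a b
    using y(2) unfolding reorient_def by auto
  show thesis
  proof (rule that[OF y(1)])
    fix a b assume ab: "(a, b) \<in> A"
    show "(a, b) \<in> R \<longleftrightarrow> y b < y a" using neg[of a b] pos[OF ab] by (cases "(a, b) \<in> R") auto
  qed
qed

lemma AR_closed:
  assumes "R \<in> AR" "(x, y) \<in> R" "(y, z) \<in> R" "(x, z) \<in> A"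
  shows "(x, z) \<in> R"
proof -
  obtain h :: "'v \<Rightarrow> nat" where "inj h" and h: "\<And>a b. (a, b) \<in> A \<Longrightarrow> (a, b) \<in> R \<longleftrightarrow> h b < h a"
    by (rule AR_numbering[OF assms(1)], rule that)
  have "(x, y) \<in> A" "(y, z) \<in> A" using AR_subset[OF assms(1)] assms(2,3) by auto
  then show ?thesis using h[of x y] h[of y z] h[of x z] assms by simp
qed

lemma AR_coclosed:
  assumes "R \<in> AR" "(x, z) \<in> R" "(x, y) \<in> A" "(y, z) \<in> A"
  shows "(x, y) \<in> R \<or> (y, z) \<in> R"
proof -
  obtain h :: "'v \<Rightarrow> nat" where "inj h" and h: "\<And>a b. (a, b) \<in> A \<Longrightarrow> (a, b) \<in> R \<longleftrightarrow> h b < h a"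
    by (rule AR_numbering[OF assms(1)], rule that)
  have "(x, z) \<in> A" using AR_subset[OF assms(1)] assms(2) by auto
  then show ?thesis using h[of x y] h[of y z] h[of x z] assms by linarith
qed

lemma AR_I:
  assumes "R \<subseteq> A"
    and "\<And>x y z. (x, y) \<in> R \<Longrightarrow> (y, z) \<in> R \<Longrightarrow> (x, z) \<in> A \<Longrightarrow> (x, z) \<in> R"
    and "\<And>x y z. (x, z) \<in> R \<Longrightarrow> (x, y) \<in> A \<Longrightarrow> (y, z) \<in> A \<Longrightarrow> (x, y) \<in> R \<or> (y, z) \<in> R"
  shows "R \<in> AR"
  using acyclic_reorientI[OF assms] assms(1) unfolding AR_def by simp

lemma AR_trancl:
  assumes R: "R \<in> AR" and "(x, y) \<in> R\<^sup>+" and xy: "(x, y) \<in> A"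
  shows "(x, y) \<in> R"
proof -
  obtain h :: "'v \<Rightarrow> nat" where "inj h" and h: "\<And>a b. (a, b) \<in> A \<Longrightarrow> (a, b) \<in> R \<longleftrightarrow> h b < h a"
    by (rule AR_numbering[OF R], rule that)
  have "h y < h x" using assms(2)
  proof (induction rule: trancl_induct)
    case (base y)
    then show ?case using h AR_subset[OF R] by blast
  next
    case (step y z)
    then show ?case using h[of y z] AR_subset[OF R] by auto
  qed
  then show ?thesis using h[OF xy] by simp
qed

section \<open>Joins and meets of acyclic reorientations\<close>

lemma least_Upper_L:
  assumes "R \<in> AR" "R' \<in> AR"
  shows "least L Z (Upper L {R, R'}) \<longleftrightarrow>
    Z \<in> AR \<and> R \<subseteq> Z \<and> R' \<subseteq> Z \<and> (\<forall>Y\<in>AR. R \<subseteq> Y \<and> R' \<subseteq> Y \<longrightarrow> Z \<subseteq> Y)"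
proof -
  have "Upper L {R, R'} = {Y \<in> AR. R \<subseteq> Y \<and> R' \<subseteq> Y}"
    unfolding Upper_def carrier_L le_L using assms by auto
  then show ?thesis unfolding least_def carrier_L le_L by (simp add: Ball_def imp_conjL)
qed

lemma greatest_Lower_L:
  assumes "R \<in> AR" "R' \<in> AR"
  shows "greatest L Z (Lower L {R, R'}) \<longleftrightarrow>
    Z \<in> AR \<and> Z \<subseteq> R \<and> Z \<subseteq> R' \<and> (\<forall>Y\<in>AR. Y \<subseteq> R \<and> Y \<subseteq> R' \<longrightarrow> Y \<subseteq> Z)"
proof -
  have "Lower L {R, R'} = {Y \<in> AR. Y \<subseteq> R \<and> Y \<subseteq> R'}"
    unfolding Lower_def carrier_L le_L using assms by auto
  then show ?thesis unfolding greatest_def carrier_L le_L by (simp add: Ball_def imp_conjL)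
qed

lemma join_eqI:
  assumes "R \<in> AR" "R' \<in> AR" "Z \<in> AR" "R \<subseteq> Z" "R' \<subseteq> Z"
    and "\<And>Y. Y \<in> AR \<Longrightarrow> R \<subseteq> Y \<Longrightarrow> R' \<subseteq> Y \<Longrightarrow> Z \<subseteq> Y"
  shows "R \<squnion>\<^bsub>L\<^esub> R' = Z"
  unfolding join_def sup_def least_Upper_L[OF assms(1,2)]
proof (rule some_equality)
  show "Z \<in> AR \<and> R \<subseteq> Z \<and> R' \<subseteq> Z \<and> (\<forall>Y\<in>AR. R \<subseteq> Y \<and> R' \<subseteq> Y \<longrightarrow> Z \<subseteq> Y)"
    using assms(3-5) by (intro conjI ballI impI assms(6)) auto
  fix X assume X: "X \<in> AR \<and> R \<subseteq> X \<and> R' \<subseteq> X \<and> (\<forall>Y\<in>AR. R \<subseteq> Y \<and> R' \<subseteq> Y \<longrightarrow> X \<subseteq> Y)"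
  show "X = Z"
  proof
    show "X \<subseteq> Z" using X assms(3-5) by simp
    show "Z \<subseteq> X" using X by (intro assms(6)) simp_all
  qed
qed

lemma meet_eqI:
  assumes "R \<in> AR" "R' \<in> AR" "Z \<in> AR" "Z \<subseteq> R" "Z \<subseteq> R'"
    and "\<And>Y. Y \<in> AR \<Longrightarrow> Y \<subseteq> R \<Longrightarrow> Y \<subseteq> R' \<Longrightarrow> Y \<subseteq> Z"
  shows "R \<sqinter>\<^bsub>L\<^esub> R' = Z"
  unfolding meet_def inf_def greatest_Lower_L[OF assms(1,2)]
proof (rule some_equality)
  show "Z \<in> AR \<and> Z \<subseteq> R \<and> Z \<subseteq> R' \<and> (\<forall>Y\<in>AR. Y \<subseteq> R \<and> Y \<subseteq> R' \<longrightarrow> Y \<subseteq> Z)"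
    using assms(3-5) by (intro conjI ballI impI assms(6)) auto
  fix X assume X: "X \<in> AR \<and> X \<subseteq> R \<and> X \<subseteq> R' \<and> (\<forall>Y\<in>AR. Y \<subseteq> R \<and> Y \<subseteq> R' \<longrightarrow> Y \<subseteq> X)"
  show "X = Z"
  proof
    show "X \<subseteq> Z" using X by (intro assms(6)) simp_all
    show "Z \<subseteq> X" using X assms(3-5) by simp
  qed
qed

text \<open>Everything above \<open>R\<close> and \<open>R'\<close> contains the arcs of this
  transitive closure. What has to be shown is that the closure creates no orientation with a cycle,
  which comes down to coclosedness.\<close>

lemma join_exists:
  assumes R: "R \<in> AR" and R': "R' \<in> AR"
  shows "{(u, v) \<in> A. (u, v) \<in> (R \<union> R')\<^sup>+} \<in> AR" (is "?J \<in> AR")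
    and "R \<squnion>\<^bsub>L\<^esub> R' = {(u, v) \<in> A. (u, v) \<in> (R \<union> R')\<^sup>+}"
proof -
  let ?T = "R \<union> R'"
  have TA: "?T \<subseteq> A" using AR_subset R R' by blast
  have Tco: "(x, y) \<in> ?T \<or> (y, z) \<in> ?T" if "(x, z) \<in> ?T" "(x, y) \<in> A" "(y, z) \<in> A" for x y z
    using AR_coclosed[OF R] AR_coclosed[OF R'] that by blast
  have TAstar: "(x, y) \<in> A\<^sup>*" if "(x, y) \<in> ?T\<^sup>+" for x y
    using trancl_mono[OF that TA] by auto
  \<comment> \<open>The first vertex \<open>y\<close> after \<open>u\<close> on a chain of reversed
    arcs lies in the support of \<open>(u, w)\<close>, so it is comparable with \<open>v\<close>. If
    \<open>y\<close> comes first, the rest of the chain is split by induction; if \<open>v\<close>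
    comes first, the single arc from \<open>u\<close> to \<open>y\<close> is split.\<close>
  have co: "(u, v) \<in> ?T\<^sup>+ \<or> (v, w) \<in> ?T\<^sup>+" if "(u, w) \<in> ?T\<^sup>+" "(u, w) \<in> A" "(u, v) \<in> A" "(v, w) \<in> A" for u v w
    using that
  proof (induction rule: converse_trancl_induct)
    case (base u)
    then show ?case using Tco[of u w v] by blast
  next
    case (step u y)
    have uy: "(u, y) \<in> A" using step(1) TA by blast
    have y: "y \<in> support A u w"
      using between_arcs[OF step.prems(1)] uy TAstar[OF step(2)] by blast
    have "y \<noteq> w"
      using trancl_mono[OF step(2) TA] acyclic_arcs unfolding acyclic_def by blast
    then have yw: "(y, w) \<in> A" using y uy arc_irrefl[of u] unfolding support_def by blast
    have v: "v \<in> support A u w" using step.prems unfolding support_def by blast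
    consider "v = y" | "(y, v) \<in> A" | "(v, y) \<in> A"
      using support_linear[OF step.prems(1) v y] by blast
    then show ?case
    proof cases
      case 1
      then show ?thesis using step(1) by blast
    next
      case 2
      then have "(y, v) \<in> ?T\<^sup>+ \<or> (v, w) \<in> ?T\<^sup>+" using step.IH yw step.prems by blast
      then show ?thesis using step(1) by (meson r_into_trancl trancl_trans)
    next
      case 3
      then have "(u, v) \<in> ?T \<or> (v, y) \<in> ?T" using Tco[OF step(1) step.prems(2)] by blast
      then show ?thesis using step(2) by (meson r_into_trancl trancl_trans)
    qed
  qed
  show J: "?J \<in> AR"
  proof (rule AR_I)
    fix x y z assume "(x, y) \<in> ?J" "(y, z) \<in> ?J" "(x, z) \<in> A"
    then show "(x, z) \<in> ?J" by (auto intro: trancl_trans)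
  next
    fix x y z assume "(x, z) \<in> ?J" "(x, y) \<in> A" "(y, z) \<in> A"
    then show "(x, y) \<in> ?J \<or> (y, z) \<in> ?J" using co[of x z y] by auto
  qed auto
  show "R \<squnion>\<^bsub>L\<^esub> R' = ?J"
  proof (rule join_eqI[OF R R' J])
    show "R \<subseteq> ?J" "R' \<subseteq> ?J" using TA by auto
    fix Y assume Y: "Y \<in> AR" "R \<subseteq> Y" "R' \<subseteq> Y"
    then have "?T\<^sup>+ \<subseteq> Y\<^sup>+" by (intro subsetI) (auto elim: trancl_mono)
    then show "?J \<subseteq> Y" using AR_trancl[OF Y(1)] by auto
  qed
qed

text \<open>Among the arcs on which \<open>R\<close> and \<open>R'\<close> differ, one whose endpoints are closest in a linear
  extension of \<open>R\<close> can be flipped: any other path between its endpoints would survive in \<open>R'\<close>.\<close>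

lemma AR_exchange:
  assumes R: "R \<in> AR" and R': "R' \<in> AR" and "R \<noteq> R'"
  shows "(\<exists>e\<in>R' - R. insert e R \<in> AR) \<or> (\<exists>e\<in>R - R'. R - {e} \<in> AR)"
proof -
  let ?O = "reorient A R" and ?O' = "reorient A R'"
  have sub: "R \<subseteq> A" "R' \<subseteq> A" and acO: "acyclic ?O" and acO': "acyclic ?O'"
    using R R' unfolding AR_def by auto
  obtain h :: "'v \<Rightarrow> nat" where h: "inj h" "\<And>x y. (x, y) \<in> ?O \<Longrightarrow> h x < h y"
    using injective_numbering[OF acO] by blast
  define D where "D = {(x, y) \<in> ?O. (y, x) \<in> ?O'}"
  have "D \<noteq> {}"
  proof -
    obtain e where "e \<in> (R' - R) \<union> (R - R')" using \<open>R \<noteq> R'\<close> by blast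
    then have "e \<in> D \<or> (snd e, fst e) \<in> D"
      using sub unfolding D_def reorient_def by (cases e) auto
    then show ?thesis by blast
  qed
  then obtain xy where xyD: "xy \<in> D"
    and min: "\<And>ab. ab \<in> D \<Longrightarrow> h (snd xy) - h (fst xy) \<le> h (snd ab) - h (fst ab)"
    using ex_has_least_nat[of "\<lambda>ab. ab \<in> D" _ "\<lambda>ab. h (snd ab) - h (fst ab)"] by blast
  obtain x y where xy: "xy = (x, y)" by (cases xy)
  have xyO: "(x, y) \<in> ?O" "(y, x) \<in> ?O'" using xyD xy unfolding D_def by auto
  let ?P = "?O - {(x, y)}"
  \<comment> \<open>An arc on such a path spans at most the gap of \<open>(x, y)\<close>, and the
    arc \<open>(x, y)\<close> itself is excluded, so by minimality no arc of the path is reversed in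
    \<open>?O'\<close>. A second path from \<open>x\<close> to \<open>y\<close> would close a cycle
    there.\<close>
  have path: "(x, z) \<in> ?O'\<^sup>*" if "(x, z) \<in> ?P\<^sup>*" "h z \<le> h y" for z
    using that
  proof (induction rule: rtrancl_induct)
    case (step q t)
    have qt: "h q < h t" using step(2) h(2) by auto
    have "h x \<le> h q" using step(1)
    proof (induction rule: rtrancl_induct)
      case (step b c)
      then show ?case using h(2)[of b c] by auto
    qed simp
    have "(q, t) \<notin> D"
    proof
      assume "(q, t) \<in> D"
      then have "h y - h x \<le> h t - h q" using min xy by fastforce
      then have "h q = h x" "h t = h y" using \<open>h x \<le> h q\<close> step.prems qt h(2)[OF xyO(1)] by linarith+
      then show False using step(2) h(1) by (auto simp: inj_eq)
    qed
    then have "(q, t) \<in> ?O'" using step(2) sub unfolding D_def reorient_def by blast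
    moreover have "(x, q) \<in> ?O'\<^sup>*" using step.IH step.prems qt by simp
    ultimately show ?case by (rule rtrancl_into_rtrancl[rotated])
  qed simp
  have "(x, y) \<notin> ?P\<^sup>*"
  proof
    assume "(x, y) \<in> ?P\<^sup>*"
    from path[OF this] have "(x, y) \<in> ?O'\<^sup>*" by simp
    then have "(y, y) \<in> ?O'\<^sup>+" using xyO(2) by (rule rtrancl_into_trancl2[rotated])
    then show False using acO' unfolding acyclic_def by blast
  qed
  moreover have "acyclic ?P" using acO by (rule acyclic_subset) auto
  ultimately have ac: "acyclic (insert (y, x) ?P)" by (simp add: acyclic_insert)
  have "x \<noteq> y" using h(2)[OF xyO(1)] by auto
  from xyO(1) consider "(x, y) \<in> A" "(x, y) \<notin> R" | "(y, x) \<in> R" unfolding reorient_def by blast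
  then show ?thesis
  proof cases
    case 1
    have "(x, y) \<in> R'" using xyO(2) arc_asym[OF 1(1)] unfolding reorient_def by blast
    moreover have "reorient A (insert (x, y) R) \<subseteq> insert (y, x) ?P"
      using 1 arc_asym[OF 1(1)] sub unfolding reorient_def by blast
    then have "insert (x, y) R \<in> AR"
      using ac 1 sub acyclic_subset unfolding AR_def by blast
    ultimately show ?thesis using 1 by blast
  next
    case 2
    have "(y, x) \<in> A" using 2 sub by blast
    have "(y, x) \<notin> R'" using xyO(2) arc_asym[OF \<open>(y, x) \<in> A\<close>] sub unfolding reorient_def by blast
    moreover have "reorient A (R - {(y, x)}) \<subseteq> insert (y, x) ?P"
      using 2 arc_asym[OF \<open>(y, x) \<in> A\<close>] sub unfolding reorient_def by blast
    then have "R - {(y, x)} \<in> AR"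
      using ac sub acyclic_subset unfolding AR_def by blast
    ultimately show ?thesis using 2 by blast
  qed
qed

text \<open>\<open>g\<close> rearranges the support and leaves all arcs outside it untouched. The
  comparison is strict, so arcs between vertices with equal values keep their direction.\<close>

definition level_set :: "'v \<Rightarrow> 'v \<Rightarrow> ('v \<Rightarrow> nat) \<Rightarrow> 'v rel" where
  "level_set u v g = {(w, w') \<in> A. w \<in> support A u v \<and> w' \<in> support A u v \<and> g w' < g w}"

text \<open>The potential \<open>k\<close> increases lexicographically along every arc. Its first
  entry puts vertices that can reach the support below it and the remaining outside vertices above
  it, which is consistent because the support is convex; then \<open>g\<close> decides inside the
  support and the linear extension \<open>f\<close> breaks ties.\<close>

lemma level_set_AR:
  assumes uv: "(u, v) \<in> A"
  shows "level_set u v g \<in> AR"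
proof -
  let ?S = "support A u v"
  obtain f :: "'v \<Rightarrow> nat" where "inj f" and f: "\<And>x y. (x, y) \<in> A \<Longrightarrow> f x < f y"
    by (rule injective_numbering[OF acyclic_arcs], rule that)
  define lev :: "'v \<Rightarrow> nat" where
    "lev w = (if w \<in> ?S then 1 else if \<exists>s\<in>?S. (w, s) \<in> A\<^sup>* then 0 else 2)" for w
  define k where "k w = (lev w, (if w \<in> ?S then g w else 0), f w)" for w
  let ?lex = "inv_image (less_than <*lex*> less_than <*lex*> less_than) k"
  have "reorient A (level_set u v g) \<subseteq> ?lex"
  proof (rule subsetI, clarify)
    fix x y assume "(x, y) \<in> reorient A (level_set u v g)"
    then consider "(x, y) \<in> A" "(x, y) \<notin> level_set u v g" | "(y, x) \<in> level_set u v g"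
      unfolding reorient_def by blast
    then show "(x, y) \<in> ?lex"
    proof cases
      case 1
      note fxy = f[OF 1(1)]
      show ?thesis
      proof (cases "x \<in> ?S \<and> y \<in> ?S")
        case True
        then show ?thesis using 1 fxy unfolding level_set_def k_def lev_def by auto
      next
        case False
        have "lev x < lev y" if "x \<in> ?S" "y \<notin> ?S"
        proof -
          have "\<not> (\<exists>s\<in>?S. (y, s) \<in> A\<^sup>*)"
            using support_convex[OF uv that(1) _ r_into_rtrancl[OF 1(1)]] that(2) by blast
          then show ?thesis using that unfolding lev_def by simp
        qed
        moreover have "lev x < lev y" if "x \<notin> ?S" "y \<in> ?S"
        proof -
          have "\<exists>s\<in>?S. (x, s) \<in> A\<^sup>*" using that(2) r_into_rtrancl[OF 1(1)] by blast
          then show ?thesis using that unfolding lev_def by simp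
        qed
        moreover have "lev x \<le> lev y" if "x \<notin> ?S" "y \<notin> ?S"
        proof -
          have "\<exists>s\<in>?S. (x, s) \<in> A\<^sup>*" if "\<exists>s\<in>?S. (y, s) \<in> A\<^sup>*"
            using that 1(1) by (blast intro: converse_rtrancl_into_rtrancl)
          then show ?thesis using that unfolding lev_def by auto
        qed
        ultimately have "lev x < lev y \<or> (x \<notin> ?S \<and> y \<notin> ?S \<and> lev x \<le> lev y)"
          using False by blast
        then show ?thesis using fxy unfolding k_def by auto
      qed
    next
      case 2
      then show ?thesis unfolding level_set_def k_def lev_def by auto
    qed
  qed
  moreover have "acyclic ?lex" by (intro wf_acyclic wf_inv_image wf_lex_prod wf_less_than)
  ultimately show ?thesis unfolding AR_def level_set_def using acyclic_subset by blast
qed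

end

subsection \<open>Congruences and forcing among ropes\<close>

text \<open>Labels the cover from \<open>R\<close> to \<open>insert (a, b) R\<close>. At such a
  cover a vertex between \<open>a\<close> and \<open>b\<close> lies on the same side of both, so the
  arc from \<open>a\<close> alone decides its side.\<close>

definition rope_of :: "'v rel \<Rightarrow> 'v rel \<Rightarrow> 'v \<Rightarrow> 'v \<Rightarrow> 'v rope" where
  "rope_of A R a b = (a, b, {w \<in> support A a b - {a, b}. (a, w) \<in> R},
                            {w \<in> support A a b - {a, b}. (a, w) \<notin> R})"

definition subrope :: "'v rel \<Rightarrow> 'v rope \<Rightarrow> 'v \<Rightarrow> 'v \<Rightarrow> 'v rope" where
  "subrope A = (\<lambda>(u, v, N, D) a b. (a, b, N \<inter> (support A a b - {a, b}), D \<inter> (support A a b - {a, b})))"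

context skeletal_dag begin

lemma ropes_iff:
  "(u, v, N, D) \<in> ropes A \<longleftrightarrow> (u, v) \<in> A \<and> N \<inter> D = {} \<and> N \<union> D = support A u v - {u, v}"
  unfolding ropes_def using transitive_support_eq by auto

lemma rope_of_in_ropes: "(a, b) \<in> A \<Longrightarrow> rope_of A R a b \<in> ropes A"
  unfolding rope_of_def ropes_iff by auto

lemma I_join_iff:
  "(w, w') \<in> I_join A (u, v, N, D) \<longleftrightarrow> (w, w') \<in> A \<and> (w = u \<or> w \<in> D) \<and> (w' = v \<or> w' \<in> N)"
  unfolding I_join_def by auto

text \<open>\<open>I_join\<close> and its lower cover are the inversion sets, within the support, of linear orders that
  put \<open>N\<close> first and \<open>D\<close> last and differ by the transposition of \<open>u\<close> and \<open>v\<close>.\<close>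

lemma
  assumes \<rho>: "(u, v, N, D) \<in> ropes A"
  shows I_join_AR: "I_join A (u, v, N, D) \<in> AR"
    and I_join_lower_AR: "I_join A (u, v, N, D) - {(u, v)} \<in> AR"
proof -
  have uv: "(u, v) \<in> A" and dis: "N \<inter> D = {}" and un: "N \<union> D = support A u v - {u, v}"
    using \<rho> unfolding ropes_iff by auto
  have ne: "u \<noteq> v" "u \<notin> N" "u \<notin> D" "v \<notin> N" "v \<notin> D" using uv arc_irrefl un by auto
  have S: "w \<in> support A u v \<longleftrightarrow> w = u \<or> w = v \<or> w \<in> N \<or> w \<in> D" for w
    using un unfolding support_def by auto
  have no: "(w, u) \<notin> A \<and> (v, w) \<notin> A" if "w \<in> support A u v" for w
    using that uv arc_irrefl arc_asym unfolding support_def by blast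
  have "I_join A (u, v, N, D) = level_set u v (\<lambda>w. if w \<in> N then 0 else if w = v then 1 else if w = u then 2 else 3)"
    (is "_ = level_set u v ?g")
  proof -
    have "(w, w') \<in> I_join A (u, v, N, D) \<longleftrightarrow> (w, w') \<in> level_set u v ?g" for w w'
      unfolding I_join_iff level_set_def using S no[of w] no[of w'] ne dis by auto
    then show ?thesis by auto
  qed
  then show "I_join A (u, v, N, D) \<in> AR" using level_set_AR[OF uv] by simp
  have "I_join A (u, v, N, D) - {(u, v)} = level_set u v (\<lambda>w. if w \<in> N then 0 else if w = u then 1 else if w = v then 2 else 3)"
    (is "_ = level_set u v ?g")
  proof -
    have "(w, w') \<in> I_join A (u, v, N, D) - {(u, v)} \<longleftrightarrow> (w, w') \<in> level_set u v ?g" for w w'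
      unfolding Diff_iff I_join_iff level_set_def using S no[of w] no[of w'] ne dis by auto
    then show ?thesis by auto
  qed
  then show "I_join A (u, v, N, D) - {(u, v)} \<in> AR" using level_set_AR[OF uv] by simp
qed

text \<open>Inside \<open>I_join\<close> the arcs from \<open>u\<close> into \<open>D\<close> and
  from \<open>N\<close> into \<open>v\<close> are unreversed, so any numbering of \<open>R\<close>
  has \<open>N\<close> weakly below \<open>v\<close>, \<open>v\<close> below \<open>u\<close>, and
  \<open>u\<close> weakly below \<open>D\<close>. Hence every proper subset in \<open>AR\<close>
  misses \<open>(u, v)\<close>, and the lower cover is unique.\<close>

lemma I_join_minimal:
  assumes \<rho>: "(u, v, N, D) \<in> ropes A" and R: "R \<in> AR" "R \<subseteq> I_join A (u, v, N, D)" "(u, v) \<in> R"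
  shows "R = I_join A (u, v, N, D)"
proof (intro equalityI R(2) subrelI)
  fix w w' assume ww: "(w, w') \<in> I_join A (u, v, N, D)"
  have uv: "(u, v) \<in> A" and dis: "N \<inter> D = {}" and un: "N \<union> D = support A u v - {u, v}"
    using \<rho> unfolding ropes_iff by auto
  have a: "(w, w') \<in> A" "w = u \<or> w \<in> D" "w' = v \<or> w' \<in> N" using ww unfolding I_join_iff by auto
  obtain h :: "'v \<Rightarrow> nat" where "inj h" and h: "\<And>a b. (a, b) \<in> A \<Longrightarrow> (a, b) \<in> R \<longleftrightarrow> h b < h a"
    by (rule AR_numbering[OF R(1)], rule that)
  have "h v < h u" using h[OF uv] R(3) by simp
  moreover have "h u \<le> h w"
  proof (cases "w = u")
    case False
    then have "w \<in> D" "(u, w) \<in> A" using a un unfolding support_def by auto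
    moreover have "(u, w) \<notin> R" using R(2) \<open>w \<in> D\<close> dis un by (auto simp: I_join_iff dest!: subsetD)
    ultimately show ?thesis using h by force
  qed simp
  moreover have "h w' \<le> h v"
  proof (cases "w' = v")
    case False
    then have "w' \<in> N" "(w', v) \<in> A" using a un unfolding support_def by auto
    moreover have "(w', v) \<notin> R" using R(2) \<open>w' \<in> N\<close> dis un by (auto simp: I_join_iff dest!: subsetD)
    ultimately show ?thesis using h by force
  qed simp
  ultimately show "(w, w') \<in> R" using h[OF a(1)] by simp
qed

lemma contracts_I_join_iff:
  assumes \<rho>: "(u, v, N, D) \<in> ropes A"
  shows "contracts L r (I_join A (u, v, N, D)) \<longleftrightarrow>
    (I_join A (u, v, N, D) - {(u, v)}, I_join A (u, v, N, D)) \<in> r"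
proof -
  let ?J = "I_join A (u, v, N, D)"
  have J: "?J \<in> AR" "?J - {(u, v)} \<in> AR" using I_join_AR[OF \<rho>] I_join_lower_AR[OF \<rho>] by auto
  have uvJ: "(u, v) \<in> ?J" using \<rho> unfolding ropes_iff I_join_iff by auto
  have "covered_by L x ?J \<longleftrightarrow> x = ?J - {(u, v)}" for x
  proof
    assume x: "covered_by L x ?J"
    then have x': "x \<in> AR" "x \<subset> ?J" "\<And>z. z \<in> AR \<Longrightarrow> \<not> (x \<subset> z \<and> z \<subset> ?J)"
      unfolding covered_by_def carrier_L lless_L by auto
    have "(u, v) \<notin> x" using I_join_minimal[OF \<rho> x'(1)] x'(2) by auto
    then have "x \<subseteq> ?J - {(u, v)}" using x'(2) by auto
    then show "x = ?J - {(u, v)}" using x'(3)[OF J(2)] uvJ by auto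
  next
    assume x: "x = ?J - {(u, v)}"
    have "\<not> (x \<subset> z \<and> z \<subset> ?J)" for z unfolding x by auto
    moreover have "x \<subset> ?J" unfolding x using uvJ by auto
    ultimately show "covered_by L x ?J"
      unfolding covered_by_def carrier_L lless_L using J x by auto
  qed
  then show ?thesis unfolding contracts_def join_irreducible_def carrier_L using J(1) by auto
qed

end

locale skeletal_congruence = skeletal_dag A for A :: "('v::finite) rel" +
  fixes r :: "'v rel rel"
  assumes congruence: "lattice_congruence (acyclic_reorientations A) r"
begin

lemma cong_equiv: "equiv AR r"
  using congruence unfolding lattice_congruence_def carrier_L by simp

lemma cong_refl: "R \<in> AR \<Longrightarrow> (R, R) \<in> r"
  using cong_equiv unfolding equiv_def refl_on_def by blast

lemma cong_sym: "(R, R') \<in> r \<Longrightarrow> (R', R) \<in> r"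
  using cong_equiv unfolding equiv_def by (meson symD)

lemma cong_trans: "(R, R') \<in> r \<Longrightarrow> (R', R'') \<in> r \<Longrightarrow> (R, R'') \<in> r"
  using cong_equiv unfolding equiv_def by (meson transD)

lemma cong_AR: "(R, R') \<in> r \<Longrightarrow> R \<in> AR \<and> R' \<in> AR"
  using cong_equiv unfolding equiv_def refl_on_def by blast

lemma cong_join: "(R, R') \<in> r \<Longrightarrow> Z \<in> AR \<Longrightarrow> (R \<squnion>\<^bsub>L\<^esub> Z, R' \<squnion>\<^bsub>L\<^esub> Z) \<in> r"
  using congruence cong_refl unfolding lattice_congruence_def by blast

lemma cong_meet: "(R, R') \<in> r \<Longrightarrow> Z \<in> AR \<Longrightarrow> (R \<sqinter>\<^bsub>L\<^esub> Z, R' \<sqinter>\<^bsub>L\<^esub> Z) \<in> r"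
  using congruence cong_refl unfolding lattice_congruence_def by blast

lemma cong_interval:
  assumes "(R, R') \<in> r" "R \<subseteq> Z" "Z \<subseteq> R'" "Z \<in> AR"
  shows "(R, Z) \<in> r"
proof -
  have "R \<in> AR" "R' \<in> AR" using cong_AR assms(1) by auto
  have "R \<sqinter>\<^bsub>L\<^esub> Z = R" by (rule meet_eqI) (use \<open>R \<in> AR\<close> assms in auto)
  moreover have "R' \<sqinter>\<^bsub>L\<^esub> Z = Z" by (rule meet_eqI) (use \<open>R' \<in> AR\<close> assms in auto)
  ultimately show ?thesis using cong_meet[OF assms(1,4)] by simp
qed

text \<open>The cover is perspective to the cover of the join irreducible \<open>?J\<close> over
  \<open>?K\<close>: joining with \<open>R\<close> sends \<open>?K\<close> and \<open>?J\<close> to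
  \<open>R\<close> and \<open>?R'\<close>, and meeting with \<open>?J\<close> goes back. The
  inclusion of \<open>?J\<close> in \<open>?R'\<close> holds because in \<open>?R'\<close> the
  vertices of \<open>N\<close> stay below \<open>b\<close> and those of \<open>D\<close> above
  \<open>a\<close>.\<close>

lemma cover_contracted_iff:
  assumes R: "R \<in> AR" "insert (a, b) R \<in> AR" "(a, b) \<notin> R"
  shows "(R, insert (a, b) R) \<in> r \<longleftrightarrow> contracts L r (I_join A (rope_of A R a b))"
proof -
  let ?R' = "insert (a, b) R"
  have ab: "(a, b) \<in> A" using AR_subset[OF R(2)] by auto
  obtain N D where \<rho>: "rope_of A R a b = (a, b, N, D)" by (simp add: rope_of_def)
  then have N: "N = {w \<in> support A a b - {a, b}. (a, w) \<in> R}"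
    and D: "D = {w \<in> support A a b - {a, b}. (a, w) \<notin> R}" unfolding rope_of_def by auto
  have rope: "(a, b, N, D) \<in> ropes A" using rope_of_in_ropes[OF ab, of R] \<rho> by simp
  let ?J = "I_join A (a, b, N, D)"
  let ?K = "?J - {(a, b)}"
  have J: "?J \<in> AR" "?K \<in> AR" using I_join_AR[OF rope] I_join_lower_AR[OF rope] by auto
  have abJ: "(a, b) \<in> ?J" unfolding I_join_iff using ab by blast
  obtain h :: "'v \<Rightarrow> nat" where "inj h" and h: "\<And>x y. (x, y) \<in> A \<Longrightarrow> (x, y) \<in> R \<longleftrightarrow> h y < h x"
    by (rule AR_numbering[OF R(1)], rule that)
  obtain h' :: "'v \<Rightarrow> nat" where "inj h'" and h': "\<And>x y. (x, y) \<in> A \<Longrightarrow> (x, y) \<in> ?R' \<longleftrightarrow> h' y < h' x"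
    by (rule AR_numbering[OF R(2)], rule that)
  have hab: "h a \<le> h b" "h' b < h' a" using h[OF ab] h'[OF ab] R(3) by auto
  have "?J \<subseteq> ?R'"
  proof (rule subrelI)
    fix w w' assume ww: "(w, w') \<in> ?J"
    have a: "(w, w') \<in> A" "w = a \<or> w \<in> D" "w' = b \<or> w' \<in> N" using ww unfolding I_join_iff by auto
    have "h' a \<le> h' w"
    proof (cases "w = a")
      case False
      then have "(a, w) \<in> A" "(a, w) \<notin> ?R'" using a unfolding D support_def by auto
      then show ?thesis using h' by force
    qed simp
    moreover have "h' w' \<le> h' b"
    proof (cases "w' = b")
      case False
      then have w': "(a, w') \<in> A" "(w', b) \<in> A" "(a, w') \<in> R" "w' \<noteq> a" using a unfolding N support_def by auto
      then have "(w', b) \<notin> R" using h[OF w'(1)] h[OF w'(2)] hab by auto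
      then show ?thesis using h'[OF w'(2)] w'(4) by auto
    qed simp
    ultimately show "(w, w') \<in> ?R'" using h'[OF a(1)] hab by auto
  qed
  then have sub: "?J \<subseteq> ?R'" "?K \<subseteq> R" by auto
  have "R \<squnion>\<^bsub>L\<^esub> ?J = ?R'" by (rule join_eqI) (use R J sub abJ in auto)
  moreover have "R \<squnion>\<^bsub>L\<^esub> ?K = R" by (rule join_eqI) (use R J sub in auto)
  moreover have "?K \<squnion>\<^bsub>L\<^esub> R = R" by (rule join_eqI) (use R J sub in auto)
  moreover have "?J \<squnion>\<^bsub>L\<^esub> R = ?R'" by (rule join_eqI) (use R J sub abJ in auto)
  moreover have "R \<sqinter>\<^bsub>L\<^esub> ?J = ?K" by (rule meet_eqI) (use R J sub in auto)
  moreover have "?R' \<sqinter>\<^bsub>L\<^esub> ?J = ?J" by (rule meet_eqI) (use R J sub in auto)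
  ultimately have "(R, ?R') \<in> r \<longleftrightarrow> (?K, ?J) \<in> r"
    using cong_join[of ?K ?J R] cong_meet[of R ?R' ?J] R J by auto
  then show ?thesis unfolding \<rho> contracts_I_join_iff[OF rope] .
qed

text \<open>A hexagonal interval with bottom \<open>B\<close> and sides \<open>B + e\<^sub>1, B + e\<^sub>1 + e\<^sub>3\<close> and \<open>B + e\<^sub>2, B + e\<^sub>2 + e\<^sub>3\<close>.\<close>

lemma hexagon:
  assumes AR: "B \<in> AR" "insert e1 B \<in> AR" "insert e2 B \<in> AR" "insert e3 (insert e1 B) \<in> AR"
      "insert e3 (insert e2 B) \<in> AR" "insert e3 (insert e2 (insert e1 B)) \<in> AR"
    and closed: "\<And>Z. Z \<in> AR \<Longrightarrow> e1 \<in> Z \<Longrightarrow> e2 \<in> Z \<Longrightarrow> e3 \<in> Z"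
    and coclosed: "\<And>Z. Z \<in> AR \<Longrightarrow> e3 \<in> Z \<Longrightarrow> e1 \<in> Z \<or> e2 \<in> Z"
    and notin: "e1 \<notin> B" "e2 \<notin> B" "e3 \<notin> B" "e1 \<noteq> e2" "e1 \<noteq> e3" "e2 \<noteq> e3"
  shows "(B, insert e1 B) \<in> r \<Longrightarrow> (insert e2 B, insert e3 (insert e2 B)) \<in> r"
    and "(insert e3 (insert e2 B), insert e3 (insert e2 (insert e1 B))) \<in> r \<Longrightarrow>
      (insert e1 B, insert e3 (insert e1 B)) \<in> r"
proof -
  let ?T = "insert e3 (insert e2 (insert e1 B))"
  \<comment> \<open>Joining with \<open>insert e2 B\<close> spreads a bottom edge over the opposite
    side up to the top, and classes are convex. The second claim is dual.\<close>
  assume "(B, insert e1 B) \<in> r"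
  from cong_join[OF this AR(3)]
  have "(B \<squnion>\<^bsub>L\<^esub> insert e2 B, insert e1 B \<squnion>\<^bsub>L\<^esub> insert e2 B) \<in> r" .
  moreover have "B \<squnion>\<^bsub>L\<^esub> insert e2 B = insert e2 B" by (rule join_eqI) (use AR in auto)
  moreover have "insert e1 B \<squnion>\<^bsub>L\<^esub> insert e2 B = ?T"
    by (rule join_eqI) (use AR closed in auto)
  ultimately have "(insert e2 B, ?T) \<in> r" by simp
  then show "(insert e2 B, insert e3 (insert e2 B)) \<in> r"
    by (rule cong_interval) (use AR in auto)
next
  let ?T = "insert e3 (insert e2 (insert e1 B))"
  assume "(insert e3 (insert e2 B), ?T) \<in> r"
  from cong_meet[OF this AR(4)]
  have "(insert e3 (insert e2 B) \<sqinter>\<^bsub>L\<^esub> insert e3 (insert e1 B), ?T \<sqinter>\<^bsub>L\<^esub> insert e3 (insert e1 B)) \<in> r" .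
  moreover have "insert e3 (insert e2 B) \<sqinter>\<^bsub>L\<^esub> insert e3 (insert e1 B) = B"
  proof (rule meet_eqI[OF AR(5,4,1)])
    fix Y assume Y: "Y \<in> AR" "Y \<subseteq> insert e3 (insert e2 B)" "Y \<subseteq> insert e3 (insert e1 B)"
    then have "e1 \<notin> Y" "e2 \<notin> Y" using notin by auto
    then have "e3 \<notin> Y" using coclosed[OF Y(1)] by blast
    then show "Y \<subseteq> B" using Y \<open>e1 \<notin> Y\<close> by auto
  qed auto
  moreover have "?T \<sqinter>\<^bsub>L\<^esub> insert e3 (insert e1 B) = insert e3 (insert e1 B)"
    by (rule meet_eqI) (use AR in auto)
  ultimately have *: "(B, insert e3 (insert e1 B)) \<in> r" by simp
  then have "(B, insert e1 B) \<in> r" by (rule cong_interval) (use AR in auto)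
  then show "(insert e1 B, insert e3 (insert e1 B)) \<in> r" using * cong_sym cong_trans by blast
qed

text \<open>The rope labels the middle edge of one side of the hexagon, and the two subropes label
  the bottom and the top edge of the other side. Whether \<open>m\<close> is in \<open>N\<close> or
  in \<open>D\<close> decides which side is which.\<close>

lemma middle_forcing:
  assumes \<rho>: "(u, v, N, D) \<in> ropes A" and m: "m \<in> N \<union> D"
    and c: "contracts L r (I_join A (subrope A (u, v, N, D) u m)) \<or>
            contracts L r (I_join A (subrope A (u, v, N, D) m v))"
  shows "contracts L r (I_join A (u, v, N, D))"
proof -
  have uv: "(u, v) \<in> A" and dis: "N \<inter> D = {}" and un: "N \<union> D = support A u v - {u, v}"
    using \<rho> unfolding ropes_iff by auto
  let ?S = "support A u v"
  have mS: "m \<in> ?S" "m \<noteq> u" "m \<noteq> v" and um: "(u, m) \<in> A" and mv: "(m, v) \<in> A"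
    using m un unfolding support_def by auto
  have uS: "u \<in> ?S" "v \<in> ?S" unfolding support_def by auto
  have ne: "u \<noteq> v" using uv arc_irrefl by auto
  have sub: "support A u m \<subseteq> ?S" "support A m v \<subseteq> ?S"
    using support_subset[OF uv] um mv mS uS by blast+
  \<comment> \<open>The hexagon of the orders of \<open>u, m, v\<close>, with the rest of \<open>N\<close> below and the rest of \<open>D\<close> above.\<close>
  define ord :: "'v \<Rightarrow> 'v \<Rightarrow> 'v \<Rightarrow> 'v \<Rightarrow> nat" where
    "ord p q s w = (if w = p then 1 else if w = q then 2 else if w = s then 3 else if w \<in> N then 0 else 4)"
    for p q s w
  define G where "G p q s = level_set u v (ord p q s)" for p q s
  have GAR: "G p q s \<in> AR" for p q s unfolding G_def by (rule level_set_AR[OF uv])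
  have G_iff: "(w, w') \<in> G p q s \<longleftrightarrow> (w, w') \<in> A \<and> w \<in> ?S \<and> w' \<in> ?S \<and> ord p q s w' < ord p q s w"
    for w w' p q s unfolding G_def level_set_def by auto
  have swap1: "G q p s = insert (p, q) (G p q s)"
    if "(p, q) \<in> A" "p \<in> ?S" "q \<in> ?S" "p \<noteq> s" "q \<noteq> s" for p q s
  proof -
    have "(w, w') \<in> G q p s \<longleftrightarrow> (w, w') = (p, q) \<or> (w, w') \<in> G p q s" for w w'
      unfolding G_iff using that arc_irrefl[of p] arc_asym[OF that(1)] by (auto simp: ord_def)
    then show ?thesis by auto
  qed
  have swap2: "G s p q = insert (q, p) (G s q p)"
    if "(q, p) \<in> A" "p \<in> ?S" "q \<in> ?S" "p \<noteq> s" "q \<noteq> s" for p q s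
  proof -
    have "(w, w') \<in> G s p q \<longleftrightarrow> (w, w') = (q, p) \<or> (w, w') \<in> G s q p" for w w'
      unfolding G_iff using that arc_irrefl[of p] arc_asym[OF that(1)] by (auto simp: ord_def)
    then show ?thesis by auto
  qed
  let ?B = "G u m v" and ?e1 = "(u, m)" and ?e2 = "(m, v)" and ?e3 = "(u, v)"
  have G: "G m u v = insert ?e1 ?B" "G u v m = insert ?e2 ?B"
    "G m v u = insert ?e3 (insert ?e1 ?B)" "G v u m = insert ?e3 (insert ?e2 ?B)"
    "G v m u = insert ?e3 (insert ?e2 (insert ?e1 ?B))"
    using swap1[of u m v] swap2[of m v u] swap2[of u v m] swap1[of u v m] swap1[of m v u]
      um mv uv mS uS ne by auto
  have AR: "?B \<in> AR" "insert ?e1 ?B \<in> AR" "insert ?e2 ?B \<in> AR" "insert ?e3 (insert ?e1 ?B) \<in> AR"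
      "insert ?e3 (insert ?e2 ?B) \<in> AR" "insert ?e3 (insert ?e2 (insert ?e1 ?B)) \<in> AR"
    using GAR[of m u v] GAR[of u v m] GAR[of m v u] GAR[of v u m] GAR[of v m u] GAR[of u m v]
    unfolding G by auto
  have closed: "?e3 \<in> Z" if "Z \<in> AR" "?e1 \<in> Z" "?e2 \<in> Z" for Z using AR_closed[OF that uv] .
  have coclosed: "?e1 \<in> Z \<or> ?e2 \<in> Z" if "Z \<in> AR" "?e3 \<in> Z" for Z using AR_coclosed[OF that um mv] .
  have notin: "?e1 \<notin> ?B" "?e2 \<notin> ?B" "?e3 \<notin> ?B" "?e1 \<noteq> ?e2" "?e1 \<noteq> ?e3" "?e2 \<noteq> ?e3"
    unfolding G_iff using mS ne by (auto simp: ord_def)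
  have T': "insert ?e3 (insert ?e1 (insert ?e2 ?B)) = insert ?e3 (insert ?e2 (insert ?e1 ?B))" by auto
  have coclosed': "?e2 \<in> Z \<or> ?e1 \<in> Z" if "Z \<in> AR" "?e3 \<in> Z" for Z using coclosed[OF that] by blast
  note hex = hexagon[OF AR closed coclosed notin]
  \<comment> \<open>The same hexagon with its two sides exchanged.\<close>
  note hex' = hexagon[OF AR(1) AR(3) AR(2) AR(5) AR(4) _ closed coclosed' notin(2,1,3) notin(4)[symmetric] notin(6,5), unfolded T', OF AR(6)]
  have rope_G: "rope_of A (G p q s) x y = (x, y, {w \<in> support A x y - {x, y}. ord p q s w < ord p q s x},
      {w \<in> support A x y - {x, y}. \<not> ord p q s w < ord p q s x})"
    if "support A x y \<subseteq> ?S" for p q s x y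
    using that unfolding rope_of_def G_iff by (auto simp: support_def)
  have strict: "v \<notin> support A u m" "u \<notin> support A m v" "w \<in> N \<union> D" if "w \<in> support A u m - {u, m} \<or> w \<in> support A m v - {m, v}" for w
  proof -
    show 1: "v \<notin> support A u m" using ne mS mv arc_asym unfolding support_def by auto
    show 2: "u \<notin> support A m v" using ne mS um arc_asym unfolding support_def by auto
    show "w \<in> N \<union> D" using that sub un 1 2 by auto
  qed
  show ?thesis
  proof (cases "m \<in> N")
    case True
    then have mD: "m \<notin> D" using dis by auto
    have r1: "rope_of A (G m u v) u v = (u, v, N, D)"
      unfolding rope_G[OF subset_refl] using un dis True mD ne mS by (auto simp: ord_def)
    have r2: "rope_of A (G v u m) u m = subrope A (u, v, N, D) u m"
      unfolding rope_G[OF sub(1)] subrope_def using strict dis True mD ne mS by (auto simp: ord_def)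
    have r3: "rope_of A ?B m v = subrope A (u, v, N, D) m v"
      unfolding rope_G[OF sub(2)] subrope_def using strict dis True mD ne mS by (auto simp: ord_def)
    have goal: "(insert ?e1 ?B, insert ?e3 (insert ?e1 ?B)) \<in> r \<longleftrightarrow> contracts L r (I_join A (u, v, N, D))"
      using cover_contracted_iff[of "insert ?e1 ?B" u v] AR notin r1 unfolding G by auto
    from c show ?thesis
    proof
      assume "contracts L r (I_join A (subrope A (u, v, N, D) u m))"
      then have "(insert ?e3 (insert ?e2 ?B), insert ?e3 (insert ?e2 (insert ?e1 ?B))) \<in> r"
        using cover_contracted_iff[of "insert ?e3 (insert ?e2 ?B)" u m] AR notin r2
        unfolding G by (simp add: insert_commute)
      then show ?thesis using hex(2) goal by blast
    next
      assume "contracts L r (I_join A (subrope A (u, v, N, D) m v))"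
      then have "(?B, insert ?e2 ?B) \<in> r"
        using cover_contracted_iff[of ?B m v] AR notin r3 by simp
      then show ?thesis using hex'(1) goal by blast
    qed
  next
    case False
    then have mD: "m \<in> D" using m by auto
    have r1: "rope_of A (G u v m) u v = (u, v, N, D)"
      unfolding rope_G[OF subset_refl] using un dis False mD ne mS by (auto simp: ord_def)
    have r2: "rope_of A ?B u m = subrope A (u, v, N, D) u m"
      unfolding rope_G[OF sub(1)] subrope_def using strict dis False mD ne mS by (auto simp: ord_def)
    have r3: "rope_of A (G m v u) m v = subrope A (u, v, N, D) m v"
      unfolding rope_G[OF sub(2)] subrope_def using strict dis False mD ne mS by (auto simp: ord_def)
    have goal: "(insert ?e2 ?B, insert ?e3 (insert ?e2 ?B)) \<in> r \<longleftrightarrow> contracts L r (I_join A (u, v, N, D))"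
      using cover_contracted_iff[of "insert ?e2 ?B" u v] AR notin r1 unfolding G by auto
    from c show ?thesis
    proof
      assume "contracts L r (I_join A (subrope A (u, v, N, D) u m))"
      then have "(?B, insert ?e1 ?B) \<in> r"
        using cover_contracted_iff[of ?B u m] AR notin r2 by simp
      then show ?thesis using hex(1) goal by blast
    next
      assume "contracts L r (I_join A (subrope A (u, v, N, D) m v))"
      then have "(insert ?e3 (insert ?e1 ?B), insert ?e3 (insert ?e2 (insert ?e1 ?B))) \<in> r"
        using cover_contracted_iff[of "insert ?e3 (insert ?e1 ?B)" m v] AR notin r3
        unfolding G by (simp add: insert_commute)
      then show ?thesis using hex'(2) goal by blast
    qed
  qed
qed

lemma subrope_in_ropes:
  assumes \<rho>: "(u, v, N, D) \<in> ropes A" and ab: "a \<in> support A u v" "b \<in> support A u v" "(a, b) \<in> A"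
  shows "subrope A (u, v, N, D) a b \<in> ropes A"
proof -
  have uv: "(u, v) \<in> A" and dis: "N \<inter> D = {}" and un: "N \<union> D = support A u v - {u, v}"
    using \<rho> unfolding ropes_iff by auto
  have "support A a b \<subseteq> support A u v" using support_subset[OF uv ab] .
  moreover have "u \<notin> support A a b - {a, b}" "v \<notin> support A a b - {a, b}"
    using ab uv arc_asym arc_irrefl unfolding support_def by blast+
  ultimately have "support A a b - {a, b} \<subseteq> N \<union> D" using un by blast
  then show ?thesis using ab dis unfolding subrope_def prod.case ropes_iff by blast
qed

text \<open>Two applications of \<open>middle_forcing\<close>: the arc \<open>(a, b)\<close> is
  extended to \<open>(u, b)\<close> with middle vertex \<open>a\<close>, then to
  \<open>(u, v)\<close> with middle vertex \<open>b\<close>. Restricting the labels in two stages or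
  in one gives the same subrope.\<close>

lemma subrope_forcing:
  assumes \<rho>: "(u, v, N, D) \<in> ropes A" and ab: "a \<in> support A u v" "b \<in> support A u v" "(a, b) \<in> A"
    and c: "contracts L r (I_join A (subrope A (u, v, N, D) a b))"
  shows "contracts L r (I_join A (u, v, N, D))"
proof -
  have uv: "(u, v) \<in> A" and un: "N \<union> D = support A u v - {u, v}"
    using \<rho> unfolding ropes_iff by auto
  have uS: "u \<in> support A u v" "v \<in> support A u v" unfolding support_def by auto
  have bu: "b \<noteq> u" using ab uv arc_asym arc_irrefl unfolding support_def by blast
  have ub: "(u, b) \<in> A" using ab bu uv unfolding support_def by auto
  obtain N' D' where sr: "subrope A (u, v, N, D) u b = (u, b, N', D')"
    and N': "N' = N \<inter> (support A u b - {u, b})" and D': "D' = D \<inter> (support A u b - {u, b})"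
    unfolding subrope_def by auto
  have \<rho>': "(u, b, N', D') \<in> ropes A" using subrope_in_ropes[OF \<rho> uS(1) ab(2) ub] sr by simp
  have "a \<noteq> v" using ab uv arc_asym arc_irrefl unfolding support_def by blast
  then have aS: "a \<in> support A u b" using ab unfolding support_def by auto
  have bS: "b \<in> support A u b" unfolding support_def by simp
  have "support A a b \<subseteq> support A u b" using support_subset[OF ub aS bS ab(3)] .
  moreover have "u \<notin> support A a b - {a, b}"
    using ab uv arc_asym arc_irrefl unfolding support_def by blast
  ultimately have eq: "subrope A (u, b, N', D') a b = subrope A (u, v, N, D) a b"
    unfolding subrope_def N' D' by auto
  have "contracts L r (I_join A (u, b, N', D'))"
  proof (cases "a = u")
    case True
    then show ?thesis using c sr by simp
  next
    case False
    have "a \<noteq> b" using ab(3) arc_irrefl by auto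
    then have "a \<in> N' \<union> D'" using aS False \<rho>' unfolding ropes_iff by auto
    then show ?thesis using middle_forcing[OF \<rho>'] c eq by auto
  qed
  then have c': "contracts L r (I_join A (subrope A (u, v, N, D) u b))" using sr by simp
  show ?thesis
  proof (cases "b = v")
    case True
    have "subrope A (u, v, N, D) u v = (u, v, N, D)" unfolding subrope_def using un by auto
    then show ?thesis using c' True by simp
  next
    case False
    then have "b \<in> N \<union> D" using ab(2) bu un by auto
    then show ?thesis using middle_forcing[OF \<rho>] c' by auto
  qed
qed

end

subsection \<open>Optimal walks of ropes\<close>

lemma set_splice: "set (splice xs ys) = set xs \<union> set ys"
  by (induction xs ys rule: splice.induct) auto

lemma distinct_spliceD: "distinct (splice xs ys) \<Longrightarrow> distinct xs \<and> distinct ys"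
  by (induction xs ys rule: splice.induct) (auto simp: set_splice)

lemma distinct_subseq: "subseq xs ys \<Longrightarrow> distinct ys \<Longrightarrow> distinct xs"
  by (auto simp: subseq_conv_nths)

definition rope_walk :: "'v rel \<Rightarrow> 'v rope \<Rightarrow> nat set \<Rightarrow> bool" where
  "rope_walk A = (\<lambda>(u, v, N, D). walk (length (reduced_path A u v))
     (\<lambda>i. reduced_path A u v ! i \<in> {u} \<union> N) (\<lambda>i. reduced_path A u v ! i \<in> D \<union> {v}))"

definition rope_stable :: "'v rel \<Rightarrow> 'v rel \<Rightarrow> 'v rope \<Rightarrow> nat set \<Rightarrow> bool" where
  "rope_stable A R = (\<lambda>(u, v, N, D). stable (length (reduced_path A u v))
     (\<lambda>i. reduced_path A u v ! i \<in> {u} \<union> N) (\<lambda>i. reduced_path A u v ! i \<in> D \<union> {v})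
     (\<lambda>i j. (reduced_path A u v ! i, reduced_path A u v ! j) \<in> R))"

definition walk_vec :: "('v::finite) rel \<Rightarrow> 'v rope \<Rightarrow> nat set \<Rightarrow> real ^ 'v" where
  "walk_vec A = (\<lambda>(u, v, N, D). walk_sum (\<lambda>i. axis (reduced_path A u v ! i) 1))"

lemma rope_stable_imp_walk: "rope_stable A R \<rho> S \<Longrightarrow> rope_walk A \<rho> S"
  by (cases \<rho>) (auto simp: rope_stable_def rope_walk_def stable_def)

lemma inner_walk_vec:
  "c \<bullet> walk_vec A (u, v, N, D) S = walk_sum (\<lambda>i. c $ (reduced_path A u v ! i)) S"
  unfolding walk_vec_def walk_sum_def by (simp add: inner_sum_right inner_diff_right inner_axis)

lemma finite_rope_walks: "finite {S. rope_walk A \<rho> S}"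
  by (cases \<rho>) (simp add: rope_walk_def finite_walks)

text \<open>No functional occurs here, so the choice is unambiguous also where a functional has
  several maximizers.\<close>

definition optimal_walk :: "'v rel \<Rightarrow> 'v rel \<Rightarrow> 'v rope \<Rightarrow> nat set" where
  "optimal_walk A R \<rho> = (THE S. rope_stable A R \<rho> S)"

context skeletal_dag begin

lemma shard_polytope_eq:
  assumes \<rho>: "\<rho> \<in> ropes A"
  shows "shard_polytope A \<rho> = convex hull (walk_vec A \<rho> ` {S. rope_walk A \<rho> S})"
proof -
  obtain u v N D where r: "\<rho> = (u, v, N, D)" by (cases \<rho>)
  have uv: "(u, v) \<in> A" using \<rho> unfolding r ropes_iff by simp
  let ?ws = "reduced_path A u v"
  let ?n = "length ?ws"
  let ?y = "\<lambda>w. axis w 1 :: real ^ 'v"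
  note dws = reduced_path(3)[OF uv]
  \<comment> \<open>The reduced path has no repetitions, so list sums over matched vertices are sums
    over sets.\<close>
  have sums: "(\<Sum>a\<leftarrow>as. ?y a) - (\<Sum>a\<leftarrow>bs. ?y a) = (\<Sum>w\<in>set as. ?y w) - (\<Sum>w\<in>set bs. ?y w)"
    if "subseq (splice as bs) ?ws" for as bs
  proof -
    have "distinct as" "distinct bs" using distinct_spliceD distinct_subseq[OF that dws] by auto
    then show ?thesis by (simp add: sum_list_distinct_conv_sum_set)
  qed
  have "{(\<Sum>w\<in>MN. ?y w) - (\<Sum>w\<in>MD. ?y w) | MN MD. alternating_matching A \<rho> MN MD} =
    walk_vec A \<rho> ` {S. rope_walk A \<rho> S}" (is "?L = ?R")
  proof (intro equalityI subsetI)
    fix x assume "x \<in> ?L"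
    then obtain MN MD where x: "x = (\<Sum>w\<in>MN. ?y w) - (\<Sum>w\<in>MD. ?y w)"
      and "alternating_matching A \<rho> MN MD" by blast
    then obtain as bs where ab: "length as = length bs" "set as = MN" "set bs = MD"
      "subseq (splice as bs) ?ws" "MN \<subseteq> {u} \<union> N" "MD \<subseteq> D \<union> {v}"
      unfolding r alternating_matching_def by auto
    obtain \<sigma> where \<sigma>: "\<sigma> 0 = False" "\<not> \<sigma> ?n"
      "\<forall>i<?n. (\<sigma> i \<and> \<not> \<sigma> (Suc i) \<longrightarrow> ?ws ! i \<in> D \<union> {v}) \<and> (\<not> \<sigma> i \<and> \<sigma> (Suc i) \<longrightarrow> ?ws ! i \<in> {u} \<union> N)"
      "(\<Sum>i<?n. (of_bool (\<sigma> (Suc i)) - of_bool (\<sigma> i)) *\<^sub>R ?y (?ws ! i)) =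
        (\<Sum>a\<leftarrow>as. ?y a) - (\<Sum>a\<leftarrow>bs. ?y a)"
      using matching_imp_states[of bs False as ?ws "{u} \<union> N" "D \<union> {v}" ?y] ab by auto
    let ?S = "{i \<in> {0<..<?n}. \<sigma> i}"
    have mem: "i \<in> ?S \<longleftrightarrow> \<sigma> i" if "i \<le> ?n" for i
    proof (cases "i = 0 \<or> i = ?n")
      case True
      then show ?thesis using \<sigma>(1,2) by auto
    next
      case False
      then show ?thesis using that by auto
    qed
    have "rope_walk A \<rho> ?S"
      unfolding r rope_walk_def prod.case walk_def
    proof (intro conjI allI)
      fix i
      show "i < ?n \<longrightarrow> (i \<in> ?S \<and> Suc i \<notin> ?S \<longrightarrow> ?ws ! i \<in> D \<union> {v}) \<and> (i \<notin> ?S \<and> Suc i \<in> ?S \<longrightarrow> ?ws ! i \<in> {u} \<union> N)"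
      proof
        assume i: "i < ?n"
        then have "i \<in> ?S \<longleftrightarrow> \<sigma> i" "Suc i \<in> ?S \<longleftrightarrow> \<sigma> (Suc i)" by (intro mem; simp)+
        then show "(i \<in> ?S \<and> Suc i \<notin> ?S \<longrightarrow> ?ws ! i \<in> D \<union> {v}) \<and> (i \<notin> ?S \<and> Suc i \<in> ?S \<longrightarrow> ?ws ! i \<in> {u} \<union> N)"
          using \<sigma>(3) i by presburger
      qed
    qed auto
    moreover have "x = walk_vec A \<rho> ?S"
      using states_sum[of \<sigma> ?n "\<lambda>i. ?y (?ws ! i)"] \<sigma> sums[OF ab(4)] x ab
      by (simp add: r walk_vec_def)
    ultimately show "x \<in> ?R" by blast
  next
    fix x assume "x \<in> ?R"
    then obtain S where S: "rope_walk A \<rho> S" "x = walk_vec A \<rho> S" by blast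
    have w: "walk ?n (\<lambda>i. ?ws ! i \<in> {u} \<union> N) (\<lambda>i. ?ws ! i \<in> D \<union> {v}) S"
      using S(1) unfolding r rope_walk_def by simp
    then have "S \<subseteq> {0<..<?n}" unfolding walk_def by simp
    then have S0: "0 \<notin> S" "?n \<notin> S" "S = {i \<in> {0<..<?n}. i \<in> S}" by auto
    obtain as bs where ab: "length bs + of_bool (\<not> 0 \<in> S) = length as + 1"
      "subseq (if 0 \<in> S then splice bs as else splice as bs) ?ws" "set as \<subseteq> {u} \<union> N" "set bs \<subseteq> D \<union> {v}"
      "(\<Sum>i<?n. (of_bool (Suc i \<in> S) - of_bool (i \<in> S)) *\<^sub>R ?y (?ws ! i)) =
        (\<Sum>a\<leftarrow>as. ?y a) - (\<Sum>a\<leftarrow>bs. ?y a)"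
      using states_imp_matching[of "\<lambda>i. i \<in> S" ?ws "D \<union> {v}" "{u} \<union> N" ?y] S0(2) w
      unfolding walk_def by blast
    have ab': "length as = length bs" "subseq (splice as bs) ?ws" using ab(1,2) S0 by auto
    have "x = (\<Sum>w\<in>set as. ?y w) - (\<Sum>w\<in>set bs. ?y w)"
      using states_sum[of "\<lambda>i. i \<in> S" ?n "\<lambda>i. ?y (?ws ! i)"] S0 ab(5) sums[OF ab'(2)] S(2)
      by (simp add: r walk_vec_def)
    moreover have "alternating_matching A \<rho> (set as) (set bs)"
      unfolding r alternating_matching_def using ab ab' by auto
    ultimately show "x \<in> ?L" by blast
  qed
  then show ?thesis unfolding shard_polytope_def by simp
qed

lemma reduced_path_arc:
  assumes "(u, v) \<in> A" "i < j" "j < length (reduced_path A u v)"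
  shows "(reduced_path A u v ! i, reduced_path A u v ! j) \<in> A"
  using sorted_wrt_nth_less[OF reduced_path(1)[OF assms(1)] assms(2,3)] .

lemma rope_stable_unique_exists:
  assumes \<rho>: "\<rho> \<in> ropes A" and R: "R \<in> AR"
  shows "\<exists>!S. rope_stable A R \<rho> S"
proof -
  obtain u v N D where r: "\<rho> = (u, v, N, D)" by (cases \<rho>)
  have uv: "(u, v) \<in> A" using \<rho> unfolding r ropes_iff by simp
  obtain h :: "'v \<Rightarrow> nat" where ih: "inj h" and h: "\<And>x y. (x, y) \<in> A \<Longrightarrow> (x, y) \<in> R \<longleftrightarrow> h y < h x"
    by (rule AR_numbering[OF R], rule that)
  have lt: "(x, y) \<notin> R \<longleftrightarrow> h x < h y" if "(x, y) \<in> A" for x y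
    using h[OF that] ih that arc_irrefl[of x] by (metis injD less_asym linorder_neqE_nat)
  show ?thesis unfolding r rope_stable_def prod.case
  proof (rule stable_unique_exists[where y = "\<lambda>i. real (h (reduced_path A u v ! i))"])
    fix i j assume "i < j" "j < length (reduced_path A u v)"
    from reduced_path_arc[OF uv this]
    show "((reduced_path A u v ! i, reduced_path A u v ! j) \<in> R \<longrightarrow>
        real (h (reduced_path A u v ! j)) < real (h (reduced_path A u v ! i))) \<and>
      ((reduced_path A u v ! i, reduced_path A u v ! j) \<notin> R \<longrightarrow>
        real (h (reduced_path A u v ! i)) < real (h (reduced_path A u v ! j)))"
      using h lt by simp
  qed
qed

lemma optimal_walk_stable:
  assumes "\<rho> \<in> ropes A" "R \<in> AR"
  shows "rope_stable A R \<rho> (optimal_walk A R \<rho>)"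
  unfolding optimal_walk_def by (rule theI'[OF rope_stable_unique_exists[OF assms]])

lemma optimal_walk_eqI:
  assumes "\<rho> \<in> ropes A" "R \<in> AR" "rope_stable A R \<rho> S"
  shows "optimal_walk A R \<rho> = S"
  using rope_stable_unique_exists[OF assms(1,2)] optimal_walk_stable[OF assms(1,2)] assms(3) by blast

text \<open>On the closed cone the orientation yields only weak inequalities between coordinates,
  and these suffice for optimality of a stable walk.\<close>

lemma optimal_walk_max:
  assumes \<rho>: "\<rho> \<in> ropes A" and R: "R \<in> AR" and c: "c \<in> reorientation_cone A R" and S: "rope_walk A \<rho> S"
  shows "c \<bullet> walk_vec A \<rho> S \<le> c \<bullet> walk_vec A \<rho> (optimal_walk A R \<rho>)"
proof -
  obtain u v N D where r: "\<rho> = (u, v, N, D)" by (cases \<rho>)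
  have uv: "(u, v) \<in> A" using \<rho> unfolding r ropes_iff by simp
  have cR: "(x, y) \<in> R \<Longrightarrow> c $ y \<le> c $ x" "(x, y) \<in> A \<Longrightarrow> (x, y) \<notin> R \<Longrightarrow> c $ x \<le> c $ y" for x y
    using c unfolding reorientation_cone_def reorient_def by auto
  let ?ws = "reduced_path A u v"
  note st = optimal_walk_stable[OF \<rho> R, unfolded rope_stable_def r prod.case]
  show ?thesis unfolding r inner_walk_vec
  proof (rule stable_walk_sum[OF st, THEN conjunct1])
    fix i j assume "i < j" "j < length ?ws"
    from reduced_path_arc[OF uv this]
    show "((?ws ! i, ?ws ! j) \<in> R \<longrightarrow> c $ (?ws ! j) \<le> c $ (?ws ! i)) \<and>
      ((?ws ! i, ?ws ! j) \<notin> R \<longrightarrow> c $ (?ws ! i) \<le> c $ (?ws ! j))"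
      using cR by simp
  next
    show "walk (length ?ws) (\<lambda>i. ?ws ! i \<in> {u} \<union> N) (\<lambda>i. ?ws ! i \<in> D \<union> {v}) S"
      using S unfolding r rope_walk_def prod.case .
  qed
qed

text \<open>In \<open>R\<close> the vertices at which a walk may be entered lie weakly below
  \<open>a\<close>, and those at which it may be left lie weakly above, so the empty walk is stable.
  Once \<open>(a, b)\<close> is reversed, the walk along the whole path improves on it.\<close>

lemma optimal_walk_rope_of:
  assumes R: "R \<in> AR" "insert (a, b) R \<in> AR" "(a, b) \<notin> R"
  shows "optimal_walk A R (rope_of A R a b) \<noteq> optimal_walk A (insert (a, b) R) (rope_of A R a b)"
proof
  let ?\<rho> = "rope_of A R a b"
  assume eq: "optimal_walk A R ?\<rho> = optimal_walk A (insert (a, b) R) ?\<rho>"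
  have ab: "(a, b) \<in> A" using AR_subset[OF R(2)] by auto
  note \<rho> = rope_of_in_ropes[OF ab, of R]
  obtain N D where r: "?\<rho> = (a, b, N, D)" by (simp add: rope_of_def)
  then have N: "N = {w \<in> support A a b - {a, b}. (a, w) \<in> R}"
    and D: "D = {w \<in> support A a b - {a, b}. (a, w) \<notin> R}" unfolding rope_of_def by auto
  obtain h :: "'v \<Rightarrow> nat" where "inj h" and h: "\<And>x y. (x, y) \<in> A \<Longrightarrow> (x, y) \<in> R \<longleftrightarrow> h y < h x"
    by (rule AR_numbering[OF R(1)], rule that)
  let ?ws = "reduced_path A a b"
  let ?n = "length ?ws"
  have hab: "h a \<le> h b" using h[OF ab] R(3) by simp
  have up: "h w \<le> h a" if "w \<in> {a} \<union> N" for w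
  proof (cases "w = a")
    case False
    then have "(a, w) \<in> A" "(a, w) \<in> R" using that unfolding N support_def by auto
    then show ?thesis using h by fastforce
  qed simp
  have dn: "h a \<le> h w" if "w \<in> D \<union> {b}" for w
  proof (cases "w = b")
    case False
    then have "(a, w) \<in> A" "(a, w) \<notin> R" using that unfolding D support_def by auto
    then show ?thesis using h by fastforce
  qed (use hab in simp)
  have "rope_stable A R ?\<rho> {}"
    unfolding r rope_stable_def prod.case stable_def
  proof (intro conjI allI impI walk_empty)
    fix i j assume ij: "i < j \<and> j < ?n"
    assume "{i<..j} \<inter> {} = {} \<and> walk ?n (\<lambda>i. ?ws ! i \<in> {a} \<union> N) (\<lambda>i. ?ws ! i \<in> D \<union> {b}) ({} \<union> {i<..j})"
    then have "?ws ! i \<in> {a} \<union> N" "?ws ! j \<in> D \<union> {b}" using ij unfolding walk_def by auto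
    then have "h (?ws ! i) \<le> h (?ws ! j)" using up dn by (meson le_trans)
    then show "(?ws ! i, ?ws ! j) \<notin> R" using h reduced_path_arc[OF ab, of i j] ij by auto
  next
    fix i j assume ij: "i < j \<and> j < ?n"
    assume "{i<..j} \<subseteq> {} \<and> walk ?n (\<lambda>i. ?ws ! i \<in> {a} \<union> N) (\<lambda>i. ?ws ! i \<in> D \<union> {b}) ({} - {i<..j})"
    then have "j \<in> {}" using ij by (metis greaterThanAtMost_iff le_refl subsetD)
    then show "(?ws ! i, ?ws ! j) \<in> R" by simp
  qed
  then have "optimal_walk A R ?\<rho> = {}" by (rule optimal_walk_eqI[OF \<rho> R(1)])
  then have st: "rope_stable A (insert (a, b) R) ?\<rho> {}"
    using optimal_walk_stable[OF \<rho> R(2)] eq by simp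
  have ends: "?ws ! 0 = a" "?ws ! (?n - 1) = b" "?ws \<noteq> []"
    using reduced_path[OF ab] by (auto simp: hd_conv_nth last_conv_nth)
  have "a \<noteq> b" using ab arc_irrefl by auto
  then have n2: "0 < ?n - 1" using ends by (cases "?n - 1") auto
  \<comment> \<open>This walk matches only the end vertices: it is entered at index 0, which is
    \<open>a\<close>, and left at the last index, which is \<open>b\<close>.\<close>
  have "walk ?n (\<lambda>i. ?ws ! i \<in> {a} \<union> N) (\<lambda>i. ?ws ! i \<in> D \<union> {b}) ({} \<union> {0<..?n - 1})"
    unfolding walk_def
  proof (intro conjI allI impI)
    show "{} \<union> {0<..?n - 1} \<subseteq> {0<..<?n}" using n2 by auto
    fix t assume "t < ?n"
    show "?ws ! t \<in> D \<union> {b}" if "t \<in> {} \<union> {0<..?n - 1} \<and> Suc t \<notin> {} \<union> {0<..?n - 1}"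
    proof -
      have "t = ?n - 1" using that by auto
      then show ?thesis using ends by simp
    qed
    show "?ws ! t \<in> {a} \<union> N" if "t \<notin> {} \<union> {0<..?n - 1} \<and> Suc t \<in> {} \<union> {0<..?n - 1}"
    proof -
      have "t = 0" using that by auto
      then show ?thesis using ends by simp
    qed
  qed
  moreover have "0 < ?n - 1 \<and> ?n - 1 < ?n \<longrightarrow>
      {0<..?n - 1} \<inter> {} = {} \<and> walk ?n (\<lambda>i. ?ws ! i \<in> {a} \<union> N) (\<lambda>i. ?ws ! i \<in> D \<union> {b}) ({} \<union> {0<..?n - 1}) \<longrightarrow>
      (?ws ! 0, ?ws ! (?n - 1)) \<notin> insert (a, b) R"
    using st unfolding r rope_stable_def prod.case stable_def by blast
  ultimately show False using ends n2 by simp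
qed

text \<open>\<open>R'\<close> orders the vertices by \<open>c\<close> and resolves ties by
  \<open>R\<close>. It serves both to show that the cones cover the space and to treat functionals
  on walls.\<close>

lemma lex_AR:
  fixes c :: "real ^ 'v"
  assumes R: "R \<in> AR"
  defines "R' \<equiv> {(x, y) \<in> A. c $ y < c $ x \<or> (c $ x = c $ y \<and> (x, y) \<in> R)}"
  shows "R' \<in> AR" "c \<in> reorientation_cone A R'"
proof -
  show "R' \<in> AR"
  proof (rule AR_I)
    show "R' \<subseteq> A" unfolding R'_def by auto
    fix x y z assume a: "(x, y) \<in> R'" "(y, z) \<in> R'" "(x, z) \<in> A"
    then have "c $ z \<le> c $ y" "c $ y \<le> c $ x" unfolding R'_def by auto
    moreover have "(x, z) \<in> R" if "c $ z = c $ y" "c $ y = c $ x"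
      using a that AR_closed[OF R _ _ a(3)] unfolding R'_def by auto
    ultimately show "(x, z) \<in> R'" using a(3) unfolding R'_def by force
  next
    fix x y z assume a: "(x, z) \<in> R'" "(x, y) \<in> A" "(y, z) \<in> A"
    then have "c $ z \<le> c $ x" unfolding R'_def by auto
    moreover have "(x, y) \<in> R \<or> (y, z) \<in> R" if "c $ z = c $ x"
      using a that AR_coclosed[OF R _ a(2,3)] unfolding R'_def by auto
    ultimately show "(x, y) \<in> R' \<or> (y, z) \<in> R'" using a(2,3) unfolding R'_def by force
  qed
  show "c \<in> reorientation_cone A R'"
    unfolding reorientation_cone_def reorient_def R'_def by (auto simp: not_less)
qed

end

subsection \<open>The normal fan of the Minkowski sum\<close>

context skeletal_congruence begin

abbreviation "uncontracted \<equiv> uncontracted_ropes A r"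

lemma uncontractedD: "\<rho> \<in> uncontracted \<Longrightarrow> \<rho> \<in> ropes A \<and> \<not> contracts L r (I_join A \<rho>)"
  unfolding uncontracted_ropes_def by simp

text \<open>If the optimal walk changes across a cover, the rope of the cover is a subrope
  of \<open>\<rho>\<close>, and therefore uncontracted.\<close>

lemma optimal_walk_cover:
  assumes R: "R \<in> AR" "insert (a, b) R \<in> AR" "(R, insert (a, b) R) \<in> r" and \<rho>: "\<rho> \<in> uncontracted"
  shows "optimal_walk A (insert (a, b) R) \<rho> = optimal_walk A R \<rho>"
proof (cases "(a, b) \<in> R")
  case True
  then show ?thesis by (simp add: insert_absorb)
next
  case notin: False
  let ?R' = "insert (a, b) R"
  obtain u v N D where r: "\<rho> = (u, v, N, D)" by (cases \<rho>)
  have \<rho>R: "(u, v, N, D) \<in> ropes A" and nc: "\<not> contracts L r (I_join A (u, v, N, D))"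
    using uncontractedD[OF \<rho>] unfolding r by auto
  have uv: "(u, v) \<in> A" and dis: "N \<inter> D = {}" and un: "N \<union> D = support A u v - {u, v}"
    using \<rho>R unfolding ropes_iff by auto
  have ab: "(a, b) \<in> A" using AR_subset[OF R(2)] by auto
  let ?ws = "reduced_path A u v"
  let ?n = "length ?ws"
  define S where "S = optimal_walk A R \<rho>"
  have S: "rope_stable A R \<rho> S"
    unfolding S_def using optimal_walk_stable \<rho>R R(1) r by simp
  note S' = S[unfolded r rope_stable_def prod.case]
  have "rope_stable A ?R' \<rho> S"
  proof (rule ccontr)
    assume neg: "\<not> rope_stable A ?R' \<rho> S"
    note neg' = neg[unfolded r rope_stable_def prod.case]
    \<comment> \<open>If \<open>a\<close> and \<open>b\<close> were not both on the path in this
      order, the orders seen by the walk under \<open>R\<close> and \<open>?R'\<close> would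
      coincide.\<close>
    have "\<exists>i j. i < j \<and> j < ?n \<and> ?ws ! i = a \<and> ?ws ! j = b"
    proof (rule ccontr)
      assume "\<not> ?thesis"
      then have "((?ws ! i, ?ws ! j) \<in> ?R') = ((?ws ! i, ?ws ! j) \<in> R)" if "i < j" "j < ?n" for i j
        using that by auto
      then have "stable ?n (\<lambda>i. ?ws ! i \<in> {u} \<union> N) (\<lambda>i. ?ws ! i \<in> D \<union> {v}) (\<lambda>i j. (?ws ! i, ?ws ! j) \<in> ?R') S"
        by (intro stable_between[OF S' S'] disjI1)
      then show False using neg' by contradiction
    qed
    then obtain i j where ij: "i < j" "j < ?n" "?ws ! i = a" "?ws ! j = b" by blast
    have aS: "a \<in> support A u v" "b \<in> support A u v"
      using ij nth_mem[of i ?ws] nth_mem[of j ?ws] unfolding reduced_path(2)[OF uv] by auto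
    have T': "((?ws ! k, ?ws ! l) \<in> ?R') = ((?ws ! k, ?ws ! l) \<in> R)"
      if "k < l" "l < ?n" "(k, l) \<noteq> (i, j)" for k l
    proof -
      have "?ws ! k \<noteq> a \<or> ?ws ! l \<noteq> b"
        using nth_eq_iff_index_eq[OF reduced_path(3)[OF uv]] that ij by auto
      then show ?thesis by auto
    qed
    have "(?ws ! i, ?ws ! j) \<notin> R" "(?ws ! i, ?ws ! j) \<in> ?R'" using ij notin by auto
    note order = stable_flip_order[OF S' neg' ij(1,2) this T']
    \<comment> \<open>A vertex of \<open>N\<close> has its arc to \<open>b\<close> unreversed by
      \<open>order\<close>; coclosedness of \<open>?R'\<close> at the reversed \<open>(a, b)\<close>
      then forces the arc from \<open>a\<close> to be reversed. A vertex of \<open>D\<close> is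
      settled by \<open>order\<close> directly.\<close>
    have side: "(w \<in> N \<longrightarrow> (a, w) \<in> R) \<and> (w \<in> D \<longrightarrow> (a, w) \<notin> R) \<and> w \<in> N \<union> D"
      if w: "w \<in> support A a b - {a, b}" for w
    proof -
      have aw: "(a, w) \<in> A" "(w, b) \<in> A" "w \<noteq> a" "w \<noteq> b" using w unfolding support_def by auto
      have "w \<in> support A u v" using support_subset[OF uv aS ab] w by blast
      then obtain m where m: "m < ?n" "?ws ! m = w"
        using reduced_path(2)[OF uv] by (metis in_set_conv_nth)
      have "i < m"
      proof (rule ccontr)
        assume "\<not> i < m"
        then have "m < i \<or> m = i" by linarith
        then show False using reduced_path_arc[OF uv, of m i] m ij aw arc_asym by auto
      qed
      moreover have "m < j"
      proof (rule ccontr)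
        assume "\<not> m < j"
        then have "j < m \<or> m = j" by linarith
        then show False using reduced_path_arc[OF uv, of j m] m ij aw arc_asym by auto
      qed
      ultimately have imp: "w \<in> {u} \<union> N \<Longrightarrow> (w, b) \<notin> R" "w \<in> D \<union> {v} \<Longrightarrow> (a, w) \<notin> R"
        using order[of m] m ij by auto
      have "(a, w) \<in> ?R' \<or> (w, b) \<in> ?R'" by (rule AR_coclosed[OF R(2) _ aw(1,2)]) simp
      then have "(a, w) \<in> R \<or> (w, b) \<in> R" using aw by auto
      moreover have "w \<noteq> u" "w \<noteq> v"
        using aw aS uv arc_asym arc_irrefl unfolding support_def by blast+
      then have "w \<in> N \<union> D" using \<open>w \<in> support A u v\<close> un by auto
      ultimately show ?thesis using imp by blast
    qed
    have "{w \<in> support A a b - {a, b}. (a, w) \<in> R} = N \<inter> (support A a b - {a, b})"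
      "{w \<in> support A a b - {a, b}. (a, w) \<notin> R} = D \<inter> (support A a b - {a, b})"
      using side dis by blast+
    then have "rope_of A R a b = subrope A (u, v, N, D) a b"
      unfolding rope_of_def subrope_def by simp
    then have "contracts L r (I_join A (subrope A (u, v, N, D) a b))"
      using cover_contracted_iff[OF R(1,2) notin] R(3) by simp
    then show False using subrope_forcing[OF \<rho>R aS ab] nc by blast
  qed
  then show ?thesis unfolding S_def using optimal_walk_eqI \<rho>R R(2) r by blast
qed

text \<open>\<open>AR_exchange\<close> climbs from \<open>R\<close> to \<open>Z\<close> one arc at a
  time, and convexity of the class keeps all intermediate orientations congruent.\<close>

lemma optimal_walk_cong_le:
  assumes "(R, Z) \<in> r" "R \<subseteq> Z" "\<rho> \<in> uncontracted"
  shows "optimal_walk A R \<rho> = optimal_walk A Z \<rho>"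
  using assms(1,2)
proof (induction "card (Z - R)" arbitrary: R rule: less_induct)
  case less
  have AR: "R \<in> AR" "Z \<in> AR" using cong_AR less.prems by auto
  show ?case
  proof (cases "R = Z")
    case False
    then obtain a b where e: "(a, b) \<in> Z - R" "insert (a, b) R \<in> AR"
      using AR_exchange[OF AR False] less.prems(2) by auto
    have sub: "insert (a, b) R \<subseteq> Z" using e less.prems by auto
    have c: "(R, insert (a, b) R) \<in> r"
      by (rule cong_interval[OF less.prems(1) _ sub e(2)]) auto
    have "card (Z - insert (a, b) R) < card (Z - R)"
      by (rule psubset_card_mono) (use e in auto)
    moreover have "(insert (a, b) R, Z) \<in> r" using cong_trans[OF cong_sym[OF c] less.prems(1)] .
    ultimately have "optimal_walk A (insert (a, b) R) \<rho> = optimal_walk A Z \<rho>"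
      using less.hyps sub by blast
    then show ?thesis using optimal_walk_cover[OF AR(1) e(2) c assms(3)] by simp
  qed simp
qed

text \<open>Both orientations are congruent to their join, which reduces the claim to comparable
  pairs.\<close>

lemma optimal_walk_cong:
  assumes "(R, R') \<in> r" "\<rho> \<in> uncontracted"
  shows "optimal_walk A R \<rho> = optimal_walk A R' \<rho>"
proof -
  have AR: "R \<in> AR" "R' \<in> AR" using cong_AR assms(1) by auto
  let ?J = "R \<squnion>\<^bsub>L\<^esub> R'"
  have J: "R \<subseteq> ?J" "R' \<subseteq> ?J"
    using join_exists(2)[OF AR] AR_subset AR by auto
  have "R \<squnion>\<^bsub>L\<^esub> R = R" by (rule join_eqI) (use AR in simp_all)
  moreover have "R' \<squnion>\<^bsub>L\<^esub> R' = R'" by (rule join_eqI) (use AR in simp_all)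
  moreover have "R' \<squnion>\<^bsub>L\<^esub> R = ?J" using join_exists(2)[OF AR] join_exists(2)[OF AR(2,1)] by (simp add: Un_commute)
  ultimately have "(R, ?J) \<in> r" "(?J, R') \<in> r"
    using cong_join[OF assms(1) AR(1)] cong_join[OF assms(1) AR(2)] by auto
  then show ?thesis
    using optimal_walk_cong_le[OF _ J(1) assms(2)] optimal_walk_cong_le[OF cong_sym J(2) assms(2)] by simp
qed

text \<open>The orientations with prescribed optimal walks are cut out by conditions on single arcs, so they
  are connected by covers inside this set.\<close>

lemma cong_if_optimal_walk_eq:
  assumes "R \<in> AR" "R' \<in> AR" "\<And>\<rho>. \<rho> \<in> uncontracted \<Longrightarrow> optimal_walk A R \<rho> = optimal_walk A R' \<rho>"
  shows "(R, R') \<in> r"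
  using assms(1,3)
proof (induction "card ((R' - R) \<union> (R - R'))" arbitrary: R rule: less_induct)
  case less
  note R = less.prems(1) and R' = assms(2)
  show ?case
  proof (cases "R = R'")
    case True
    then show ?thesis using cong_refl[OF R] by simp
  next
    case False
    \<comment> \<open>\<open>R1\<close> is one exchange away from \<open>R\<close> and agrees at
      every arc with \<open>R\<close> or \<open>R'\<close>. The walks common to \<open>R\<close> and
      \<open>R'\<close> therefore stay stable for \<open>R1\<close>, and the induction continues
      from there.\<close>
    have step: "(R, R') \<in> r" if R1: "R1 \<in> AR" and between: "\<And>e. (e \<in> R1 \<longleftrightarrow> e \<in> R) \<or> (e \<in> R1 \<longleftrightarrow> e \<in> R')"
      and smaller: "(R' - R1) \<union> (R1 - R') \<subset> (R' - R) \<union> (R - R')"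
      and cover: "(\<And>\<rho>. \<rho> \<in> uncontracted \<Longrightarrow> optimal_walk A R \<rho> = optimal_walk A R1 \<rho>) \<Longrightarrow> (R, R1) \<in> r" for R1
    proof -
      have eq: "optimal_walk A R1 \<rho> = optimal_walk A R \<rho>" if "\<rho> \<in> uncontracted" for \<rho>
      proof -
        obtain u v N D where r: "\<rho> = (u, v, N, D)" by (cases \<rho>)
        have \<rho>: "\<rho> \<in> ropes A" using uncontractedD that by blast
        have "rope_stable A R \<rho> (optimal_walk A R \<rho>)" "rope_stable A R' \<rho> (optimal_walk A R \<rho>)"
          using optimal_walk_stable[OF \<rho> R] optimal_walk_stable[OF \<rho> R'] less.prems(2)[OF that] by auto
        then have "rope_stable A R1 \<rho> (optimal_walk A R \<rho>)"
          unfolding r rope_stable_def prod.case by (rule stable_between) (rule between)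
        then show ?thesis by (rule optimal_walk_eqI[OF \<rho> R1])
      qed
      have "(R, R1) \<in> r" using cover eq by simp
      moreover have "(R1, R') \<in> r"
        using psubset_card_mono[OF _ smaller] R1 eq less.prems(2) by (intro less.hyps) auto
      ultimately show ?thesis by (rule cong_trans)
    qed
    \<comment> \<open>If the cover were not contracted, its rope would be uncontracted, and the
      optimal walk of that very rope would change.\<close>
    have cover: "(Q, insert (a, b) Q) \<in> r"
      if Q: "Q \<in> AR" "insert (a, b) Q \<in> AR" "(a, b) \<notin> Q"
        and eq: "\<And>\<rho>. \<rho> \<in> uncontracted \<Longrightarrow> optimal_walk A Q \<rho> = optimal_walk A (insert (a, b) Q) \<rho>" for Q a b
    proof -
      have "rope_of A Q a b \<notin> uncontracted" using optimal_walk_rope_of[OF Q] eq by blast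
      moreover have "rope_of A Q a b \<in> ropes A" using rope_of_in_ropes AR_subset[OF Q(2)] by auto
      ultimately show ?thesis
        using cover_contracted_iff[OF Q] unfolding uncontracted_ropes_def by auto
    qed
    from AR_exchange[OF R R' False]
    consider a b where "(a, b) \<in> R' - R" "insert (a, b) R \<in> AR"
      | a b where "(a, b) \<in> R - R'" "R - {(a, b)} \<in> AR" by auto
    then show ?thesis
    proof cases
      case 1
      show ?thesis
        by (rule step[OF 1(2)]) (use 1 cover[OF R 1(2)] in auto)
    next
      case 2
      have ins: "insert (a, b) (R - {(a, b)}) = R" using 2(1) by auto
      have "(R - {(a, b)}, R) \<in> r"
        if "\<And>\<rho>. \<rho> \<in> uncontracted \<Longrightarrow> optimal_walk A R \<rho> = optimal_walk A (R - {(a, b)}) \<rho>"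
        using cover[of "R - {(a, b)}" a b] 2 R that unfolding ins by auto
      then show ?thesis
        by (intro step[OF 2(2)]) (use 2 in \<open>auto intro: cong_sym\<close>)
    qed
  qed
qed

end

locale weighted_congruence = skeletal_congruence A r
  for A :: "('v::finite) rel" and r +
  fixes s :: "'v rope \<Rightarrow> real"
  assumes weight_pos: "\<rho> \<in> uncontracted \<Longrightarrow> 0 < s \<rho>"
begin

section \<open>The Minkowski sum and its normal cones\<close>

definition summand_vertices :: "'v rope \<Rightarrow> (real ^ 'v) set" where
  "summand_vertices \<rho> = (\<lambda>S. s \<rho> *\<^sub>R walk_vec A \<rho> S) ` {S. rope_walk A \<rho> S}"

definition shard_sum_points :: "(real ^ 'v) set" where
  "shard_sum_points = (\<Sum>\<rho>\<in>uncontracted. summand_vertices \<rho>)"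

definition shard_sum :: "(real ^ 'v) set" where
  "shard_sum = (\<Sum>\<rho>\<in>uncontracted. (\<lambda>x. s \<rho> *\<^sub>R x) ` shard_polytope A \<rho>)"

definition vertex :: "'v rel \<Rightarrow> real ^ 'v" where
  "vertex R = (\<Sum>\<rho>\<in>uncontracted. s \<rho> *\<^sub>R walk_vec A \<rho> (optimal_walk A R \<rho>))"

lemma shard_sum_points_iff: "q \<in> shard_sum_points \<longleftrightarrow> (\<exists>S. (\<forall>\<rho>\<in>uncontracted. rope_walk A \<rho> (S \<rho>)) \<and> q = (\<Sum>\<rho>\<in>uncontracted. s \<rho> *\<^sub>R walk_vec A \<rho> (S \<rho>)))"
proof
  assume "q \<in> shard_sum_points"
  then obtain f where f: "\<forall>\<rho>\<in>uncontracted. f \<rho> \<in> summand_vertices \<rho>" "q = sum f uncontracted"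
    unfolding shard_sum_points_def set_sum_alt[OF finite] by blast
  then have "\<forall>\<rho>\<in>uncontracted. \<exists>S. rope_walk A \<rho> S \<and> f \<rho> = s \<rho> *\<^sub>R walk_vec A \<rho> S"
    unfolding summand_vertices_def by blast
  from bchoice[OF this] obtain S where
    S: "\<forall>\<rho>\<in>uncontracted. rope_walk A \<rho> (S \<rho>) \<and> f \<rho> = s \<rho> *\<^sub>R walk_vec A \<rho> (S \<rho>)" by blast
  then have "q = (\<Sum>\<rho>\<in>uncontracted. s \<rho> *\<^sub>R walk_vec A \<rho> (S \<rho>))" unfolding f(2) by (intro sum.cong) auto
  with S show "\<exists>S. (\<forall>\<rho>\<in>uncontracted. rope_walk A \<rho> (S \<rho>)) \<and> q = (\<Sum>\<rho>\<in>uncontracted. s \<rho> *\<^sub>R walk_vec A \<rho> (S \<rho>))" by blast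
next
  assume "\<exists>S. (\<forall>\<rho>\<in>uncontracted. rope_walk A \<rho> (S \<rho>)) \<and> q = (\<Sum>\<rho>\<in>uncontracted. s \<rho> *\<^sub>R walk_vec A \<rho> (S \<rho>))"
  then show "q \<in> shard_sum_points"
    unfolding shard_sum_points_def set_sum_alt[OF finite] summand_vertices_def by blast
qed

lemma finite_shard_sum_points: "finite shard_sum_points"
proof -
  have fin: "finite (\<Sum>\<rho>\<in>X. summand_vertices \<rho>)" if "finite X" for X
    using that
  proof (induction X rule: finite_induct)
    case empty
    then show ?case by (simp add: set_zero)
  next
    case (insert x F)
    have "finite (summand_vertices x)"
      unfolding summand_vertices_def using finite_rope_walks by (intro finite_imageI)
    then show ?case using insert by (simp add: finite_set_plus)
  qed
  show ?thesis unfolding shard_sum_points_def by (rule fin[OF finite])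
qed

lemma shard_sum_eq: "shard_sum = convex hull shard_sum_points"
proof -
  have "(\<lambda>x. s \<rho> *\<^sub>R x) ` shard_polytope A \<rho> = convex hull (summand_vertices \<rho>)" if "\<rho> \<in> uncontracted" for \<rho>
    using uncontractedD[OF that] shard_polytope_eq
    by (simp add: convex_hull_scaling[symmetric] summand_vertices_def image_image)
  then show ?thesis unfolding shard_sum_def shard_sum_points_def convex_hull_set_sum by (intro sum.cong) auto
qed

lemma optimal_walk_is_walk:
  assumes "\<rho> \<in> uncontracted" "R \<in> AR"
  shows "rope_walk A \<rho> (optimal_walk A R \<rho>)"
proof -
  have "\<rho> \<in> ropes A" using uncontractedD[OF assms(1)] by simp
  then show ?thesis by (rule rope_stable_imp_walk[OF optimal_walk_stable[OF _ assms(2)]])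
qed

lemma vertex_in_shard_sum_points: "R \<in> AR \<Longrightarrow> vertex R \<in> shard_sum_points"
  unfolding shard_sum_points_iff vertex_def by (intro exI[of _ "optimal_walk A R"] conjI ballI optimal_walk_is_walk refl)

text \<open>A functional in the normal cone need not lie in the cone of \<open>R\<close> itself, so
  for one inclusion a congruent orientation whose cone contains it has to be constructed.\<close>

lemma normal_cone_vertex:
  assumes R: "R \<in> AR"
  shows "normal_cone shard_sum {vertex R} = (\<Union>R'\<in>r `` {R}. reorientation_cone A R')"
proof (intro equalityI subsetI)
  fix c assume "c \<in> (\<Union>R'\<in>r `` {R}. reorientation_cone A R')"
  then obtain R' where R': "(R, R') \<in> r" "c \<in> reorientation_cone A R'" by blast
  have "R' \<in> AR" using cong_AR R' by blast
  have v: "vertex R = vertex R'"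
    unfolding vertex_def using optimal_walk_cong[OF R'(1)] by (intro sum.cong) auto
  have "c \<bullet> q \<le> c \<bullet> vertex R'" if q: "q \<in> shard_sum_points" for q
  proof -
    obtain S where S: "\<forall>\<rho>\<in>uncontracted. rope_walk A \<rho> (S \<rho>)" "q = (\<Sum>\<rho>\<in>uncontracted. s \<rho> *\<^sub>R walk_vec A \<rho> (S \<rho>))"
      using q unfolding shard_sum_points_iff by blast
    have "s \<rho> * (c \<bullet> walk_vec A \<rho> (S \<rho>)) \<le> s \<rho> * (c \<bullet> walk_vec A \<rho> (optimal_walk A R' \<rho>))" if "\<rho> \<in> uncontracted" for \<rho>
      using optimal_walk_max[OF _ \<open>R' \<in> AR\<close> R'(2)] S(1) uncontractedD[OF that] weight_pos[OF that] that
      by (intro mult_left_mono) auto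
    then show ?thesis unfolding S(2) vertex_def inner_sum_right inner_scaleR_right by (intro sum_mono) auto
  qed
  then show "c \<in> normal_cone shard_sum {vertex R}" unfolding shard_sum_eq normal_cone_hull v by blast
next
  fix c assume "c \<in> normal_cone shard_sum {vertex R}"
  then have c: "c \<bullet> q \<le> c \<bullet> vertex R" if "q \<in> shard_sum_points" for q
    using that unfolding shard_sum_eq normal_cone_hull by blast
  \<comment> \<open>Breaking the ties of \<open>c\<close> by \<open>R\<close> does not change the optimal walks.\<close>
  define R' where "R' = {(x, y) \<in> A. c $ y < c $ x \<or> (c $ x = c $ y \<and> (x, y) \<in> R)}"
  have R': "R' \<in> AR" "c \<in> reorientation_cone A R'" unfolding R'_def using lex_AR[OF R] by auto
  have "optimal_walk A R' \<rho> = optimal_walk A R \<rho>" if \<rho>: "\<rho> \<in> uncontracted" for \<rho>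
  proof -
    obtain u v N D where rr: "\<rho> = (u, v, N, D)" by (cases \<rho>)
    have ropes: "\<rho> \<in> ropes A" using uncontractedD[OF \<rho>] by simp
    then have uv: "(u, v) \<in> A" unfolding rr ropes_iff by simp
    define S where "S = optimal_walk A R \<rho>"
    have S: "rope_stable A R \<rho> S" unfolding S_def using optimal_walk_stable[OF ropes R] .
    have max: "c \<bullet> walk_vec A \<rho> S' \<le> c \<bullet> walk_vec A \<rho> S" if S': "rope_walk A \<rho> S'" for S'
    proof -
      \<comment> \<open>Only the summand of \<open>\<rho>\<close> is exchanged, so maximality of the
        sum passes to each summand separately; positivity of the weight is needed to cancel
        it.\<close>
      define F where "F \<tau> = (if \<tau> = \<rho> then S' else optimal_walk A R \<tau>)" for \<tau>
      have "(\<Sum>\<tau>\<in>uncontracted. s \<tau> *\<^sub>R walk_vec A \<tau> (F \<tau>)) \<in> shard_sum_points"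
        unfolding shard_sum_points_iff using S' optimal_walk_is_walk R by (intro exI[of _ F]) (auto simp: F_def)
      then have le: "c \<bullet> (\<Sum>\<tau>\<in>uncontracted. s \<tau> *\<^sub>R walk_vec A \<tau> (F \<tau>)) \<le> c \<bullet> vertex R" by (rule c)
      have "(\<Sum>\<tau>\<in>uncontracted - {\<rho>}. s \<tau> *\<^sub>R walk_vec A \<tau> (F \<tau>)) =
        (\<Sum>\<tau>\<in>uncontracted - {\<rho>}. s \<tau> *\<^sub>R walk_vec A \<tau> (optimal_walk A R \<tau>))"
        by (intro sum.cong) (auto simp: F_def)
      then have "s \<rho> * (c \<bullet> walk_vec A \<rho> S') \<le> s \<rho> * (c \<bullet> walk_vec A \<rho> S)"
        using le unfolding vertex_def sum.remove[OF finite \<rho>]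
        by (simp add: inner_add_right F_def S_def)
      then show ?thesis using weight_pos[OF \<rho>] by simp
    qed
    let ?ws = "reduced_path A u v"
    let ?walk = "walk (length ?ws) (\<lambda>i. ?ws ! i \<in> {u} \<union> N) (\<lambda>i. ?ws ! i \<in> D \<union> {v})"
    note S' = S[unfolded rr rope_stable_def prod.case]
    have wS: "?walk S" using S' unfolding stable_def by blast
    have mx: "walk_sum (\<lambda>i. c $ (?ws ! i)) S' \<le> walk_sum (\<lambda>i. c $ (?ws ! i)) S" if "?walk S'" for S'
      using max[of S'] that unfolding rr rope_walk_def prod.case inner_walk_vec by blast
    note flips = maximal_walk_flips[OF wS mx]
    \<comment> \<open>At each admissible flip, maximality of \<open>S\<close> for \<open>c\<close>
      gives the weak inequality, and where it is an equality \<open>R'\<close> follows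
      \<open>R\<close>, for which \<open>S\<close> is stable.\<close>
    have "rope_stable A R' \<rho> S"
      unfolding rr rope_stable_def prod.case stable_def
    proof (intro conjI allI impI wS)
      fix i j assume ij: "i < j \<and> j < length ?ws"
        and f: "{i<..j} \<inter> S = {} \<and> ?walk (S \<union> {i<..j})"
      have "(?ws ! i, ?ws ! j) \<notin> R" using S' ij f unfolding stable_def by blast
      moreover have "c $ (?ws ! i) \<le> c $ (?ws ! j)" using flips(1)[of i j] ij f by blast
      ultimately show "(?ws ! i, ?ws ! j) \<notin> R'" unfolding R'_def by auto
    next
      fix i j assume ij: "i < j \<and> j < length ?ws"
        and f: "{i<..j} \<subseteq> S \<and> ?walk (S - {i<..j})"
      have "(?ws ! i, ?ws ! j) \<in> R" using S' ij f unfolding stable_def by blast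
      moreover have "c $ (?ws ! j) \<le> c $ (?ws ! i)" using flips(2)[of i j] ij f by blast
      moreover have "(?ws ! i, ?ws ! j) \<in> A" using reduced_path_arc[OF uv] ij by blast
      ultimately show "(?ws ! i, ?ws ! j) \<in> R'" unfolding R'_def by auto
    qed
    then show ?thesis unfolding S_def using optimal_walk_eqI[OF ropes R'(1)] by blast
  qed
  then have "(R, R') \<in> r" using cong_if_optimal_walk_eq[OF R R'(1)] by simp
  then show "c \<in> (\<Union>R'\<in>r `` {R}. reorientation_cone A R')" using R'(2) by blast
qed

lemma normal_fan_shard_sum: "normal_fan shard_sum = quotient_fan A r"
proof -
  have empty: "{} \<in> AR" unfolding AR_def reorient_def using acyclic_arcs by simp
  have "normal_fan shard_sum = {C. C \<noteq> {} \<and> (\<exists>p\<in>vertex ` AR. C face_of normal_cone shard_sum {p})}"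
  proof (rule normal_fan_eq_faces[OF shard_sum_eq finite_shard_sum_points])
    show "vertex ` AR \<subseteq> shard_sum" unfolding shard_sum_eq by (auto intro!: hull_inc vertex_in_shard_sum_points)
    fix c
    \<comment> \<open>The orientation without reversed arcs serves as tie-breaker for an arbitrary
      \<open>c\<close>.\<close>
    obtain R where R: "R \<in> AR" "c \<in> reorientation_cone A R" using lex_AR[OF empty, of c] by blast
    then have "c \<in> normal_cone shard_sum {vertex R}" unfolding normal_cone_vertex[OF R(1)] using cong_refl by blast
    then show "\<exists>p\<in>vertex ` AR. c \<in> normal_cone shard_sum {p}" using R(1) by blast
  qed
  also have "\<dots> = {C. C \<noteq> {} \<and> (\<exists>R\<in>AR. C face_of (\<Union>R'\<in>r `` {R}. reorientation_cone A R'))}"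
    using normal_cone_vertex by (simp cong: bex_cong)
  also have "\<dots> = quotient_fan A r"
    unfolding quotient_fan_def carrier_L quotient_def by auto
  finally show ?thesis .
qed

end

theorem theorem58:
  fixes A :: "('v::finite) rel" and r :: "'v rel rel" and s :: "'v rope \<Rightarrow> real"
  assumes "acyclic A" and "skeletal A"
    and "lattice_congruence (acyclic_reorientations A) r"
    and "\<forall>\<rho>\<in>uncontracted_ropes A r. 0 < s \<rho>"
  shows "quotient_fan A r =
         normal_fan (\<Sum>\<rho>\<in>uncontracted_ropes A r. (\<lambda>x. s \<rho> *\<^sub>R x) ` shard_polytope A \<rho>)"
proof -
  interpret weighted_congruence A r s
    by unfold_locales (use assms in auto)
  show ?thesis using normal_fan_shard_sum unfolding shard_sum_def by simp
qed

end
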